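(* Consider periodic solutions $u_\theta$ of the two-dimensional Navier-Stokes equations $\frac{du}{dt}+\nu Au+B(u,u)=f$, $u(0)=\theta$, with viscosity $\nu=1/2$ and forcing $f=0$, and observations $Z^{(N)}=(Y_i,t_i,X_i)_{i=1}^N$ in the model described in the context, with either $0<T_0<T$ or $T_0=T>0$. Then there exists $c=c(U,T)>0$ such that $$\liminf_{N\to\infty}\ \inf_{\tilde\theta_N}\ \sup_{\theta\in V:\|\theta\|_{H^2}\le U}P^N_\theta\Big(\|\tilde\theta_N-\theta\|_{L^2}>\frac{c}{\log N}\Big)>\frac14,$$ where the infimum extends over all estimators $\tilde\theta_N$ of $\theta$ (i.e., all measurable functions of $Z^{(N)}$ taking values in the space $V$).
   Context: PDE. $\Omega=[0,2\pi]^2$ is the flat two-dimensional torus (all functions are $2\pi$-periodic in each coordinate). For vector fields on $\Omega$ with values in $\mathbb R^2$ let $H=\{u\in L^2(\Omega)^2:\nabla\cdot u=0,\ \int_\Omega u=0\}$ with the $L^2$ inner product, and $V=\{u\in H^1(\Omega)^2:\nabla\cdot u=0,\ \int_\Omega u=0\}$ with norm $\|u\|_V=\|\nabla u\|_{L^2}$. $P$ is the $L^2$-orthogonal (Helmholtz-Leray) projector onto $H$. $A=-P\Delta$ is the Stokes operator with domain $\mathcal D(A)=H^2(\Omega)^2\cap V$, and $B(u,v)=P[(u\cdot\nabla)v]$, where $[(u\cdot\nabla)v]_j=\sum_{i=1}^2u_i\,\partial_{x_i}v_j$. For $\theta\in V$, $u_\theta$ denotes the unique strong solution of the equation with $u(0)=\theta$,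 i.e. $u_\theta\in C([0,T],V)\cap L^2((0,T],\mathcal D(A))$, $du_\theta/dt\in L^2((0,T],H)$ and the equation holds in $H$. $U>0$ is a given radius, and $\|\cdot\|_{H^2}$ is the norm of the Sobolev space $H^2(\Omega)^2$. Observations. $T_0,T$ are fixed constants delimiting the time horizon in which measurements are taken. $Y_i=u_\theta(t_i,X_i)+\varepsilon_i$, $i=1,\dots,N$, with $\varepsilon_i$ i.i.d. $N(0,I_{\mathbb R^2})$, and $(t_i,X_i)_{i=1}^N$ i.i.d., independent of the $\varepsilon_i$, drawn from the uniform distribution $\lambda$ on $(T_0,T]\times\Omega$ if $T_0<T$; in the case $T_0=T>0$, $(T_0,T]$ is read as $\{T\}$ and $\lambda=\delta_T\otimes\lambda_\Omega$, with $\delta_T$ Dirac measure at $T$ and $\lambda_\Omega$ the uniform distribution on $\Omega$. $P^N_\theta$ is the law of $Z^{(N)}=(Y_i,t_i,X_i)_{i=1}^N$ when the initial condition is $\theta$.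
   Formalization: The constant c may depend on T_0 as well as on U and T; a c depending only on U and T, uniform over all 0<T_0<T, cannot exist, since the attainable error is of order T_0/log N for small T_0. *)

theory Defs
  imports "HOL-Probability.Probability"
begin

text \<open>
  Elements of the function spaces are represented by Borel functions on the plane that are
  2 pi-periodic in each coordinate. Two representatives describe the same element iff they agree
  almost everywhere; all predicates below are invariant under this identification.
\<close>

type_synonym vfield = "real^2 \<Rightarrow> real^2"

definition torus :: "(real^2) set" where
  "torus = {x. \<forall>i. 0 \<le> x $ i \<and> x $ i \<le> 2 * pi}"

definition periodic :: "(real^2 \<Rightarrow> 'a) \<Rightarrow> bool" where
  "periodic u \<longleftrightarrow> (\<forall>x i. u (x + axis i (2 * pi)) = u x)"

definition ae_eq :: "vfield \<Rightarrow> vfield \<Rightarrow> bool" where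
  "ae_eq u v \<longleftrightarrow> (AE x in lborel. u x = v x)"

definition L2_space :: "vfield set" where
  "L2_space = {u \<in> borel_measurable borel. periodic u \<and>
     set_integrable lborel torus (\<lambda>x. (norm (u x))\<^sup>2)}"

definition L2_inner :: "vfield \<Rightarrow> vfield \<Rightarrow> real" where
  "L2_inner u v = (LINT x:torus|lborel. u x \<bullet> v x)"

definition L2_norm :: "vfield \<Rightarrow> real" where
  "L2_norm u = sqrt (L2_inner u u)"

definition partial_deriv :: "2 \<Rightarrow> (real^2 \<Rightarrow> real) \<Rightarrow> real^2 \<Rightarrow> real" where
  "partial_deriv i \<phi> x = frechet_derivative \<phi> (at x) (axis i 1)"

text \<open>Periodic functions all of whose iterated partial derivatives exist and are differentiable,
  i.e. the smooth functions on the torus.\<close>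

definition test_functions :: "(real^2 \<Rightarrow> real) set" where
  "test_functions = {\<phi>. periodic \<phi> \<and>
     (\<forall>js x. foldr partial_deriv js \<phi> differentiable (at x))}"

definition is_weak_deriv :: "2 \<Rightarrow> vfield \<Rightarrow> vfield \<Rightarrow> bool" where
  "is_weak_deriv i u g \<longleftrightarrow> g \<in> L2_space \<and>
     (\<forall>\<phi>\<in>test_functions.
        (LINT x:torus|lborel. partial_deriv i \<phi> x *\<^sub>R u x) =
        - (LINT x:torus|lborel. \<phi> x *\<^sub>R g x))"

definition weak_deriv :: "2 \<Rightarrow> vfield \<Rightarrow> vfield" where
  "weak_deriv i u = (SOME g. is_weak_deriv i u g)"

definition H1_space :: "vfield set" where
  "H1_space = {u \<in> L2_space. \<forall>i. \<exists>g. is_weak_deriv i u g}"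

definition H2_space :: "vfield set" where
  "H2_space = {u \<in> H1_space. \<forall>i. weak_deriv i u \<in> H1_space}"

text \<open>The sum runs over the multi-indices of order at most two, so the mixed derivative is
  counted once.\<close>

definition H2_norm :: "vfield \<Rightarrow> real" where
  "H2_norm u = sqrt ((L2_norm u)\<^sup>2
     + (L2_norm (weak_deriv 1 u))\<^sup>2
     + (L2_norm (weak_deriv 2 u))\<^sup>2
     + (L2_norm (weak_deriv 1 (weak_deriv 1 u)))\<^sup>2
     + (L2_norm (weak_deriv 1 (weak_deriv 2 u)))\<^sup>2
     + (L2_norm (weak_deriv 2 (weak_deriv 2 u)))\<^sup>2)"

definition weakly_div_free :: "vfield \<Rightarrow> bool" where
  "weakly_div_free u \<longleftrightarrow>
     (\<forall>\<phi>\<in>test_functions. (LINT x:torus|lborel. (\<Sum>i\<in>UNIV. u x $ i * partial_deriv i \<phi> x)) = 0)"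

definition H_space :: "vfield set" where
  "H_space = {u \<in> L2_space. weakly_div_free u \<and> (LINT x:torus|lborel. u x) = 0}"

definition V_space :: "vfield set" where
  "V_space = {u \<in> H1_space. weakly_div_free u \<and> (LINT x:torus|lborel. u x) = 0}"

definition V_norm :: "vfield \<Rightarrow> real" where
  "V_norm u = sqrt (\<Sum>i\<in>UNIV. (L2_norm (weak_deriv i u))\<^sup>2)"

text \<open>Borel sigma-algebra of the topology that a seminorm \<^term>\<open>p\<close> induces on \<^term>\<open>X\<close>. The
  open sets are saturated under almost-everywhere equality, so on the quotient this is the
  Borel sigma-algebra of the normed space.\<close>

definition borel_of_norm :: "vfield set \<Rightarrow> (vfield \<Rightarrow> real) \<Rightarrow> vfield measure" where
  "borel_of_norm X p =
     sigma X {G. G \<subseteq> X \<and> (\<forall>u\<in>G. \<exists>e>0. \<forall>v\<in>X. p (v - u) < e \<longrightarrow> v \<in> G)}"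

definition leray :: "vfield \<Rightarrow> vfield" where
  "leray w = (SOME v. v \<in> H_space \<and> (\<forall>h\<in>H_space. L2_inner (w - v) h = 0))"

definition laplacian :: "vfield \<Rightarrow> vfield" where
  "laplacian u = (\<lambda>x. \<Sum>i\<in>UNIV. weak_deriv i (weak_deriv i u) x)"

definition stokes_domain :: "vfield set" where
  "stokes_domain = H2_space \<inter> V_space"

definition stokes :: "vfield \<Rightarrow> vfield" where
  "stokes u = (\<lambda>x. - leray (laplacian u) x)"

definition advection :: "vfield \<Rightarrow> vfield \<Rightarrow> vfield" where
  "advection u v = (\<lambda>x. \<Sum>i\<in>UNIV. (u x $ i) *\<^sub>R weak_deriv i v x)"

definition nonlin :: "vfield \<Rightarrow> vfield \<Rightarrow> vfield" where
  "nonlin u v = leray (advection u v)"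

definition C_V :: "real \<Rightarrow> (real \<Rightarrow> vfield) set" where
  "C_V T = {u. \<forall>t\<in>{0..T}. u t \<in> V_space \<and>
     ((\<lambda>s. V_norm (u s - u t)) \<longlongrightarrow> 0) (at t within {0..T})}"

text \<open>Square integrable maps from \<open>(0,T]\<close> into \<^term>\<open>X\<close>. The spaces used are separable, so
  Borel measurability is Bochner measurability.\<close>

definition time_L2 ::
  "real \<Rightarrow> vfield set \<Rightarrow> (vfield \<Rightarrow> real) \<Rightarrow> (real \<Rightarrow> vfield) set" where
  "time_L2 T X p = {w \<in> restrict_space borel {0<..T} \<rightarrow>\<^sub>M borel_of_norm X p.
     (\<integral>\<^sup>+t\<in>{0<..T}. ennreal ((p (w t))\<^sup>2) \<partial>lborel) < \<infinity>}"

text \<open>\<open>du/dt = g\<close> in H, i.e. \<open>u t - u s\<close> is the Bochner integral of \<open>g\<close> over \<open>(s,t]\<close>; the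
  latter is determined by its inner products with the elements of H.\<close>

definition has_time_deriv :: "real \<Rightarrow> (real \<Rightarrow> vfield) \<Rightarrow> (real \<Rightarrow> vfield) \<Rightarrow> bool" where
  "has_time_deriv T u g \<longleftrightarrow>
     (\<forall>h\<in>H_space. \<forall>s t. 0 \<le> s \<and> s \<le> t \<and> t \<le> T \<longrightarrow>
        L2_inner (u t) h - L2_inner (u s) h = (LINT r:{s<..t}|lborel. L2_inner (g r) h))"

text \<open>The joint measurability clause only selects a representative: every element of
  \<open>C([0,T],V)\<close> has one that is Borel in \<open>(t,x)\<close> (values at times outside \<open>[0,T]\<close> play no role).
  Any two such solutions with the same data agree for every \<open>t\<close> in \<open>[0,T]\<close> and almost every \<open>x\<close>.
  Here \<^term>\<open>w\<close> is a version of \<^term>\<open>u\<close> with values in the domain of the Stokes operator,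
  which carries the \<open>H\<^sup>2\<close> norm (equivalent to its graph norm).\<close>

definition strong_solution ::
  "real \<Rightarrow> (real \<Rightarrow> vfield) \<Rightarrow> real \<Rightarrow> vfield \<Rightarrow> (real \<Rightarrow> vfield) \<Rightarrow> bool" where
  "strong_solution \<nu> f T \<theta> u \<longleftrightarrow>
     (\<lambda>(t, x). u t x) \<in> borel_measurable borel \<and>
     u \<in> C_V T \<and>
     ae_eq (u 0) \<theta> \<and>
     (\<exists>w \<in> time_L2 T stokes_domain H2_norm. \<exists>g \<in> time_L2 T H_space L2_norm.
        (AE t in lborel. t \<in> {0<..T} \<longrightarrow> ae_eq (u t) (w t)) \<and>
        has_time_deriv T u g \<and>
        (AE t in lborel. t \<in> {0<..T} \<longrightarrow>
           ae_eq (\<lambda>x. g t x + \<nu> *\<^sub>R stokes (w t) x + nonlin (w t) (w t) x) (f t)))"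

definition ns_solution :: "real \<Rightarrow> (real \<Rightarrow> vfield) \<Rightarrow> real \<Rightarrow> vfield \<Rightarrow> real \<Rightarrow> vfield" where
  "ns_solution \<nu> f T \<theta> = (SOME u. strong_solution \<nu> f T \<theta> u)"

type_synonym observation = "(real^2) \<times> real \<times> (real^2)"

definition std_gaussian :: "(real^2) measure" where
  "std_gaussian = density lborel (\<lambda>y. ennreal (\<Prod>i\<in>UNIV. std_normal_density (y $ i)))"

definition design_law :: "real \<Rightarrow> real \<Rightarrow> (real \<times> (real^2)) measure" where
  "design_law T0 T =
     (if T0 < T then uniform_measure lborel ({T0<..T} \<times> torus)
      else return borel T \<Otimes>\<^sub>M uniform_measure lborel torus)"

definition sample_space :: "nat \<Rightarrow> (nat \<Rightarrow> observation) measure" where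
  "sample_space N = (\<Pi>\<^sub>M i\<in>{..<N}. borel)"

text \<open>The law of \<open>(Y\<^sub>i, t\<^sub>i, X\<^sub>i)\<close>, \<open>i < N\<close>, with \<open>Y\<^sub>i = u t\<^sub>i X\<^sub>i + \<epsilon>\<^sub>i\<close>; it depends on \<^term>\<open>u\<close>
  only up to almost-everywhere equality in space at each time.\<close>

definition data_law :: "real \<Rightarrow> real \<Rightarrow> (real \<Rightarrow> vfield) \<Rightarrow> nat \<Rightarrow> (nat \<Rightarrow> observation) measure" where
  "data_law T0 T u N =
     distr (\<Pi>\<^sub>M i\<in>{..<N}. std_gaussian \<Otimes>\<^sub>M design_law T0 T) (sample_space N)
       (\<lambda>\<omega>. \<lambda>i\<in>{..<N}. case \<omega> i of (\<epsilon>, t, x) \<Rightarrow> (u t x + \<epsilon>, t, x))"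

definition estimators :: "nat \<Rightarrow> ((nat \<Rightarrow> observation) \<Rightarrow> vfield) set" where
  "estimators N = sample_space N \<rightarrow>\<^sub>M borel_of_norm V_space V_norm"

end

theory Submission
  imports Defs
begin

text \<open>
  A shear flow \<open>\<theta>(x) = (0, c sin (k x\<^sub>1))\<close> is an eigenfunction of the Stokes operator on which the
  nonlinearity vanishes, so the solution started at it is \<open>exp (- k\<^sup>2 t / 2) \<theta>\<close>. With
  \<open>c = U / (10 k\<^sup>2)\<close> it lies in the \<open>H\<^sup>2\<close> ball of radius \<open>U\<close>, at \<open>L\<^sup>2\<close> distance of order \<open>1 / k\<^sup>2\<close> from
  \<open>0\<close>. For \<open>k\<^sup>2\<close> of order \<open>log N / T\<^sub>0\<close> the solution is at most \<open>U / N\<^sup>2\<close> from time \<open>T\<^sub>0\<close> on, so \<open>N\<close>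
  observations with Gaussian noise cannot tell \<open>\<theta>\<close> from \<open>0\<close>, although the two are separated by a multiple
  of \<open>1 / log N\<close>; this is Le Cam's two point argument.

  The solution is only known to be some strong solution, hence uniqueness is needed. It is an energy
  estimate for the difference \<open>d\<close> to the explicit solution, in which \<open>(u \<cdot> \<nabla>d, d)\<close> vanishes and the
  remaining term is controlled by the gradient of the explicit solution. Sobolev's embedding, Poincare's
  inequality and the integrations by parts with non-smooth fields all come from Fourier series.
\<close>

section \<open>The torus as a measure space\<close>

text \<open>Fields are plain functions, and \<open>weak_deriv\<close>, \<open>leray\<close> and
  \<open>ns_solution\<close> are arbitrary choices, so every concrete fact about them holds only up
  to null sets and rests on a uniqueness statement: completeness of the trigonometric system for
  weak derivatives, orthogonality for \<open>leray\<close>, the energy estimate for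
  \<open>ns_solution\<close>. The last one must give equality at every time, because the design may
  be a point mass at \<open>T\<close>.

  The two hypotheses are not compared with each other, but each with the law of pure noise, under
  which the two error events together have mass at least one. For zero amplitude this comparison is
  free, so a single error term remains. The Gaussian comparison is linear in the size \<delta> of
  the solution, hence N observations cost about N \<delta>; with \<delta> of order 1 / N^2 the cost
  is of order 1 / N. Asking for this power of N affects the constant but not the rate 1 / log N.

  Real sines and cosines are summed over all integer frequencies, so each mode is counted with both
  signs; this fixes the normalisations.\<close>

definition torm :: "(real^2) measure" where "torm = restrict_space lborel torus"

lemma torus_eq_cbox: "torus = cbox 0 (\<chi> i. 2 * pi)"
  by (auto simp: torus_def mem_box_cart)

lemma torus_sets [measurable]: "torus \<in> sets borel"
  by (simp add: torus_eq_cbox)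

lemma compact_torus: "compact torus"
  by (simp add: torus_eq_cbox compact_cbox)

lemma set_integral_torus:
  fixes f :: "real^2 \<Rightarrow> 'b::{banach, second_countable_topology}"
  shows "(LINT x:torus|lborel. f x) = integral\<^sup>L torm f"
  by (simp add: torm_def integral_restrict_space set_lebesgue_integral_def)

lemma set_integrable_torus:
  fixes f :: "real^2 \<Rightarrow> 'b::{banach, second_countable_topology}"
  shows "set_integrable lborel torus f \<longleftrightarrow> integrable torm f"
  by (simp add: torm_def integrable_restrict_space set_integrable_def)

lemma space_torm [simp]: "space torm = torus"
  by (simp add: torm_def space_restrict_space)

lemma sets_torm: "sets torm = sets (restrict_space borel torus)"
  by (simp add: torm_def sets_restrict_space)

lemma borel_measurable_torm: "f \<in> borel \<rightarrow>\<^sub>M N \<Longrightarrow> f \<in> torm \<rightarrow>\<^sub>M N"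
  by (simp add: torm_def measurable_restrict_space1)

lemma AE_torm: "(AE x in torm. P x) \<longleftrightarrow> (AE x in lborel. x \<in> torus \<longrightarrow> P x)"
  unfolding torm_def by (subst AE_restrict_space_iff) auto

lemma prod_Basis_real2: "(\<Prod>b\<in>(Basis::(real^2) set). f b) = (\<Prod>i\<in>UNIV. f (axis i 1))"
proof -
  have 1: "(Basis::(real^2) set) = (\<lambda>i. axis i 1) ` UNIV"
    by (auto simp: Basis_vec_def)
  have 2: "inj (\<lambda>i::2. axis i (1::real))"
    by (auto simp: inj_on_def axis_eq_axis)
  show ?thesis
    unfolding 1 by (subst prod.reindex[OF 2]) simp
qed

lemma emeasure_torm: "emeasure torm torus = ennreal (4 * pi\<^sup>2)"
proof -
  have "emeasure lborel torus = ennreal (\<Prod>b\<in>Basis. ((\<chi> i. 2 * pi) - (0::real^2)) \<bullet> b)"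
    unfolding torus_eq_cbox by (subst emeasure_lborel_cbox) (auto simp: Basis_vec_def inner_axis)
  also have "\<dots> = ennreal (4 * pi\<^sup>2)"
    by (simp add: prod_Basis_real2 inner_axis power2_eq_square)
  finally show ?thesis by (simp add: torm_def emeasure_restrict_space)
qed

lemma finite_measure_torm: "finite_measure torm"
  by standard (simp add: emeasure_torm)

interpretation torm: finite_measure torm by (rule finite_measure_torm)

lemma measure_torm: "measure torm torus = 4 * pi\<^sup>2"
  by (simp add: measure_def emeasure_torm)

section \<open>Coordinates of the plane and Fubini's theorem\<close>

definition mk2 :: "real \<Rightarrow> real \<Rightarrow> real^2" where "mk2 a b = (\<chi> i. if i = 1 then a else b)"

lemma mk2_nth [simp]: "mk2 a b $ 1 = a" "mk2 a b $ 2 = b"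
  by (simp_all add: mk2_def)

lemma mk2_eta: "mk2 (x $ 1) (x $ 2) = x"
  by (simp add: vec_eq_iff forall_2)

lemma mk2_eq: "mk2 a b = a *\<^sub>R axis 1 1 + b *\<^sub>R axis 2 1"
  by (simp add: vec_eq_iff forall_2 axis_def)

lemma continuous_mk2: "continuous_on UNIV (\<lambda>(a, b). mk2 a b)"
  unfolding mk2_eq case_prod_unfold by (intro continuous_intros)

lemma mk2_measurable [measurable]: "(\<lambda>(a, b). mk2 a b) \<in> borel_measurable (lborel \<Otimes>\<^sub>M lborel)"
proof -
  have "(\<lambda>(a, b). mk2 a b) \<in> borel_measurable borel"
    by (rule borel_measurable_continuous_onI[OF continuous_mk2])
  then show ?thesis by (simp add: lborel_prod)
qed

text \<open>Lebesgue measure is determined by its values on boxes, and a box is a product of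
  intervals. In this form iterated integrals over the two coordinates become available for functions
  on \<open>real^2\<close>.\<close>

lemma lborel_eq_mk2: "lborel = distr (lborel \<Otimes>\<^sub>M lborel) borel (\<lambda>(a, b). mk2 a b)"
proof (rule lborel_eqI)
  fix l u :: "real^2"
  assume "\<And>b. b \<in> Basis \<Longrightarrow> l \<bullet> b \<le> u \<bullet> b"
  then have le: "l $ i \<le> u $ i" for i
    by (metis axis_in_Basis_iff cart_eq_inner_axis inner_real_def one_neq_zero real_inner_1_right Basis_real_def singletonI)
  have "emeasure (distr (lborel \<Otimes>\<^sub>M lborel) borel (\<lambda>(a, b). mk2 a b)) (box l u)
      = emeasure (lborel \<Otimes>\<^sub>M lborel) ((\<lambda>(a, b). mk2 a b) -` box l u \<inter> space (lborel \<Otimes>\<^sub>M lborel))"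
    by (subst emeasure_distr) auto
  also have "(\<lambda>(a, b). mk2 a b) -` box l u \<inter> space (lborel \<Otimes>\<^sub>M lborel) = box (l$1) (u$1) \<times> box (l$2) (u$2)"
    by (auto simp: mem_box_cart forall_2 space_pair_measure)
  also have "emeasure (lborel \<Otimes>\<^sub>M lborel) \<dots> = ennreal ((u$1 - l$1) * (u$2 - l$2))"
    by (subst lborel.emeasure_pair_measure_Times) (auto simp: le ennreal_mult)
  also have "(u$1 - l$1) * (u$2 - l$2) = (\<Prod>b\<in>Basis. (u - l) \<bullet> b)"
    by (simp add: prod_Basis_real2 inner_axis UNIV_2)
  finally show "emeasure (distr (lborel \<Otimes>\<^sub>M lborel) borel (\<lambda>(a, b). mk2 a b)) (box l u) =
    ennreal (\<Prod>b\<in>Basis. (u - l) \<bullet> b)" .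
qed simp

lemma periodicD: "periodic u \<Longrightarrow> u (x + axis i (2 * pi)) = u x"
  by (simp add: periodic_def)

lemma indicator_torus_mk2:
  "indicator torus (mk2 a b) = (indicator {0..2*pi} a * indicator {0..2*pi} b :: real)"
  by (auto simp: torus_def forall_2 split: split_indicator)

text \<open>Along a line in direction \<open>i\<close> the integral over one period is the
  difference of two values of \<phi> at points one period apart, hence zero; Fubini does the rest.
  All integrations by parts on the torus go back to this.\<close>

lemma integral_torm_partial_deriv:
  fixes \<phi> :: "real^2 \<Rightarrow> real"
  assumes per: "periodic \<phi>" and diff: "\<And>x. \<phi> differentiable (at x)"
    and cont: "continuous_on UNIV (partial_deriv i \<phi>)"
  shows "integral\<^sup>L torm (partial_deriv i \<phi>) = 0"
proof -
  let ?F = "\<lambda>x. indicator torus x *\<^sub>R partial_deriv i \<phi> x"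
  have meas: "partial_deriv i \<phi> \<in> borel_measurable borel"
    by (rule borel_measurable_continuous_onI[OF cont])
  have intF: "integrable lborel ?F"
    by (rule borel_integrable_compact[OF compact_torus]) (rule continuous_on_subset[OF cont], simp)
  have intG: "integrable (lborel \<Otimes>\<^sub>M lborel) (\<lambda>(a, b). ?F (mk2 a b))"
  proof -
    have "integrable (distr (lborel \<Otimes>\<^sub>M lborel) borel (\<lambda>(a, b). mk2 a b)) ?F"
      using intF by (subst (asm) lborel_eq_mk2)
    from integrable_distr[OF _ this] show ?thesis by (simp add: case_prod_unfold)
  qed
  have I: "integral\<^sup>L torm (partial_deriv i \<phi>) = integral\<^sup>L (lborel \<Otimes>\<^sub>M lborel) (\<lambda>(a, b). ?F (mk2 a b))"
  proof -
    have "integral\<^sup>L torm (partial_deriv i \<phi>) = integral\<^sup>L lborel ?F"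
      by (simp add: torm_def integral_restrict_space)
    also have "\<dots> = integral\<^sup>L (distr (lborel \<Otimes>\<^sub>M lborel) borel (\<lambda>(a, b). mk2 a b)) ?F"
      by (subst lborel_eq_mk2) simp
    also have "\<dots> = integral\<^sup>L (lborel \<Otimes>\<^sub>M lborel) (\<lambda>(a, b). ?F (mk2 a b))"
      using meas by (subst integral_distr) (auto simp: case_prod_unfold)
    finally show ?thesis .
  qed
  have line: "(\<integral>s. indicator {0..2*pi} s *\<^sub>R partial_deriv i \<phi> (y + s *\<^sub>R axis i 1) \<partial>lborel) = 0" for y
  proof -
    have "(\<integral>s. indicator {0..2*pi} s *\<^sub>R partial_deriv i \<phi> (y + s *\<^sub>R axis i 1) \<partial>lborel)
      = \<phi> (y + (2*pi) *\<^sub>R axis i 1) - \<phi> (y + 0 *\<^sub>R axis i 1)"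
    proof (rule integral_FTC_atLeastAtMost)
      fix s :: real
      have "(\<phi> has_derivative frechet_derivative \<phi> (at (y + s *\<^sub>R axis i 1))) (at (y + s *\<^sub>R axis i 1))"
        using diff frechet_derivative_works by blast
      then have "((\<lambda>s. \<phi> (y + s *\<^sub>R axis i 1)) has_derivative
          (\<lambda>h. frechet_derivative \<phi> (at (y + s *\<^sub>R axis i 1)) (h *\<^sub>R axis i 1))) (at s)"
        by (rule has_derivative_compose[rotated]) (auto intro!: derivative_eq_intros)
      moreover have "frechet_derivative \<phi> (at (y + s *\<^sub>R axis i 1)) (h *\<^sub>R axis i 1)
         = h *\<^sub>R partial_deriv i \<phi> (y + s *\<^sub>R axis i 1)" for h
        unfolding partial_deriv_def
        using linear_frechet_derivative[OF diff] by (simp add: linear_cmul)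
      ultimately show "((\<lambda>s. \<phi> (y + s *\<^sub>R axis i 1)) has_vector_derivative
          partial_deriv i \<phi> (y + s *\<^sub>R axis i 1)) (at s within {0..2*pi})"
        by (auto simp: has_vector_derivative_def intro: has_derivative_at_withinI)
    next
      show "continuous_on {0..2*pi} (\<lambda>s. partial_deriv i \<phi> (y + s *\<^sub>R axis i 1))"
        by (rule continuous_on_compose2[OF cont]) (auto intro!: continuous_intros)
    qed simp
    also have "y + (2*pi) *\<^sub>R axis i 1 = y + axis i (2*pi)"
      by (simp add: vec_eq_iff axis_def)
    finally show ?thesis using periodicD[OF per, of y i] by simp
  qed
  \<comment> \<open>The integration along direction \<open>i\<close> has to be the inner one, so the
    two cases use opposite orders of integration.\<close>
  consider "i = 1" | "i = 2" using exhaust_2 by blast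
  then show ?thesis
  proof cases
    case 1
    have *: "mk2 0 b + a *\<^sub>R axis 1 1 = mk2 a b" for a b
      by (simp add: mk2_eq)
    have "?F (mk2 a b) = indicator {0..2*pi} b *\<^sub>R
        (indicator {0..2*pi} a *\<^sub>R partial_deriv i \<phi> (mk2 0 b + a *\<^sub>R axis i 1))" for a b
      by (simp add: 1 * indicator_torus_mk2)
    then have "(\<integral>a. ?F (mk2 a b) \<partial>lborel) = 0" for b
      using line[of "mk2 0 b"] by (simp only: integral_scaleR_right) simp
    then show ?thesis
      using lborel_pair.integral_snd[OF intG] I by simp
  next
    case 2
    have *: "mk2 a 0 + b *\<^sub>R axis 2 1 = mk2 a b" for a b
      by (simp add: mk2_eq)
    have "?F (mk2 a b) = indicator {0..2*pi} a *\<^sub>R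
        (indicator {0..2*pi} b *\<^sub>R partial_deriv i \<phi> (mk2 a 0 + b *\<^sub>R axis i 1))" for a b
      by (simp add: 2 * indicator_torus_mk2)
    then have "(\<integral>b. ?F (mk2 a b) \<partial>lborel) = 0" for a
      using line[of "mk2 a 0"] by (simp only: integral_scaleR_right) simp
    then show ?thesis
      using lborel_pair.integral_fst'[OF intG] I by simp
  qed
qed

section \<open>Translations by the period lattice\<close>

definition lattice_vec :: "int \<times> int \<Rightarrow> real^2" where
  "lattice_vec m = mk2 (of_int (fst m) * (2*pi)) (of_int (snd m) * (2*pi))"

lemma periodic_lattice_vec:
  assumes per: "periodic P" shows "P (x + lattice_vec m) = P x"
proof -
  have step: "P (x + axis i (of_int k * (2*pi))) = P x" for x i k
  proof (induction k arbitrary: x rule: int_induct[where k=0])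
    case base then show ?case by (simp add: axis_def vec_eq_iff zero_vec_def[symmetric])
  next
    case (step1 k)
    have "x + axis i (of_int (k+1) * (2*pi)) = (x + axis i (of_int k * (2*pi))) + axis i (2*pi)"
      by (simp add: vec_eq_iff axis_def algebra_simps)
    then show ?case using step1 periodicD[OF per] by metis
  next
    case (step2 k)
    have "x + axis i (of_int k * (2*pi)) = (x + axis i (of_int (k-1) * (2*pi))) + axis i (2*pi)"
      by (simp add: vec_eq_iff axis_def algebra_simps)
    then show ?case using step2 periodicD[OF per] by metis
  qed
  have "x + lattice_vec m = (x + axis 1 (of_int (fst m) * (2*pi))) + axis 2 (of_int (snd m) * (2*pi))"
    by (simp add: lattice_vec_def vec_eq_iff forall_2 axis_def)
  then show ?thesis using step by metis
qed

lemma ex_lattice_vec_torus: "\<exists>m. x + lattice_vec m \<in> torus"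
proof -
  define m where "m = (- \<lfloor>x$1 / (2*pi)\<rfloor>, - \<lfloor>x$2 / (2*pi)\<rfloor>)"
  have "0 \<le> r + of_int (- \<lfloor>r/(2*pi)\<rfloor>) * (2*pi) \<and> r + of_int (- \<lfloor>r/(2*pi)\<rfloor>) * (2*pi) \<le> 2*pi" for r
  proof -
    define q :: real where "q = of_int \<lfloor>r/(2*pi)\<rfloor>"
    have "q \<le> r/(2*pi)" "r/(2*pi) \<le> q + 1" unfolding q_def by linarith+
    then have "0 \<le> r - q * (2*pi) \<and> r - q * (2*pi) \<le> 2*pi" by (simp add: field_simps)
    then show ?thesis by (simp add: q_def)
  qed
  then have "x + lattice_vec m \<in> torus"
    by (simp add: torus_def forall_2 lattice_vec_def m_def)
  then show ?thesis ..
qed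

lemma periodic_ex_torus: "periodic u \<Longrightarrow> \<exists>y\<in>torus. u y = u x"
  using ex_lattice_vec_torus[of x] periodic_lattice_vec[of u x] by metis

text \<open>Countably many lattice translates of \<open>torus\<close> cover the plane, and
  \<open>lborel\<close> is translation invariant, so the exceptional set is a countable union of
  null sets. This links \<open>ae_eq\<close>, which speaks of the whole plane, with integrals over
  \<open>torm\<close>.\<close>

lemma AE_periodic:
  assumes per: "periodic P" and ae: "AE x in torm. P x"
  shows "AE x in lborel. P x"
proof -
  have "AE x in lborel. x + lattice_vec m \<in> torus \<longrightarrow> P (x + lattice_vec m)" for m
  proof (rule AE_distrD[where M'=borel and f="\<lambda>x. x + lattice_vec m"])
    show "AE x in distr lborel borel (\<lambda>x. x + lattice_vec m). x \<in> torus \<longrightarrow> P x"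
    proof -
      have eq: "(\<lambda>x. x + lattice_vec m) = (+) (lattice_vec m)" by (auto simp: add.commute)
      show ?thesis unfolding eq lborel_distr_plus using ae by (simp add: AE_torm)
    qed
  qed simp
  then have "AE x in lborel. \<forall>m. x + lattice_vec m \<in> torus \<longrightarrow> P (x + lattice_vec m)"
    by (simp add: AE_all_countable)
  then show ?thesis
    by eventually_elim (metis ex_lattice_vec_torus periodic_lattice_vec[OF per])
qed

section \<open>The space of square integrable periodic fields\<close>

lemma L2_inner_eq: "L2_inner u v = (\<integral>x. u x \<bullet> v x \<partial>torm)"
  by (simp add: L2_inner_def set_integral_torus)

lemma L2_spaceI:
  "u \<in> borel_measurable borel \<Longrightarrow> periodic u \<Longrightarrow> integrable torm (\<lambda>x. (norm (u x))\<^sup>2) \<Longrightarrow> u \<in> L2_space"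
  by (simp add: L2_space_def set_integrable_torus)

lemma L2_space_borel: "u \<in> L2_space \<Longrightarrow> u \<in> borel_measurable borel"
  and L2_space_measurable [measurable_dest]: "u \<in> L2_space \<Longrightarrow> u \<in> borel_measurable torm"
  and L2_space_periodic: "u \<in> L2_space \<Longrightarrow> periodic u"
  and L2_space_integrable_sq: "u \<in> L2_space \<Longrightarrow> integrable torm (\<lambda>x. (norm (u x))\<^sup>2)"
  by (auto simp: L2_space_def set_integrable_torus intro: borel_measurable_torm)

text \<open>The torus has finite measure, so \<open>1 + (norm (u x))\<^sup>2\<close> is an
  integrable majorant.\<close>

lemma L2_space_integrable:
  assumes "u \<in> L2_space" shows "integrable torm u"
proof (rule Bochner_Integration.integrable_bound)
  show "integrable torm (\<lambda>x. 1 + (norm (u x))\<^sup>2)"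
    using L2_space_integrable_sq[OF assms] by simp
  have "r \<le> 1 + r\<^sup>2" for r :: real
    using zero_le_power2[of "r - 1/2"] by (simp add: power2_diff power2_eq_square[of "1/2"])
  then show "AE x in torm. norm (u x) \<le> norm (1 + (norm (u x))\<^sup>2)"
    by auto
qed (use assms in measurable)

lemma L2_inner_integrable:
  assumes "u \<in> L2_space" "v \<in> L2_space" shows "integrable torm (\<lambda>x. u x \<bullet> v x)"
proof (rule Bochner_Integration.integrable_bound)
  show "integrable torm (\<lambda>x. (norm (u x))\<^sup>2 + (norm (v x))\<^sup>2)"
    using assms L2_space_integrable_sq by auto
  have "norm (u x \<bullet> v x) \<le> norm ((norm (u x))\<^sup>2 + (norm (v x))\<^sup>2)" for x
  proof -
    have "\<bar>u x \<bullet> v x\<bar> \<le> norm (u x) * norm (v x)" by (rule Cauchy_Schwarz_ineq2)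
    also have "\<dots> \<le> (norm (u x))\<^sup>2 + (norm (v x))\<^sup>2"
      using sum_squares_bound[of "norm (u x)" "norm (v x)"] mult_nonneg_nonneg[OF norm_ge_zero[of "u x"] norm_ge_zero[of "v x"]]
      by linarith
    finally show ?thesis by simp
  qed
  then show "AE x in torm. norm (u x \<bullet> v x) \<le> norm ((norm (u x))\<^sup>2 + (norm (v x))\<^sup>2)" by auto
qed (use assms in measurable)

lemma L2_add: "(\<lambda>x. u x + v x) \<in> L2_space" if u: "u \<in> L2_space" and v: "v \<in> L2_space"
proof (rule L2_spaceI)
  show "(\<lambda>x. u x + v x) \<in> borel_measurable borel"
    using L2_space_borel[OF u] L2_space_borel[OF v] by simp
  show "periodic (\<lambda>x. u x + v x)"
    using L2_space_periodic[OF u] L2_space_periodic[OF v] by (simp add: periodic_def)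
  have "(\<lambda>x. (norm (u x + v x))\<^sup>2) = (\<lambda>x. (norm (u x))\<^sup>2 + 2 * (u x \<bullet> v x) + (norm (v x))\<^sup>2)"
    by (simp add: dot_norm field_simps)
  then show "integrable torm (\<lambda>x. (norm (u x + v x))\<^sup>2)"
    using u v L2_inner_integrable L2_space_integrable_sq by simp
qed

lemma L2_mult_bounded:
  assumes u: "u \<in> L2_space" and c: "c \<in> borel_measurable borel" "periodic c" and b: "AE x in torm. \<bar>c x\<bar> \<le> K"
  shows "(\<lambda>x. c x *\<^sub>R u x) \<in> L2_space"
proof (rule L2_spaceI)
  note [measurable] = L2_space_borel[OF u] c(1)
  show "(\<lambda>x. c x *\<^sub>R u x) \<in> borel_measurable borel" by measurable
  show "periodic (\<lambda>x. c x *\<^sub>R u x)"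
    using L2_space_periodic[OF u] c by (simp add: periodic_def)
  show "integrable torm (\<lambda>x. (norm (c x *\<^sub>R u x))\<^sup>2)"
  proof (rule Bochner_Integration.integrable_bound)
    show "integrable torm (\<lambda>x. K\<^sup>2 * (norm (u x))\<^sup>2)" using L2_space_integrable_sq[OF u] by simp
    show "AE x in torm. norm ((norm (c x *\<^sub>R u x))\<^sup>2) \<le> norm (K\<^sup>2 * (norm (u x))\<^sup>2)"
      using b
    proof eventually_elim
      case (elim x)
      then have "\<bar>c x\<bar>\<^sup>2 \<le> K\<^sup>2" by (intro power_mono) auto
      then show ?case by (simp add: power_mult_distrib mult_right_mono)
    qed
  qed (rule borel_measurable_torm, measurable)
qed

lemma L2_scale: "(\<lambda>x. c *\<^sub>R u x) \<in> L2_space" if "u \<in> L2_space"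
  using L2_mult_bounded[OF that, of "\<lambda>_. c" "\<bar>c\<bar>"] by (simp add: periodic_def)

lemma L2_uminus: "(\<lambda>x. - u x) \<in> L2_space" if "u \<in> L2_space"
  using L2_scale[OF that, of "-1"] by simp

lemma L2_diff: "(\<lambda>x. u x - v x) \<in> L2_space" if u: "u \<in> L2_space" and v: "v \<in> L2_space"
  using L2_add[OF u L2_uminus[OF v]] by simp

lemma L2_bounded:
  assumes "u \<in> borel_measurable borel" "periodic u" "\<And>x. norm (u x) \<le> K"
  shows "u \<in> L2_space"
proof (rule L2_spaceI[OF assms(1,2)])
  show "integrable torm (\<lambda>x. (norm (u x))\<^sup>2)"
  proof (rule torm.integrable_const_bound[where B="K\<^sup>2"])
    show "AE x in torm. norm ((norm (u x))\<^sup>2) \<le> K\<^sup>2"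
      using assms(3) by (auto intro!: power_mono)
  qed (rule borel_measurable_torm, use assms(1) in measurable)
qed

lemma L2_zero: "(\<lambda>x. 0) \<in> L2_space"
  by (rule L2_bounded[where K=0]) (auto simp: periodic_def)

lemma L2_inner_commute: "L2_inner u v = L2_inner v u"
  by (simp add: L2_inner_eq inner_commute)

lemma L2_inner_add_left:
  "u \<in> L2_space \<Longrightarrow> v \<in> L2_space \<Longrightarrow> h \<in> L2_space \<Longrightarrow> L2_inner (\<lambda>x. u x + v x) h = L2_inner u h + L2_inner v h"
  by (simp add: L2_inner_eq inner_add_left L2_inner_integrable)

lemma L2_inner_diff_left:
  "u \<in> L2_space \<Longrightarrow> v \<in> L2_space \<Longrightarrow> h \<in> L2_space \<Longrightarrow> L2_inner (\<lambda>x. u x - v x) h = L2_inner u h - L2_inner v h"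
  by (simp add: L2_inner_eq inner_diff_left L2_inner_integrable)

lemma L2_inner_scale_left: "L2_inner (\<lambda>x. c *\<^sub>R u x) h = c * L2_inner u h"
  by (simp add: L2_inner_eq)

lemma L2_inner_add_right:
  "u \<in> L2_space \<Longrightarrow> v \<in> L2_space \<Longrightarrow> h \<in> L2_space \<Longrightarrow> L2_inner h (\<lambda>x. u x + v x) = L2_inner h u + L2_inner h v"
  by (simp add: L2_inner_commute[of h] L2_inner_add_left)

lemma L2_inner_diff_right:
  "u \<in> L2_space \<Longrightarrow> v \<in> L2_space \<Longrightarrow> h \<in> L2_space \<Longrightarrow> L2_inner h (\<lambda>x. u x - v x) = L2_inner h u - L2_inner h v"
  by (simp add: L2_inner_commute[of h] L2_inner_diff_left)

lemma L2_inner_scale_right: "L2_inner h (\<lambda>x. c *\<^sub>R u x) = c * L2_inner h u"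
  by (simp add: L2_inner_commute[of h] L2_inner_scale_left)

lemma L2_inner_self_nonneg: "0 \<le> L2_inner u u"
  by (simp add: L2_inner_eq)

lemma L2_norm_nonneg [simp]: "0 \<le> L2_norm u"
  by (simp add: L2_norm_def L2_inner_self_nonneg)

lemma L2_norm_sq: "(L2_norm u)\<^sup>2 = L2_inner u u"
  by (simp add: L2_norm_def L2_inner_self_nonneg)

lemma L2_norm_sq_integral: "(L2_norm u)\<^sup>2 = (\<integral>x. (norm (u x))\<^sup>2 \<partial>torm)"
  by (simp add: L2_norm_sq L2_inner_eq power2_norm_eq_inner)

lemma L2_norm_scale: "L2_norm (\<lambda>x. c *\<^sub>R u x) = \<bar>c\<bar> * L2_norm u"
  by (simp add: L2_norm_def L2_inner_scale_left L2_inner_scale_right real_sqrt_mult)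

lemma L2_norm_uminus: "L2_norm (\<lambda>x. - u x) = L2_norm u"
  using L2_norm_scale[of "-1" u] by simp

lemma L2_norm_zero [simp]: "L2_norm (\<lambda>x. 0) = 0"
  by (simp add: L2_norm_def L2_inner_eq)

lemma L2_norm_diff_sq:
  assumes "u \<in> L2_space" "v \<in> L2_space"
  shows "(L2_norm (\<lambda>x. u x - v x))\<^sup>2 = (L2_norm u)\<^sup>2 - 2 * L2_inner u v + (L2_norm v)\<^sup>2"
  using assms by (simp add: L2_norm_sq L2_inner_diff_left L2_inner_diff_right L2_diff L2_inner_commute[of v u])

lemma L2_norm_add_sq:
  assumes "u \<in> L2_space" "v \<in> L2_space"
  shows "(L2_norm (\<lambda>x. u x + v x))\<^sup>2 = (L2_norm u)\<^sup>2 + 2 * L2_inner u v + (L2_norm v)\<^sup>2"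
  using assms by (simp add: L2_norm_sq L2_inner_add_left L2_inner_add_right L2_add L2_inner_commute[of v u])

text \<open>Nonnegativity of the quadratic form \<open>q\<close> in the two coefficients. On
  representatives \<open>L2_norm\<close> is only a seminorm, so the case of a vanishing norm is
  treated apart: there the form is affine in one coefficient and could become negative unless the
  inner product is zero.\<close>

lemma L2_Cauchy_Schwarz:
  assumes u: "u \<in> L2_space" and v: "v \<in> L2_space"
  shows "\<bar>L2_inner u v\<bar> \<le> L2_norm u * L2_norm v"
proof -
  have q: "0 \<le> a\<^sup>2 * (L2_norm u)\<^sup>2 - 2 * a * b * L2_inner u v + b\<^sup>2 * (L2_norm v)\<^sup>2" for a b
  proof -
    have "0 \<le> (L2_norm (\<lambda>x. a *\<^sub>R u x - b *\<^sub>R v x))\<^sup>2" by simp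
    also have "\<dots> = a\<^sup>2 * (L2_norm u)\<^sup>2 - 2 * a * b * L2_inner u v + b\<^sup>2 * (L2_norm v)\<^sup>2"
      by (subst L2_norm_diff_sq[OF L2_scale[OF u] L2_scale[OF v]])
        (simp add: L2_norm_scale L2_inner_scale_left L2_inner_scale_right power_mult_distrib)
    finally show ?thesis .
  qed
  define p r s where "p = L2_norm u" and "r = L2_norm v" and "s = L2_inner u v"
  have p: "p \<ge> 0" and r: "r \<ge> 0" by (auto simp: p_def r_def)
  have q': "0 \<le> a\<^sup>2 * p\<^sup>2 - 2 * a * b * s + b\<^sup>2 * r\<^sup>2" for a b using q by (simp add: p_def r_def s_def)
  show ?thesis
  proof (cases "p = 0 \<or> r = 0")
    case True
    then show ?thesis
    proof
      assume "p = 0"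
      have "s = 0"
      proof (rule ccontr)
        assume "s \<noteq> 0"
        \<comment> \<open>With this first coefficient the cross term is
          \<open>r\<^sup>2 + 1\<close>, one more than the only square that remains, so the form
          would take the value \<open>-1\<close>.\<close>
        then have "2 * ((r\<^sup>2 + 1) / (2 * s)) * 1 * s = r\<^sup>2 + 1" by simp
        with q'[of "(r\<^sup>2 + 1) / (2 * s)" 1] \<open>p = 0\<close> show False by simp
      qed
      then show ?thesis using p r by (simp add: p_def r_def s_def)
    next
      assume "r = 0"
      have "s = 0"
      proof (rule ccontr)
        assume "s \<noteq> 0"
        then have "2 * 1 * ((p\<^sup>2 + 1) / (2 * s)) * s = p\<^sup>2 + 1" by simp
        with q'[of 1 "(p\<^sup>2 + 1) / (2 * s)"] \<open>r = 0\<close> show False by simp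
      qed
      then show ?thesis using p r by (simp add: p_def r_def s_def)
    qed
  next
    case False
    then have pr: "p > 0" "r > 0" using p r by auto
    have "2 * p * r * s \<le> 2 * p * r * (p * r)" 
      using q'[of r p] by (simp add: power2_eq_square algebra_simps)
    then have 1: "s \<le> p * r" using pr by (simp add: mult_le_cancel_left)
    have "2 * p * r * (- s) \<le> 2 * p * r * (p * r)" 
      using q'[of r "-p"] by (simp add: power2_eq_square algebra_simps)
    then have 2: "- s \<le> p * r" using pr by (simp only: mult_le_cancel_left) simp
    show ?thesis using 1 2 by (simp add: p_def r_def s_def)
  qed
qed

lemma L2_norm_triangle:
  assumes u: "u \<in> L2_space" and v: "v \<in> L2_space"
  shows "L2_norm (\<lambda>x. u x + v x) \<le> L2_norm u + L2_norm v"
proof (rule power2_le_imp_le)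
  show "(L2_norm (\<lambda>x. u x + v x))\<^sup>2 \<le> (L2_norm u + L2_norm v)\<^sup>2"
    using L2_Cauchy_Schwarz[OF assms] by (simp add: L2_norm_add_sq[OF assms] power2_sum)
qed simp

lemma L2_norm_triangle_diff:
  assumes u: "u \<in> L2_space" and v: "v \<in> L2_space" and w: "w \<in> L2_space"
  shows "L2_norm (\<lambda>x. u x - w x) \<le> L2_norm (\<lambda>x. u x - v x) + L2_norm (\<lambda>x. v x - w x)"
  using L2_norm_triangle[OF L2_diff[OF u v] L2_diff[OF v w]] by simp

lemma L2_norm_minus_commute: "L2_norm (\<lambda>x. u x - v x) = L2_norm (\<lambda>x. v x - u x)"
  using L2_norm_uminus[of "\<lambda>x. u x - v x"] by simp

lemma L2_norm_triangle_rev: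
  assumes u: "u \<in> L2_space" and v: "v \<in> L2_space"
  shows "L2_norm u - L2_norm v \<le> L2_norm (\<lambda>x. u x - v x)"
  using L2_norm_triangle[OF L2_diff[OF u v] v] by simp

section \<open>Equality almost everywhere\<close>

lemma ae_eq_torm: "ae_eq u v \<Longrightarrow> AE x in torm. u x = v x"
  by (auto simp: ae_eq_def AE_torm elim: eventually_mono)

lemma ae_eq_torm_iff:
  assumes "periodic u" "periodic v" shows "ae_eq u v \<longleftrightarrow> (AE x in torm. u x = v x)"
proof
  assume "AE x in torm. u x = v x"
  then show "ae_eq u v"
    unfolding ae_eq_def using assms by (intro AE_periodic) (auto simp: periodic_def)
qed (rule ae_eq_torm)

lemma ae_eq_refl [simp]: "ae_eq u u" by (simp add: ae_eq_def)
lemma ae_eq_sym: "ae_eq u v \<Longrightarrow> ae_eq v u" by (auto simp: ae_eq_def elim: eventually_mono)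
lemma integral_torm_ae_cong:
  assumes "ae_eq u v" "u \<in> L2_space" "v \<in> L2_space"
  shows "integral\<^sup>L torm u = integral\<^sup>L torm v"
  using assms by (intro integral_cong_AE) (auto dest: ae_eq_torm L2_space_measurable)

lemma L2_inner_ae_cong:
  assumes "ae_eq u u'" "ae_eq v v'" "u \<in> L2_space" "u' \<in> L2_space" "v \<in> L2_space" "v' \<in> L2_space"
  shows "L2_inner u v = L2_inner u' v'"
proof -
  note [measurable_dest] = L2_space_measurable
  have "AE x in torm. u x \<bullet> v x = u' x \<bullet> v' x"
    using ae_eq_torm[OF assms(1)] ae_eq_torm[OF assms(2)] by eventually_elim simp
  then show ?thesis
    unfolding L2_inner_eq using assms(3-) by (intro integral_cong_AE) auto
qed

lemma L2_norm_ae_cong: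
  assumes "ae_eq u u'" "u \<in> L2_space" "u' \<in> L2_space"
  shows "L2_norm u = L2_norm u'"
  using L2_inner_ae_cong[OF assms(1,1)] assms by (simp add: L2_norm_def)

lemma L2_norm_eq_0:
  assumes "u \<in> L2_space" shows "L2_norm u = 0 \<longleftrightarrow> ae_eq u (\<lambda>x. 0)"
proof
  assume "L2_norm u = 0"
  then have "(\<integral>x. (norm (u x))\<^sup>2 \<partial>torm) = 0" by (metis L2_norm_sq_integral zero_power2)
  then have "AE x in torm. (norm (u x))\<^sup>2 = 0"
    using L2_space_integrable_sq[OF assms] by (subst (asm) integral_nonneg_eq_0_iff_AE) auto
  then show "ae_eq u (\<lambda>x. 0)"
    using L2_space_periodic[OF assms] by (subst ae_eq_torm_iff) (auto simp: periodic_def)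
next
  assume "ae_eq u (\<lambda>x. 0)"
  from L2_norm_ae_cong[OF this assms L2_zero] show "L2_norm u = 0" by simp
qed

lemma L2_norm_diff_eq_0:
  assumes "u \<in> L2_space" "v \<in> L2_space" shows "L2_norm (\<lambda>x. u x - v x) = 0 \<longleftrightarrow> ae_eq u v"
  using L2_norm_eq_0[OF L2_diff[OF assms]] by (simp add: ae_eq_def)

text \<open>Cauchy-Schwarz against the field \<open>c x *\<^sub>R e\<close>, where \<open>e\<close>
  is the integral itself, followed by cancelling one factor \<open>norm e\<close>. The factor
  \<open>2*pi\<close> is the square root of the area of the torus.\<close>

lemma integral_torm_le_L2_norm:
  assumes "u \<in> L2_space" "c \<in> borel_measurable borel" "periodic c" "\<And>x. \<bar>c x\<bar> \<le> K"
  shows "norm (\<integral>x. c x *\<^sub>R u x \<partial>torm) \<le> K * (2*pi) * L2_norm u"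
proof -
  have K: "0 \<le> K" using assms(4)[of undefined] by linarith
  have cu: "(\<lambda>x. c x *\<^sub>R u x) \<in> L2_space" using assms by (intro L2_mult_bounded) auto
  define e where "e = (\<integral>x. c x *\<^sub>R u x \<partial>torm)"
  have ec: "(\<lambda>x. c x *\<^sub>R e) \<in> L2_space"
    using assms K by (intro L2_bounded[where K="K * norm e"]) (auto simp: periodic_def mult_right_mono)
  have "L2_norm (\<lambda>x. c x *\<^sub>R e) \<le> K * norm e * (2*pi)"
  proof (rule power2_le_imp_le)
    have "(L2_norm (\<lambda>x. c x *\<^sub>R e))\<^sup>2 = (\<integral>x. (norm (c x *\<^sub>R e))\<^sup>2 \<partial>torm)" by (rule L2_norm_sq_integral)
    also have "\<dots> \<le> (\<integral>x. (K * norm e)\<^sup>2 \<partial>torm)"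
      using L2_space_integrable_sq[OF ec] assms(4)
      by (intro integral_mono) (auto intro!: power_mono mult_right_mono)
    also have "\<dots> = (K * norm e * (2*pi))\<^sup>2"
      by (simp add: measure_torm power_mult_distrib)
    finally show "(L2_norm (\<lambda>x. c x *\<^sub>R e))\<^sup>2 \<le> (K * norm e * (2*pi))\<^sup>2" .
  qed (use K in simp)
  moreover have "(norm e)\<^sup>2 = L2_inner u (\<lambda>x. c x *\<^sub>R e)"
  proof -
    have "(norm e)\<^sup>2 = (\<integral>x. c x *\<^sub>R u x \<partial>torm) \<bullet> e"
      by (simp add: power2_norm_eq_inner e_def)
    also have "\<dots> = (\<integral>x. (c x *\<^sub>R u x) \<bullet> e \<partial>torm)"
      using L2_space_integrable[OF cu] by (intro integral_inner_left[symmetric])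
    finally show ?thesis by (simp add: L2_inner_eq)
  qed
  moreover have "\<dots> \<le> L2_norm u * L2_norm (\<lambda>x. c x *\<^sub>R e)"
    using L2_Cauchy_Schwarz[OF assms(1) ec] by linarith
  ultimately have "(norm e)\<^sup>2 \<le> L2_norm u * (K * norm e * (2*pi))"
    using mult_left_mono[of "L2_norm (\<lambda>x. c x *\<^sub>R e)" "K * norm e * (2*pi)" "L2_norm u"] by simp
  then have "norm e * norm e \<le> norm e * (K * (2*pi) * L2_norm u)"
    by (simp add: power2_eq_square algebra_simps)
  then have "norm e \<le> K * (2*pi) * L2_norm u"
    using K L2_norm_nonneg[of u] by (cases "norm e = 0") (auto simp: mult_le_cancel_left)
  then show ?thesis by (simp add: e_def)
qed

section \<open>Completeness and orthogonal projection\<close>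

lemma nn_integral_L2_norm:
  assumes "u \<in> L2_space"
  shows "(\<integral>\<^sup>+x. ennreal ((norm (u x))\<^sup>2) \<partial>torm) = ennreal ((L2_norm u)\<^sup>2)"
  using L2_space_integrable_sq[OF assms] by (simp add: L2_norm_sq_integral nn_integral_eq_integral)

text \<open>Riesz-Fischer: a subsequence with geometrically small steps converges almost everywhere,
  and Fatou's lemma turns this into norm convergence of the whole sequence. Taking
  \<open>lim\<close> at every point gives a limit that is Borel and periodic without any
  modification on a null set.\<close>

theorem L2_complete:
  fixes u :: "nat \<Rightarrow> vfield"
  assumes u: "\<And>n. u n \<in> L2_space"
    and cauchy: "\<And>e. e > 0 \<Longrightarrow> \<exists>M. \<forall>m\<ge>M. \<forall>n\<ge>M. L2_norm (\<lambda>x. u m x - u n x) < e"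
  obtains v where "v \<in> L2_space" "(\<lambda>n. L2_norm (\<lambda>x. u n x - v x)) \<longlonglongrightarrow> 0"
proof -
  have "\<exists>M. \<forall>m\<ge>M. \<forall>n\<ge>M. L2_norm (\<lambda>x. u m x - u n x) < (1/2)^k" for k :: nat
    by (rule cauchy) simp
  then obtain M where M: "\<And>k m n. m \<ge> M k \<Longrightarrow> n \<ge> M k \<Longrightarrow> L2_norm (\<lambda>x. u m x - u n x) < (1/2)^k"
    by metis
  \<comment> \<open>Summing the thresholds keeps \<open>r k\<close> above both \<open>M k\<close>
    and \<open>k\<close>, and \<open>r (Suc k)\<close> above \<open>M k\<close>, although
    \<open>M\<close> need not be monotone.\<close>
  define r where "r k = (\<Sum>j\<le>k. M j) + k" for k
  have rM: "r k \<ge> M k" for k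
  proof -
    have "M k \<le> (\<Sum>j\<le>k. M j)" by (rule member_le_sum) auto
    then show ?thesis by (simp add: r_def)
  qed
  have r_Suc: "r (Suc k) \<ge> M k" for k
    using rM[of k] by (simp add: r_def)
  have r_ge: "r k \<ge> k" for k by (simp add: r_def)
  define w where "w k = u (r k)" for k
  have w: "w k \<in> L2_space" for k using u by (simp add: w_def)
  have w_step: "L2_norm (\<lambda>x. w (Suc k) x - w k x) \<le> (1/2)^k" for k
    using M[OF r_Suc rM, of k] by (simp add: w_def)
  have [measurable]: "w k \<in> borel_measurable borel" "w k \<in> borel_measurable torm"
    "u k \<in> borel_measurable torm" for k
    using w u by (auto intro: L2_space_borel L2_space_measurable)
  \<comment> \<open>The squared steps have integral at most \<open>(1/4)^k\<close>, so the weight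
    \<open>2^k\<close> keeps the series integrable, while finiteness of the series at a point makes
    the steps there decay like \<open>(sqrt (1/2))^k\<close>.\<close>
  define a where "a k x = ennreal (2^k * (norm (w (Suc k) x - w k x))\<^sup>2)" for k x
  have a_int: "(\<integral>\<^sup>+x. a k x \<partial>torm) \<le> ennreal ((1/2)^k)" for k
  proof -
    have "(\<integral>\<^sup>+x. a k x \<partial>torm) = ennreal (2^k) * (\<integral>\<^sup>+x. ennreal ((norm (w (Suc k) x - w k x))\<^sup>2) \<partial>torm)"
      unfolding a_def by (subst nn_integral_cmult[symmetric]) (auto simp: ennreal_mult)
    also have "\<dots> = ennreal (2^k * (L2_norm (\<lambda>x. w (Suc k) x - w k x))\<^sup>2)"
      by (subst nn_integral_L2_norm[OF L2_diff[OF w w]]) (simp add: ennreal_mult)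
    also have "\<dots> \<le> ennreal (2^k * ((1/2)^k)\<^sup>2)"
      using w_step by (intro ennreal_leI mult_left_mono power_mono) auto
    also have "2^k * ((1/2)^k)\<^sup>2 = (1/2::real)^k"
      by (simp add: power2_eq_square power_divide)
    finally show ?thesis .
  qed
  have "(\<integral>\<^sup>+x. (\<Sum>k. a k x) \<partial>torm) = (\<Sum>k. \<integral>\<^sup>+x. a k x \<partial>torm)"
    unfolding a_def by (rule nn_integral_suminf) measurable
  also have "\<dots> \<le> (\<Sum>k. ennreal ((1/2)^k))"
    by (intro suminf_le a_int) auto
  also have "\<dots> = ennreal 2"
    using suminf_geometric[of "1/2::real"] by (subst suminf_ennreal2) auto
  finally have "(\<integral>\<^sup>+x. (\<Sum>k. a k x) \<partial>torm) \<noteq> \<infinity>"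
    by (auto simp: top_unique)
  then have ae: "AE x in torm. (\<Sum>k. a k x) \<noteq> \<infinity>"
    unfolding a_def by (intro nn_integral_PInf_AE) measurable
  have conv: "convergent (\<lambda>k. w k x)" if fin: "(\<Sum>k. a k x) \<noteq> \<infinity>" for x
  proof -
    obtain C where C: "(\<Sum>k. a k x) = ennreal C" "C \<ge> 0"
      using fin by (cases "\<Sum>k. a k x") auto
    have bound: "norm (w (Suc k) x - w k x) \<le> sqrt C * (sqrt (1/2))^k" for k
    proof -
      have "a k x \<le> (\<Sum>k. a k x)"
        using sum_le_suminf[of "\<lambda>k. a k x" "{k}"] by simp
      then have "2^k * (norm (w (Suc k) x - w k x))\<^sup>2 \<le> C"
        using C by (simp add: a_def)
      then have "(norm (w (Suc k) x - w k x))\<^sup>2 \<le> C * (1/2)^k"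
        by (simp add: field_simps power_divide)
      then have "sqrt ((norm (w (Suc k) x - w k x))\<^sup>2) \<le> sqrt (C * (1/2)^k)"
        by (rule real_sqrt_le_mono)
      then show ?thesis by (simp add: real_sqrt_mult real_sqrt_power)
    qed
    have "summable (\<lambda>k. sqrt C * (sqrt (1/2))^k)"
      by (intro summable_mult summable_geometric) (simp add: real_sqrt_divide)
    from summable_comparison_test'[OF this bound] have "summable (\<lambda>k. w (Suc k) x - w k x)" .
    then have "convergent (\<lambda>n. \<Sum>k<n. w (Suc k) x - w k x)" by (simp add: summable_iff_convergent)
    then have "convergent (\<lambda>n. w n x - w 0 x)" by (simp add: sum_lessThan_telescope[of "\<lambda>n. w n x"])
    then show ?thesis by (simp add: convergent_diff_const_right_iff)
  qed
  define v where "v x = lim (\<lambda>k. w k x)" for x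
  have v_borel [measurable]: "v \<in> borel_measurable borel" "v \<in> borel_measurable torm"
    unfolding v_def by (auto intro!: borel_measurable_torm borel_measurable_lim_metric)
  have v_lim: "AE x in torm. (\<lambda>k. w k x) \<longlonglongrightarrow> v x"
    using ae by eventually_elim (use conv in \<open>auto simp: v_def convergent_LIMSEQ_iff\<close>)
  have v_per: "periodic v"
    using L2_space_periodic[OF w] by (simp add: periodic_def v_def)
  \<comment> \<open>Stated with the extended integral, so that it applies before \<open>v\<close> is
    known to be square integrable. It yields first that membership and then the convergence.\<close>
  have fatou: "(\<integral>\<^sup>+x. ennreal ((norm (u m x - v x))\<^sup>2) \<partial>torm) \<le> ennreal (e\<^sup>2)"
    if e: "e > 0" and m: "\<forall>m'\<ge>M'. \<forall>n\<ge>M'. L2_norm (\<lambda>x. u m' x - u n x) < e" "m \<ge> M'" for m M' e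
  proof -
    have "(\<integral>\<^sup>+x. ennreal ((norm (u m x - v x))\<^sup>2) \<partial>torm)
        = (\<integral>\<^sup>+x. liminf (\<lambda>k. ennreal ((norm (u m x - w k x))\<^sup>2)) \<partial>torm)"
    proof (rule nn_integral_cong_AE)
      show "AE x in torm. ennreal ((norm (u m x - v x))\<^sup>2) = liminf (\<lambda>k. ennreal ((norm (u m x - w k x))\<^sup>2))"
        using v_lim
      proof eventually_elim
        case (elim x)
        then have "(\<lambda>k. ennreal ((norm (u m x - w k x))\<^sup>2)) \<longlonglongrightarrow> ennreal ((norm (u m x - v x))\<^sup>2)"
          by (intro tendsto_intros)
        then show ?case by (rule lim_imp_Liminf[OF sequentially_bot, symmetric])
      qed
    qed
    also have "\<dots> \<le> liminf (\<lambda>k. \<integral>\<^sup>+x. ennreal ((norm (u m x - w k x))\<^sup>2) \<partial>torm)"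
      by (rule nn_integral_liminf) measurable
    also have "\<dots> \<le> limsup (\<lambda>k. \<integral>\<^sup>+x. ennreal ((norm (u m x - w k x))\<^sup>2) \<partial>torm)"
      by (intro Liminf_le_Limsup) simp
    also have "\<dots> \<le> ennreal (e\<^sup>2)"
    proof (rule Limsup_bounded)
      show "\<forall>\<^sub>F k in sequentially. (\<integral>\<^sup>+x. ennreal ((norm (u m x - w k x))\<^sup>2) \<partial>torm) \<le> ennreal (e\<^sup>2)"
        using eventually_ge_at_top[of M']
      proof eventually_elim
        case (elim k)
        then have "L2_norm (\<lambda>x. u m x - w k x) < e" using m r_ge[of k] by (simp add: w_def)
        then have "(L2_norm (\<lambda>x. u m x - w k x))\<^sup>2 \<le> e\<^sup>2" by (intro power_mono) auto
        then show ?case by (simp add: nn_integral_L2_norm[OF L2_diff[OF u w]] ennreal_leI)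
      qed
    qed
    finally show ?thesis .
  qed
  have diff_L2: "(\<lambda>x. u m x - v x) \<in> L2_space"
    if m: "e > 0" "\<forall>m'\<ge>M'. \<forall>n\<ge>M'. L2_norm (\<lambda>x. u m' x - u n x) < e" "m \<ge> M'" for m M' e
  proof (rule L2_spaceI)
    show "(\<lambda>x. u m x - v x) \<in> borel_measurable borel"
      using L2_space_borel[OF u] by simp
    show "periodic (\<lambda>x. u m x - v x)"
      using L2_space_periodic[OF u] v_per by (simp add: periodic_def)
    show "integrable torm (\<lambda>x. (norm (u m x - v x))\<^sup>2)"
      using fatou[OF m] by (intro integrableI_bounded) (auto intro: le_less_trans)
  qed
  have v: "v \<in> L2_space"
  proof -
    obtain M' where M': "\<forall>m'\<ge>M'. \<forall>n\<ge>M'. L2_norm (\<lambda>x. u m' x - u n x) < 1" using cauchy[of 1] by auto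
    have "(\<lambda>x. u M' x - v x) \<in> L2_space" by (rule diff_L2[OF _ M']) auto
    from L2_diff[OF u this, of M'] show ?thesis by simp
  qed
  have "(\<lambda>n. L2_norm (\<lambda>x. u n x - v x)) \<longlonglongrightarrow> 0"
  proof (rule LIMSEQ_I)
    fix e :: real assume e: "e > 0"
    obtain M' where M': "\<forall>m'\<ge>M'. \<forall>n\<ge>M'. L2_norm (\<lambda>x. u m' x - u n x) < e/2" using cauchy[of "e/2"] e by auto
    have "norm (L2_norm (\<lambda>x. u n x - v x) - 0) < e" if "n \<ge> M'" for n
    proof -
      have "ennreal ((L2_norm (\<lambda>x. u n x - v x))\<^sup>2) \<le> ennreal ((e/2)\<^sup>2)"
        using fatou[OF _ M' that] e by (simp add: nn_integral_L2_norm[OF L2_diff[OF u v]])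
      then have "L2_norm (\<lambda>x. u n x - v x) \<le> e/2"
        using e by (subst (asm) ennreal_le_iff) (auto intro: power2_le_imp_le)
      then show ?thesis using e by simp
    qed
    then show "\<exists>no. \<forall>n\<ge>no. norm (L2_norm (\<lambda>x. u n x - v x) - 0) < e" by blast
  qed
  with v show ?thesis by (rule that)
qed

lemma L2_inner_tendsto:
  assumes "\<And>n. s n \<in> L2_space" "v \<in> L2_space" "h \<in> L2_space"
    and "(\<lambda>n. L2_norm (\<lambda>x. s n x - v x)) \<longlonglongrightarrow> 0"
  shows "(\<lambda>n. L2_inner (s n) h) \<longlonglongrightarrow> L2_inner v h"
proof (rule Lim_null_comparison[where g="\<lambda>n. L2_norm (\<lambda>x. s n x - v x) * L2_norm h", THEN LIM_zero_cancel])
  show "\<forall>\<^sub>F n in sequentially. norm (L2_inner (s n) h - L2_inner v h) \<le> L2_norm (\<lambda>x. s n x - v x) * L2_norm h"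
    using L2_Cauchy_Schwarz[OF L2_diff[OF assms(1,2)] assms(3)]
    by (simp add: L2_inner_diff_left assms)
  show "(\<lambda>n. L2_norm (\<lambda>x. s n x - v x) * L2_norm h) \<longlonglongrightarrow> 0"
    using tendsto_mult_right[OF assms(4)] by simp
qed

lemma L2_norm_tendsto:
  assumes "\<And>n. s n \<in> L2_space" "v \<in> L2_space"
    and "(\<lambda>n. L2_norm (\<lambda>x. s n x - v x)) \<longlonglongrightarrow> 0"
  shows "(\<lambda>n. L2_norm (s n)) \<longlonglongrightarrow> L2_norm v"
proof (rule Lim_null_comparison[OF _ assms(3), THEN LIM_zero_cancel])
  show "\<forall>\<^sub>F n in sequentially. norm (L2_norm (s n) - L2_norm v) \<le> L2_norm (\<lambda>x. s n x - v x)"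
  proof (intro always_eventually allI)
    fix n
    show "norm (L2_norm (s n) - L2_norm v) \<le> L2_norm (\<lambda>x. s n x - v x)"
      using L2_norm_triangle_rev[OF assms(1)[of n] assms(2)] L2_norm_triangle_rev[OF assms(2) assms(1)[of n]]
        L2_norm_minus_commute[of "s n" v] by simp
  qed
qed

text \<open>The witness is the point of \<open>S\<close> closest to \<open>w\<close>.\<close>

theorem L2_projection:
  assumes G: "G \<subseteq> L2_space" and w: "w \<in> L2_space"
    and S: "S = {u \<in> L2_space. \<forall>g\<in>G. L2_inner u g = 0}"
  obtains v where "v \<in> S" "\<forall>h\<in>S. L2_inner (\<lambda>x. w x - v x) h = 0"
proof -
  have SL: "s \<in> L2_space" if "s \<in> S" for s using that by (simp add: S)
  have S_zero: "(\<lambda>x. 0) \<in> S" by (simp add: S L2_zero L2_inner_eq)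
  have S_lin: "(\<lambda>x. a *\<^sub>R s x + b *\<^sub>R t x) \<in> S" if "s \<in> S" "t \<in> S" for s t a b
    using that G by (auto simp: S L2_add L2_scale L2_inner_add_left L2_inner_scale_left subset_eq)
  define D where "D s = (L2_norm (\<lambda>x. w x - s x))\<^sup>2" for s
  define d where "d = Inf (D ` S)"
  have bdd: "bdd_below (D ` S)" by (rule bdd_belowI[where m=0]) (auto simp: D_def)
  have d_le: "d \<le> D s" if "s \<in> S" for s unfolding d_def using bdd that by (intro cInf_lower) auto
  have "\<exists>s\<in>S. D s < d + 1 / real (Suc n)" for n
    using cInf_lessD[of "D ` S" "d + 1 / real (Suc n)"] S_zero by (auto simp: d_def)
  then obtain s where s: "\<And>n. s n \<in> S" "\<And>n. D (s n) < d + 1 / real (Suc n)" by metis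
  have sL: "s n \<in> L2_space" for n using s SL by blast
  \<comment> \<open>Parallelogram identity: the midpoint of \<open>s m\<close> and
    \<open>s n\<close> lies in \<open>S\<close>, so its distance from \<open>w\<close> is at least
    the infimum, and this forces the minimising sequence to be Cauchy.\<close>
  have par: "(L2_norm (\<lambda>x. s m x - s n x))\<^sup>2 \<le> 2 / real (Suc m) + 2 / real (Suc n)" for m n
  proof -
    define p q where "p = (\<lambda>x. w x - s m x)" and "q = (\<lambda>x. w x - s n x)"
    have pq: "p \<in> L2_space" "q \<in> L2_space" using w sL by (auto simp: p_def q_def L2_diff)
    have "d \<le> D (\<lambda>x. (1/2) *\<^sub>R s m x + (1/2) *\<^sub>R s n x)"
      by (intro d_le S_lin s)
    also have "(\<lambda>x. w x - ((1/2) *\<^sub>R s m x + (1/2) *\<^sub>R s n x)) = (\<lambda>x. (1/2) *\<^sub>R (p x + q x))"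
      by (auto simp: p_def q_def vec_eq_iff fun_eq_iff field_simps)
    then have "D (\<lambda>x. (1/2) *\<^sub>R s m x + (1/2) *\<^sub>R s n x) = (1/4) * (L2_norm (\<lambda>x. p x + q x))\<^sup>2"
      unfolding D_def by (simp only: L2_norm_scale) (simp add: power_mult_distrib power2_eq_square)
    finally have 1: "4 * d \<le> (L2_norm (\<lambda>x. p x + q x))\<^sup>2" by simp
    have "(\<lambda>x. s m x - s n x) = (\<lambda>x. q x - p x)" by (auto simp: p_def q_def)
    then have "(L2_norm (\<lambda>x. s m x - s n x))\<^sup>2 = 2 * (L2_norm p)\<^sup>2 + 2 * (L2_norm q)\<^sup>2 - (L2_norm (\<lambda>x. p x + q x))\<^sup>2"
      using pq by (simp add: L2_norm_diff_sq L2_norm_add_sq L2_inner_commute)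
    also have "\<dots> \<le> 2 * (d + 1 / real (Suc m)) + 2 * (d + 1 / real (Suc n)) - 4 * d"
      using 1 s(2)[of m] s(2)[of n] by (simp add: D_def p_def q_def)
    finally show ?thesis by simp
  qed
  have cauchy: "\<exists>M. \<forall>m\<ge>M. \<forall>n\<ge>M. L2_norm (\<lambda>x. s m x - s n x) < e" if e: "e > 0" for e
  proof -
    obtain M :: nat where M: "4 / e\<^sup>2 < real M" using reals_Archimedean2 by blast
    have "L2_norm (\<lambda>x. s m x - s n x) < e" if "m \<ge> M" "n \<ge> M" for m n
    proof (rule power2_less_imp_less)
      have "0 < 4 / e\<^sup>2" using e by simp
      then have M0: "0 < real M" using M by linarith
      have "2 / real (Suc m) \<le> 2 / real M" "2 / real (Suc n) \<le> 2 / real M"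
        using that M0 by (auto intro!: divide_left_mono)
      then have "(L2_norm (\<lambda>x. s m x - s n x))\<^sup>2 \<le> 4 / real M" using par[of m n] by simp
      also have "\<dots> < e\<^sup>2" using M M0 e by (simp add: field_simps)
      finally show "(L2_norm (\<lambda>x. s m x - s n x))\<^sup>2 < e\<^sup>2" .
    qed (use e in simp)
    then show ?thesis by blast
  qed
  obtain v where v: "v \<in> L2_space" "(\<lambda>n. L2_norm (\<lambda>x. s n x - v x)) \<longlonglongrightarrow> 0"
    using L2_complete[of s, OF sL cauchy] by blast
  have vS: "v \<in> S"
    unfolding S
  proof (intro CollectI conjI ballI)
    fix g assume g: "g \<in> G"
    have "(\<lambda>n. L2_inner (s n) g) \<longlonglongrightarrow> L2_inner v g"
      using sL v g G by (intro L2_inner_tendsto) auto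
    moreover have "L2_inner (s n) g = 0" for n using s(1)[of n] g by (simp add: S)
    ultimately show "L2_inner v g = 0" by (simp add: LIMSEQ_const_iff)
  qed (rule v)
  have Dv: "D v \<le> d"
  proof -
    have "(\<lambda>n. L2_norm (\<lambda>x. (w x - s n x))) \<longlonglongrightarrow> L2_norm (\<lambda>x. w x - v x)"
    proof (rule L2_norm_tendsto)
      show "(\<lambda>n. L2_norm (\<lambda>x. w x - s n x - (w x - v x))) \<longlonglongrightarrow> 0"
        using v(2) by (subst L2_norm_minus_commute) simp
    qed (use w sL v L2_diff in auto)
    then have "(\<lambda>n. D (s n)) \<longlonglongrightarrow> D v" unfolding D_def by (rule tendsto_power)
    moreover have "(\<lambda>n. d + 1 / real (Suc n)) \<longlonglongrightarrow> d + 0"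
      using LIMSEQ_inverse_real_of_nat by (intro tendsto_add tendsto_const) (simp add: inverse_eq_divide)
    ultimately show ?thesis
      using s(2) by (intro LIMSEQ_le[of "\<lambda>n. D (s n)" "D v" "\<lambda>n. d + 1 / real (Suc n)" d]) (auto intro: less_imp_le)
  qed
  have "L2_inner (\<lambda>x. w x - v x) h = 0" if h: "h \<in> S" for h
  proof -
    define z where "z = (\<lambda>x. w x - v x)"
    have z: "z \<in> L2_space" using w v by (simp add: z_def L2_diff)
    \<comment> \<open>The fields \<open>v + t h\<close> are competitors in \<open>S\<close>;
      comparing squared distances for all \<open>t\<close> will force the linear term to
      vanish.\<close>
    have q: "2 * t * L2_inner z h \<le> t\<^sup>2 * (L2_norm h)\<^sup>2" for t
    proof -
      have "D v \<le> D (\<lambda>x. 1 *\<^sub>R v x + t *\<^sub>R h x)"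
        using Dv d_le[OF S_lin[OF vS h]] by (rule order_trans)
      also have "(\<lambda>x. w x - (1 *\<^sub>R v x + t *\<^sub>R h x)) = (\<lambda>x. z x - t *\<^sub>R h x)"
        by (simp add: z_def fun_eq_iff)
      then have "D (\<lambda>x. 1 *\<^sub>R v x + t *\<^sub>R h x) = (L2_norm z)\<^sup>2 - 2 * (t * L2_inner z h) + (\<bar>t\<bar> * L2_norm h)\<^sup>2"
        unfolding D_def using L2_norm_diff_sq[OF z L2_scale[OF SL[OF h]], of t]
        by (simp only: L2_inner_scale_right L2_norm_scale)
      finally show ?thesis by (simp add: D_def z_def power_mult_distrib)
    qed
    define i where "i = L2_inner z h"
    \<comment> \<open>The value \<open>t = i / ((L2_norm h)\<^sup>2 + 1)\<close> is optimal up to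
      the added \<open>1\<close>, which covers the case \<open>L2_norm h = 0\<close>.\<close>
    have "2 * (i / ((L2_norm h)\<^sup>2 + 1)) * i \<le> (i / ((L2_norm h)\<^sup>2 + 1))\<^sup>2 * ((L2_norm h)\<^sup>2 + 1)"
      using q[of "i / ((L2_norm h)\<^sup>2 + 1)"] unfolding i_def[symmetric]
      by (rule order_trans) (intro mult_left_mono, auto)
    also have "\<dots> = (i / ((L2_norm h)\<^sup>2 + 1)) * i"
    proof -
      have "(L2_norm h)\<^sup>2 + 1 \<noteq> 0" using zero_le_power2[of "L2_norm h"] by linarith
      then show ?thesis by (simp add: power2_eq_square[of "i / _"])
    qed
    finally have "i * i / ((L2_norm h)\<^sup>2 + 1) \<le> 0" by simp
    moreover have "(L2_norm h)\<^sup>2 + 1 > 0" using zero_le_power2[of "L2_norm h"] by linarith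
    ultimately have "i * i \<le> 0" by (simp add: divide_le_0_iff)
    then have "i = 0" using zero_le_square[of i] by simp
    then show ?thesis by (simp add: i_def z_def)
  qed
  with vS show ?thesis by (intro that) auto
qed

section \<open>Trigonometric polynomials\<close>

definition freq :: "int \<times> int \<Rightarrow> 2 \<Rightarrow> real" where
  "freq k i = real_of_int (if i = 1 then fst k else snd k)"

definition phase :: "int \<times> int \<Rightarrow> real^2 \<Rightarrow> real" where
  "phase k x = freq k 1 * x $ 1 + freq k 2 * x $ 2"

lemma phase_axis: "phase k (x + axis i c) = phase k x + freq k i * c"
  using exhaust_2[of i] by (auto simp: phase_def freq_def axis_def algebra_simps)

lemma phase_add: "phase k x + phase l x = phase (k + l) x"
  and phase_diff: "phase k x - phase l x = phase (k - l) x"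
  by (auto simp: phase_def freq_def algebra_simps)

lemma phase_0 [simp]: "phase 0 x = 0" "phase (0, 0) x = 0"
  by (simp_all add: phase_def freq_def)

lemma phase_uminus: "phase (- k) x = - phase k x"
  by (simp add: phase_def freq_def)

lemma cos_phase_period: "cos (phase k (x + axis i (2*pi))) = cos (phase k x)"
  and sin_phase_period: "sin (phase k (x + axis i (2*pi))) = sin (phase k x)"
proof -
  have "freq k i * (2*pi) = 2*pi * of_int (if i = 1 then fst k else snd k)" by (simp add: freq_def)
  then show "cos (phase k (x + axis i (2*pi))) = cos (phase k x)"
    "sin (phase k (x + axis i (2*pi))) = sin (phase k x)"
    unfolding phase_axis by (simp_all only: cos_add sin_add cos_int_2pin sin_int_2pin)
qed

text \<open>Products are not a constructor; the product-to-sum formulas recover them in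
  \<open>trig_mult\<close>. Linear claims therefore have to be checked on single modes only.\<close>

inductive_set trig :: "(real^2 \<Rightarrow> real) set" where
  cos: "(\<lambda>x. cos (phase k x)) \<in> trig"
| sin: "(\<lambda>x. sin (phase k x)) \<in> trig"
| add: "f \<in> trig \<Longrightarrow> g \<in> trig \<Longrightarrow> (\<lambda>x. f x + g x) \<in> trig"
| scale: "f \<in> trig \<Longrightarrow> (\<lambda>x. c * f x) \<in> trig"

lemma trig_const: "(\<lambda>x. c) \<in> trig"
  using trig.scale[OF trig.cos[of 0], of c] by simp

lemma trig_sum: "finite A \<Longrightarrow> (\<And>a. a \<in> A \<Longrightarrow> f a \<in> trig) \<Longrightarrow> (\<lambda>x. \<Sum>a\<in>A. f a x) \<in> trig"
  by (induction A rule: finite_induct) (auto intro: trig_const trig.add)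

lemma trig_cos_mult:
  assumes "g \<in> trig" shows "(\<lambda>x. cos (phase k x) * g x) \<in> trig"
  using assms
proof induction
  case (cos l)
  have "(\<lambda>x. cos (phase k x) * cos (phase l x)) = (\<lambda>x. (1/2) * (cos (phase (k - l) x) + cos (phase (k + l) x)))"
    by (simp add: cos_times_cos phase_add phase_diff fun_eq_iff)
  then show ?case by (simp only:) (intro trig.intros)
next
  case (sin l)
  have "(\<lambda>x. cos (phase k x) * sin (phase l x)) = (\<lambda>x. (1/2) * (sin (phase (k + l) x) + (-1) * sin (phase (k - l) x)))"
    by (simp add: cos_times_sin phase_add phase_diff fun_eq_iff)
  then show ?case by (simp only:) (intro trig.intros)
next
  case (add f g)
  then show ?case using trig.add[OF add.IH] by (simp add: distrib_left)
next
  case (scale f c)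
  then show ?case using trig.scale[OF scale.IH, of c] by (simp add: mult.left_commute)
qed

lemma trig_sin_mult:
  assumes "g \<in> trig" shows "(\<lambda>x. sin (phase k x) * g x) \<in> trig"
  using assms
proof induction
  case (cos l)
  have "(\<lambda>x. sin (phase k x) * cos (phase l x)) = (\<lambda>x. (1/2) * (sin (phase (k + l) x) + sin (phase (k - l) x)))"
    by (simp add: sin_times_cos phase_add phase_diff fun_eq_iff)
  then show ?case by (simp only:) (intro trig.intros)
next
  case (sin l)
  have "(\<lambda>x. sin (phase k x) * sin (phase l x)) = (\<lambda>x. (1/2) * (cos (phase (k - l) x) + (-1) * cos (phase (k + l) x)))"
    by (simp add: sin_times_sin phase_add phase_diff fun_eq_iff)
  then show ?case by (simp only:) (intro trig.intros)
next
  case (add f g)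
  then show ?case using trig.add[OF add.IH] by (simp add: distrib_left)
next
  case (scale f c)
  then show ?case using trig.scale[OF scale.IH, of c] by (simp add: mult.left_commute)
qed

lemma trig_mult:
  assumes "f \<in> trig" "g \<in> trig" shows "(\<lambda>x. f x * g x) \<in> trig"
  using assms(1)
proof induction
  case (add f f')
  then show ?case using trig.add[OF add.IH] by (simp add: distrib_right)
next
  case (scale f c)
  then show ?case using trig.scale[OF scale.IH, of c] by (simp add: mult.assoc)
qed (auto intro: trig_cos_mult trig_sin_mult assms(2))

lemma trig_periodic: "f \<in> trig \<Longrightarrow> periodic f"
  by (induction rule: trig.induct) (auto simp: periodic_def cos_phase_period sin_phase_period)

lemma trig_bounded: "f \<in> trig \<Longrightarrow> \<exists>K. \<forall>x. \<bar>f x\<bar> \<le> K"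
proof (induction rule: trig.induct)
  case (add f g)
  then obtain K L where "\<forall>x. \<bar>f x\<bar> \<le> K" "\<forall>x. \<bar>g x\<bar> \<le> L" by auto
  then have "\<bar>f x + g x\<bar> \<le> K + L" for x by (meson abs_triangle_ineq add_mono order_trans)
  then show ?case by blast
next
  case (scale f c)
  then obtain K where "\<forall>x. \<bar>f x\<bar> \<le> K" by auto
  then have "\<bar>c * f x\<bar> \<le> \<bar>c\<bar> * K" for x by (simp add: abs_mult mult_left_mono)
  then show ?case by blast
qed (auto intro: exI[of _ 1])

section \<open>Derivatives of trigonometric polynomials, and test functions\<close>

lemma phase_has_derivative: "(phase k has_derivative phase k) (at x)"
  unfolding phase_def[abs_def] by (auto intro!: derivative_eq_intros bounded_linear.has_derivative[OF bounded_linear_vec_nth])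

lemma partial_deriv_eqI: "(f has_derivative D) (at x) \<Longrightarrow> partial_deriv i f x = D (axis i 1)"
  by (simp add: partial_deriv_def frechet_derivative_at[symmetric])

lemma phase_axis1: "phase k (axis i 1) = freq k i"
  using phase_axis[of k 0 i 1] by (simp add: phase_def)

lemma cos_phase_has_derivative: "((\<lambda>x. cos (phase k x)) has_derivative (\<lambda>h. - sin (phase k x) * phase k h)) (at x)"
  by (rule derivative_eq_intros phase_has_derivative refl)+ (simp add: mult.commute)

lemma sin_phase_has_derivative: "((\<lambda>x. sin (phase k x)) has_derivative (\<lambda>h. cos (phase k x) * phase k h)) (at x)"
  by (rule derivative_eq_intros phase_has_derivative refl)+ (simp add: mult.commute)

lemma partial_deriv_cos: "partial_deriv i (\<lambda>x. cos (phase k x)) = (\<lambda>x. - freq k i * sin (phase k x))"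
  by (rule ext) (simp add: partial_deriv_eqI[OF cos_phase_has_derivative] phase_axis1)

lemma partial_deriv_sin: "partial_deriv i (\<lambda>x. sin (phase k x)) = (\<lambda>x. freq k i * cos (phase k x))"
  by (rule ext) (simp add: partial_deriv_eqI[OF sin_phase_has_derivative] phase_axis1)

lemma trig_differentiable: "f \<in> trig \<Longrightarrow> f differentiable (at x)"
proof (induction rule: trig.induct)
  case (cos k) then show ?case using cos_phase_has_derivative differentiable_def by blast
next
  case (sin k) then show ?case using sin_phase_has_derivative differentiable_def by blast
qed auto

lemma partial_deriv_add:
  assumes "f differentiable (at x)" "g differentiable (at x)"
  shows "partial_deriv i (\<lambda>x. f x + g x) x = partial_deriv i f x + partial_deriv i g x"
  using partial_deriv_eqI[OF has_derivative_add[OF assms[unfolded frechet_derivative_works]], of i]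
  by (simp add: partial_deriv_def)

lemma partial_deriv_mult:
  assumes "f differentiable (at x)" "g differentiable (at x)"
  shows "partial_deriv i (\<lambda>x. f x * g x) x = f x * partial_deriv i g x + partial_deriv i f x * g x"
  using partial_deriv_eqI[OF has_derivative_mult[OF assms[unfolded frechet_derivative_works]], of i]
  by (simp add: partial_deriv_def)

lemma partial_deriv_const: "partial_deriv i (\<lambda>x. c) x = 0"
  by (rule partial_deriv_eqI[where D="\<lambda>_. 0"]) simp

lemma partial_deriv_scale:
  "f differentiable (at x) \<Longrightarrow> partial_deriv i (\<lambda>x. c * f x) x = c * partial_deriv i f x"
  using partial_deriv_mult[of "\<lambda>_. c" x f i] by (simp add: partial_deriv_const)

lemma partial_deriv_trig: "f \<in> trig \<Longrightarrow> partial_deriv i f \<in> trig"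
proof (induction rule: trig.induct)
  case (cos k) show ?case unfolding partial_deriv_cos by (intro trig.intros)
next
  case (sin k) show ?case unfolding partial_deriv_sin by (intro trig.intros)
next
  case (add f g)
  have "partial_deriv i (\<lambda>x. f x + g x) = (\<lambda>x. partial_deriv i f x + partial_deriv i g x)"
    using add by (auto simp: partial_deriv_add trig_differentiable)
  with add show ?case by (auto intro: trig.intros)
next
  case (scale f c)
  have "partial_deriv i (\<lambda>x. c * f x) = (\<lambda>x. c * partial_deriv i f x)"
    using scale by (auto simp: partial_deriv_scale trig_differentiable)
  with scale show ?case by (auto intro: trig.intros)
qed

lemma trig_test_functions: "f \<in> trig \<Longrightarrow> f \<in> test_functions"
proof -
  assume f: "f \<in> trig"
  have "foldr partial_deriv js f \<in> trig" for js
    by (induction js) (auto intro: f partial_deriv_trig)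
  then show ?thesis by (auto simp: test_functions_def trig_periodic[OF f] intro: trig_differentiable)
qed

lemma test_functions_partial_deriv: "\<phi> \<in> test_functions \<Longrightarrow> partial_deriv i \<phi> \<in> test_functions"
proof -
  assume \<phi>: "\<phi> \<in> test_functions"
  have "foldr partial_deriv js (partial_deriv i \<phi>) differentiable (at x)" for js x
  proof -
    \<comment> \<open>\<open>foldr\<close> applies the last entry of the list first, so appending
      \<open>i\<close> makes it the innermost derivative.\<close>
    have "foldr partial_deriv (js @ [i]) \<phi> differentiable (at x)"
      using \<phi> unfolding test_functions_def by blast
    then show ?thesis by simp
  qed
  moreover have "periodic (partial_deriv i \<phi>)"
  proof -
    have per: "\<phi> (x + axis j (2*pi)) = \<phi> x" for x j
      using \<phi> by (auto simp: test_functions_def periodic_def)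
    have diff: "\<phi> differentiable (at x)" for x
    proof -
      have "foldr partial_deriv [] \<phi> differentiable (at x)"
        using \<phi> unfolding test_functions_def by blast
      then show ?thesis by simp
    qed
    have "partial_deriv i \<phi> (x + axis j (2*pi)) = partial_deriv i \<phi> x" for x j
    proof -
      have "(\<phi> has_derivative frechet_derivative \<phi> (at (x + axis j (2*pi)))) (at (x + axis j (2*pi)))"
        using diff frechet_derivative_works by blast
      then have "((\<lambda>y. \<phi> (y + axis j (2*pi))) has_derivative
          (\<lambda>h. frechet_derivative \<phi> (at (x + axis j (2*pi))) h)) (at x)"
        by (rule has_derivative_compose[rotated]) (auto intro!: derivative_eq_intros)
      then have "(\<phi> has_derivative (\<lambda>h. frechet_derivative \<phi> (at (x + axis j (2*pi))) h)) (at x)"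
        by (simp add: per)
      from partial_deriv_eqI[OF this, of i] show ?thesis by (simp add: partial_deriv_def)
    qed
    then show ?thesis by (simp add: periodic_def)
  qed
  ultimately show ?thesis by (simp add: test_functions_def)
qed

lemma test_functionsD:
  assumes "\<phi> \<in> test_functions"
  shows "periodic \<phi>" "\<phi> differentiable (at x)" "continuous_on UNIV \<phi>" "\<phi> \<in> borel_measurable borel"
    "\<exists>K. \<forall>x. \<bar>\<phi> x\<bar> \<le> K"
proof -
  show per: "periodic \<phi>" using assms by (simp add: test_functions_def)
  have diff: "\<phi> differentiable (at x)" for x
  proof -
    have "foldr partial_deriv [] \<phi> differentiable (at x)"
      using assms unfolding test_functions_def by blast
    then show ?thesis by simp
  qed
  then show "\<phi> differentiable (at x)" .
  show cont: "continuous_on UNIV \<phi>"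
    using diff by (intro differentiable_imp_continuous_on) (simp add: differentiable_on_def)
  then show "\<phi> \<in> borel_measurable borel" by (rule borel_measurable_continuous_onI)
  have "compact (\<phi> ` torus)" using compact_torus cont by (intro compact_continuous_image) (auto intro: continuous_on_subset)
  then obtain K where "\<forall>y\<in>\<phi> ` torus. norm y \<le> K" using compact_imp_bounded bounded_iff by metis
  then have "\<bar>\<phi> x\<bar> \<le> K" for x using periodic_ex_torus[OF per, of x] by auto
  then show "\<exists>K. \<forall>x. \<bar>\<phi> x\<bar> \<le> K" by blast
qed

lemma L2_mult_test: "\<phi> \<in> test_functions \<Longrightarrow> u \<in> L2_space \<Longrightarrow> (\<lambda>x. \<phi> x *\<^sub>R u x) \<in> L2_space"
  using test_functionsD(5)[of \<phi>] by (auto intro!: L2_mult_bounded test_functionsD)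

lemma L2_mult_trig: "\<phi> \<in> trig \<Longrightarrow> u \<in> L2_space \<Longrightarrow> (\<lambda>x. \<phi> x *\<^sub>R u x) \<in> L2_space"
  by (intro L2_mult_test trig_test_functions)

lemma integral_torm_partial_deriv_test: "\<phi> \<in> test_functions \<Longrightarrow> (\<integral>x. partial_deriv i \<phi> x \<partial>torm) = 0"
  by (intro integral_torm_partial_deriv test_functionsD test_functions_partial_deriv)

section \<open>The torus as a compact subset of a Euclidean space, and completeness of the
  trigonometric system\<close>

definition torus_embed :: "real^2 \<Rightarrow> complex \<times> complex" where
  "torus_embed x = (cis (x $ 1), cis (x $ 2))"

lemma continuous_torus_embed: "continuous_on A torus_embed"
  unfolding torus_embed_def[abs_def] cis_conv_exp by (intro continuous_intros)

lemma torus_embed_measurable [measurable]: "torus_embed \<in> borel_measurable borel"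
  by (rule borel_measurable_continuous_onI[OF continuous_torus_embed])

lemma polynomial_torus_embed:
  assumes "real_polynomial_function p" shows "(\<lambda>x. p (torus_embed x)) \<in> trig"
  using assms
proof (induction p rule: real_polynomial_function.induct)
  case (linear f)
  then interpret bounded_linear f .
  have "f (torus_embed x) = f (1,0) * cos (phase (1,0) x) + f (\<i>,0) * sin (phase (1,0) x)
      + f (0,1) * cos (phase (0,1) x) + f (0,\<i>) * sin (phase (0,1) x)" for x
  proof -
    have "torus_embed x = cos (x$1) *\<^sub>R (1,0) + sin (x$1) *\<^sub>R (\<i>,0) + cos (x$2) *\<^sub>R (0,1) + sin (x$2) *\<^sub>R (0,\<i>)"
      by (simp add: torus_embed_def complex_eq_iff)
    then have "f (torus_embed x) = cos (x$1) *\<^sub>R f (1,0) + sin (x$1) *\<^sub>R f (\<i>,0)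
        + cos (x$2) *\<^sub>R f (0,1) + sin (x$2) *\<^sub>R f (0,\<i>)"
      by (simp only: add scale)
    then show ?thesis by (simp add: phase_def freq_def)
  qed
  then show ?case by (auto intro!: trig.intros)
qed (auto intro: trig_const trig.add trig_mult)

lemma Arg2pi_measurable [measurable]: "Arg2pi \<in> borel_measurable borel"
  by (rule borel_measurableI_le) (auto intro: borel_closed closed_Arg2pi2pi_le)

text \<open>An upper edge lies in a hyperplane, hence is null. The closed square contains both
  copies of each identified edge; without the upper ones \<open>torus_embed\<close> becomes
  injective.\<close>

lemma AE_torm_less: "AE x in torm. x $ i < 2*pi"
proof -
  have "negligible {x::real^2. x \<bullet> axis i 1 = 2*pi}"
    by (rule negligible_standard_hyperplane) (simp add: axis_in_Basis_iff)
  then have "{x::real^2. x \<bullet> axis i 1 = 2*pi} \<in> null_sets lborel"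
    by (subst (asm) negligible_iff_null_sets, subst (asm) null_sets_completion_iff) (auto simp: inner_axis)
  then have "AE x in lborel. x \<notin> {x::real^2. x \<bullet> axis i 1 = 2*pi}" by (rule AE_not_in)
  then show ?thesis
    unfolding AE_torm by eventually_elim (auto simp: inner_axis torus_def less_le)
qed

text \<open>
  Polynomials on the embedded torus are trigonometric, so by Stone-Weierstrass \<open>u\<close> is orthogonal to the
  indicators of open sets, hence (Dynkin) to those of all Borel sets of the plane, because the
  embedding has a measurable inverse on \<open>[0, 2\<pi>)\<^sup>2\<close>.
\<close>

theorem trig_complete:
  assumes u: "u \<in> L2_space"
    and orth: "\<And>k. (\<integral>x. cos (phase k x) *\<^sub>R u x \<partial>torm) = 0" "\<And>k. (\<integral>x. sin (phase k x) *\<^sub>R u x \<partial>torm) = 0"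
  shows "ae_eq u (\<lambda>x. 0)"
proof -
  have [measurable]: "u \<in> borel_measurable torm" "torus_embed \<in> borel_measurable torm"
    using u by (auto intro: L2_space_measurable borel_measurable_torm)
  have int_u: "integrable torm u" by (rule L2_space_integrable[OF u])
  have trig0: "(\<integral>x. f x *\<^sub>R u x \<partial>torm) = 0" if "f \<in> trig" for f
    using that
  proof induction
    case (add f g)
    then show ?case
      using L2_space_integrable[OF L2_mult_trig[OF add(1) u]] L2_space_integrable[OF L2_mult_trig[OF add(2) u]]
      by (simp add: scaleR_add_left)
  next
    case (scale f c)
    have "(\<integral>x. (c * f x) *\<^sub>R u x \<partial>torm) = (\<integral>x. c *\<^sub>R (f x *\<^sub>R u x) \<partial>torm)" by simp
    then show ?case by (simp only: integral_scaleR_right scale) simp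
  qed (auto simp: orth)
  have open0: "(\<integral>x. indicator U (torus_embed x) *\<^sub>R u x \<partial>torm) = 0" if U: "open U" for U
  \<comment> \<open>\<open>infdist\<close> to the empty set is zero, so the cut-offs below would not
    tend to the indicator of the whole space. That case is the mean of \<open>u\<close>, which is
    the zero mode.\<close>
  proof (cases "U = UNIV")
    case True then show ?thesis using orth(1)[of 0] by simp
  next
    case False
    have [measurable]: "U \<in> sets borel" using U by simp
    \<comment> \<open>Continuous cut-offs with values between 0 and 1 that converge pointwise to the
      indicator of \<open>U\<close>. Stone-Weierstrass approximates each of them uniformly on the
      embedded torus.\<close>
    define F where "F n z = min 1 (real n * infdist z (- U))" for n z
    have "\<exists>p. real_polynomial_function p \<and> (\<forall>z\<in>torus_embed ` torus. \<bar>F n z - p z\<bar> < 1 / real (Suc n))" for n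
    proof -
      have "compact (torus_embed ` torus)"
        by (intro compact_continuous_image compact_torus continuous_torus_embed)
      moreover have "continuous_on (torus_embed ` torus) (F n)"
        unfolding F_def by (intro continuous_intros)
      moreover have "0 < 1 / real (Suc n)" by simp
      ultimately obtain g where "real_polynomial_function g"
        "\<And>z. z \<in> torus_embed ` torus \<Longrightarrow> \<bar>F n z - g z\<bar> < 1 / real (Suc n)"
        by (rule Stone_Weierstrass_real_polynomial_function) blast
      then show ?thesis by blast
    qed
    then obtain p where p: "\<And>n. real_polynomial_function (p n)"
      "\<And>n x. x \<in> torus \<Longrightarrow> \<bar>F n (torus_embed x) - p n (torus_embed x)\<bar> < 1 / real (Suc n)"
      by (metis image_eqI)
    have F01: "0 \<le> F n z" "F n z \<le> 1" for n z by (auto simp: F_def infdist_nonneg)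
    have F_lim: "(\<lambda>n. F n z) \<longlonglongrightarrow> indicator U z" for z
    proof (cases "z \<in> U")
      case True
      have "infdist z (- U) > 0"
        using in_closed_iff_infdist_zero[of "- U" z] U False True infdist_nonneg[of z "- U"]
        by (auto simp: closed_Compl less_le)
      then obtain N :: nat where N: "1 < real N * infdist z (- U)"
        using reals_Archimedean3 by blast
      have "F n z = 1" if "n \<ge> N" for n
      proof -
        have "real N * infdist z (- U) \<le> real n * infdist z (- U)"
          using that by (intro mult_right_mono infdist_nonneg) simp
        then show ?thesis using N by (simp add: F_def)
      qed
      then have "(\<lambda>n. F n z) \<longlonglongrightarrow> 1" by (intro tendsto_eventually) (auto simp: eventually_sequentially)
      then show ?thesis using True by simp
    next
      case False
      then have "F n z = 0" for n by (simp add: F_def)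
      then show ?thesis using False by simp
    qed
    have "(\<lambda>n. \<integral>x. p n (torus_embed x) *\<^sub>R u x \<partial>torm) \<longlonglongrightarrow> (\<integral>x. indicator U (torus_embed x) *\<^sub>R u x \<partial>torm)"
    proof (rule integral_dominated_convergence[where w="\<lambda>x. 2 * norm (u x)"])
      show "(\<lambda>x. indicator U (torus_embed x) *\<^sub>R u x) \<in> borel_measurable torm" by measurable
      fix n
      have "(\<lambda>x. p n (torus_embed x)) \<in> borel_measurable torm"
        by (intro borel_measurable_torm test_functionsD(4) trig_test_functions polynomial_torus_embed p)
      then show "(\<lambda>x. p n (torus_embed x) *\<^sub>R u x) \<in> borel_measurable torm" by measurable
      show "AE x in torm. norm (p n (torus_embed x) *\<^sub>R u x) \<le> 2 * norm (u x)"
      proof (rule AE_I2)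
        fix x assume "x \<in> space torm"
        then have "\<bar>F n (torus_embed x) - p n (torus_embed x)\<bar> < 1 / real (Suc n)" using p(2) by simp
        moreover have "1 / real (Suc n) \<le> 1" by simp
        ultimately have "\<bar>p n (torus_embed x)\<bar> \<le> 2" using F01[of n "torus_embed x"] by linarith
        then show "norm (p n (torus_embed x) *\<^sub>R u x) \<le> 2 * norm (u x)" by (simp add: mult_right_mono)
      qed
    next
      show "AE x in torm. (\<lambda>n. p n (torus_embed x) *\<^sub>R u x) \<longlonglongrightarrow> indicator U (torus_embed x) *\<^sub>R u x"
      proof (rule AE_I2)
        fix x assume "x \<in> space torm"
        then have x: "\<bar>p n (torus_embed x) - F n (torus_embed x)\<bar> \<le> inverse (real (Suc n))" for n
          using p(2)[of x n] by (simp add: inverse_eq_divide abs_minus_commute)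
        have "(\<lambda>n. p n (torus_embed x) - F n (torus_embed x)) \<longlonglongrightarrow> 0"
          by (rule Lim_null_comparison[OF _ LIMSEQ_inverse_real_of_nat])
            (intro always_eventually allI, unfold real_norm_def, rule x)
        from tendsto_add[OF this F_lim[of "torus_embed x"]]
        have "(\<lambda>n. p n (torus_embed x)) \<longlonglongrightarrow> indicator U (torus_embed x)" by simp
        then show "(\<lambda>n. p n (torus_embed x) *\<^sub>R u x) \<longlonglongrightarrow> indicator U (torus_embed x) *\<^sub>R u x"
          by (intro tendsto_intros)
      qed
    qed (use int_u in auto)
    moreover have "(\<integral>x. p n (torus_embed x) *\<^sub>R u x \<partial>torm) = 0" for n
      by (rule trig0[OF polynomial_torus_embed[OF p(1)]])
    ultimately show ?thesis by (simp add: LIMSEQ_const_iff)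
  qed
  have int_ind: "integrable torm (\<lambda>x. indicator B (torus_embed x) *\<^sub>R u x)" if [measurable]: "B \<in> sets borel" for B
    by (rule Bochner_Integration.integrable_bound[OF int_u]) (auto split: split_indicator)
  have borel0: "(\<integral>x. indicator B (torus_embed x) *\<^sub>R u x \<partial>torm) = 0" if "B \<in> sets borel" for B
  proof -
    have "Int_stable {S :: (complex \<times> complex) set. open S}" by (auto simp: Int_stable_def)
    moreover have "{S :: (complex \<times> complex) set. open S} \<subseteq> Pow UNIV" by simp
    moreover have "B \<in> sigma_sets UNIV {S. open S}" using that by (simp add: borel_def)
    ultimately show ?thesis
    proof (induction rule: sigma_sets_induct_disjoint)
      case (basic A) then show ?case using open0 by simp
    next
      case empty then show ?case by simp
    next
      case (compl A)
      then have A: "A \<in> sets borel" by (simp add: borel_def)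
      have "indicator (UNIV - A) (torus_embed x) *\<^sub>R u x = u x - indicator A (torus_embed x) *\<^sub>R u x" for x
        by (simp split: split_indicator)
      then show ?case using compl int_ind[OF A] int_u orth(1)[of 0] by simp
    next
      case (union A)
      then have A [measurable]: "A i \<in> sets borel" for i by (auto simp: borel_def)
      have "(\<lambda>n. \<integral>x. indicator (\<Union>i<n. A i) (torus_embed x) *\<^sub>R u x \<partial>torm) \<longlonglongrightarrow>
         (\<integral>x. indicator (\<Union>i. A i) (torus_embed x) *\<^sub>R u x \<partial>torm)"
      proof (rule integral_dominated_convergence[where w="\<lambda>x. norm (u x)"])
        show "AE x in torm. (\<lambda>n. indicator (\<Union>i<n. A i) (torus_embed x) *\<^sub>R u x) \<longlonglongrightarrow>
            indicator (\<Union>i. A i) (torus_embed x) *\<^sub>R u x"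
          by (intro AE_I2 tendsto_intros LIMSEQ_indicator_UN)
        show "(\<lambda>x. indicator (\<Union>i. A i) (torus_embed x) *\<^sub>R u x) \<in> borel_measurable torm"
          by (intro borel_measurable_integrable int_ind sets.countable_UN) (auto intro: A)
        show "(\<lambda>x. indicator (\<Union>i<n. A i) (torus_embed x) *\<^sub>R u x) \<in> borel_measurable torm" for n
          by (intro borel_measurable_integrable int_ind sets.finite_UN) (auto intro: A)
      qed (use int_u in \<open>auto split: split_indicator\<close>)
      moreover have "(\<integral>x. indicator (\<Union>i<n. A i) (torus_embed x) *\<^sub>R u x \<partial>torm) = 0" for n
      proof -
        have "disjoint_family_on A {..<n}" using union by (auto simp: disjoint_family_on_def)
        then have "indicator (\<Union>i<n. A i) z = (\<Sum>i<n. indicator (A i) z :: real)" for z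
          by (intro indicator_UN_disjoint) auto
        then have "(\<integral>x. indicator (\<Union>i<n. A i) (torus_embed x) *\<^sub>R u x \<partial>torm)
          = (\<integral>x. (\<Sum>i<n. indicator (A i) (torus_embed x) *\<^sub>R u x) \<partial>torm)"
          by (simp add: scaleR_sum_left)
        also have "\<dots> = (\<Sum>i<n. \<integral>x. indicator (A i) (torus_embed x) *\<^sub>R u x \<partial>torm)"
          by (rule Bochner_Integration.integral_sum) (rule int_ind[OF A])
        also have "\<dots> = 0" using union by simp
        finally show ?thesis .
      qed
      ultimately show ?case by (simp add: LIMSEQ_const_iff)
    qed
  qed
  define L where "L z = mk2 (Arg2pi (fst z)) (Arg2pi (snd z))" for z
  have [measurable]: "L \<in> borel_measurable borel"
  proof -
    have "(\<lambda>z. Arg2pi (fst z) *\<^sub>R axis 1 1 + Arg2pi (snd z) *\<^sub>R (axis 2 1 :: real^2)) \<in> borel_measurable (borel \<Otimes>\<^sub>M borel)"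
      by measurable
    then show ?thesis unfolding L_def[abs_def] mk2_eq borel_prod .
  qed
  have L_E: "L (torus_embed x) = x" if "x \<in> torus" "x $ 1 < 2*pi" "x $ 2 < 2*pi" for x
  proof -
    have "Arg2pi (cis t) = t" if "0 \<le> t" "t < 2*pi" for t
      using Arg2pi_exp[of "\<i> * of_real t"] that by (simp add: cis_conv_exp)
    then show ?thesis using that by (simp add: L_def torus_embed_def torus_def mk2_eta)
  qed
  have set0: "(\<integral>x. indicator A x *\<^sub>R u x \<partial>torm) = 0" if A: "A \<in> sets torm" for A
  proof -
    have A' [measurable]: "A \<in> sets borel" using A by (auto simp: sets_torm sets_restrict_space)
    have B: "L -` A \<in> sets borel"
      using measurable_sets[OF \<open>L \<in> borel_measurable borel\<close> A'] by simp
    have "(\<integral>x. indicator A x *\<^sub>R u x \<partial>torm) = (\<integral>x. indicator (L -` A) (torus_embed x) *\<^sub>R u x \<partial>torm)"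
    proof (rule integral_cong_AE)
      show "(\<lambda>x. indicator A x *\<^sub>R u x) \<in> borel_measurable torm" using A by measurable
      show "(\<lambda>x. indicator (L -` A) (torus_embed x) *\<^sub>R u x) \<in> borel_measurable torm" using int_ind[OF B] by simp
      show "AE x in torm. indicator A x *\<^sub>R u x = indicator (L -` A) (torus_embed x) *\<^sub>R u x"
        using AE_torm_less[of 1] AE_torm_less[of 2] AE_space
        by eventually_elim (auto simp: L_E split: split_indicator)
    qed
    then show ?thesis using borel0[OF B] by simp
  qed
  have "AE x in torm. u x $ j = 0" for j
  proof (rule density_unique_real)
    show "integrable torm (\<lambda>x. u x $ j)"
      using integrable_bounded_linear[OF bounded_linear_vec_nth int_u] .
    fix A assume A: "A \<in> sets torm"
    then have iA: "integrable torm (\<lambda>x. indicator A x *\<^sub>R u x)"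
      using int_u by (rule integrable_mult_indicator)
    have "(\<integral>x\<in>A. u x $ j \<partial>torm) = (\<integral>x. indicator A x *\<^sub>R u x \<partial>torm) $ j"
      unfolding set_lebesgue_integral_def
      using integral_bounded_linear[OF bounded_linear_vec_nth iA, of j] by simp
    then show "(\<integral>x\<in>A. u x $ j \<partial>torm) = (\<integral>x\<in>A. 0 \<partial>torm)" using set0[OF A] by simp
  qed auto
  then have "AE x in torm. u x $ 1 = 0 \<and> u x $ 2 = 0" by auto
  then have "AE x in torm. u x = 0" by eventually_elim (simp add: vec_eq_iff forall_2)
  then show ?thesis
    using L2_space_periodic[OF u] by (subst ae_eq_torm_iff) (auto simp: periodic_def)
qed

section \<open>Fourier series\<close>

text \<open>Both \<open>k\<close> and \<open>- k\<close> are summed in \<open>psum\<close>, so each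
  nonconstant mode occurs twice. This makes \<open>1 / (4*pi\<^sup>2)\<close> the right factor for
  every frequency, zero included, and is why \<open>modes\<close> is symmetric under
  negation.\<close>

definition fourier_cos :: "int \<times> int \<Rightarrow> vfield \<Rightarrow> real^2" where
  "fourier_cos k u = (1 / (4*pi\<^sup>2)) *\<^sub>R (\<integral>x. cos (phase k x) *\<^sub>R u x \<partial>torm)"

definition fourier_sin :: "int \<times> int \<Rightarrow> vfield \<Rightarrow> real^2" where
  "fourier_sin k u = (1 / (4*pi\<^sup>2)) *\<^sub>R (\<integral>x. sin (phase k x) *\<^sub>R u x \<partial>torm)"

definition modes :: "nat \<Rightarrow> (int \<times> int) set" where
  "modes n = {- int n..int n} \<times> {- int n..int n}"

definition psum :: "nat \<Rightarrow> vfield \<Rightarrow> vfield" where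
  "psum n u x = (\<Sum>k\<in>modes n. cos (phase k x) *\<^sub>R fourier_cos k u + sin (phase k x) *\<^sub>R fourier_sin k u)"

definition coeff_inner :: "int \<times> int \<Rightarrow> vfield \<Rightarrow> vfield \<Rightarrow> real" where
  "coeff_inner k u v = fourier_cos k u \<bullet> fourier_cos k v + fourier_sin k u \<bullet> fourier_sin k v"

lemma finite_modes [simp]: "finite (modes n)" by (simp add: modes_def)

lemma modes_mono: "n \<le> m \<Longrightarrow> modes n \<subseteq> modes m" by (auto simp: modes_def)

lemma uminus_modes: "- k \<in> modes n \<longleftrightarrow> k \<in> modes n"
  by (cases k) (auto simp: modes_def)

lemma cos_trig_test: "(\<lambda>x. cos (phase k x)) \<in> test_functions"
  and sin_trig_test: "(\<lambda>x. sin (phase k x)) \<in> test_functions"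
  by (auto intro: trig_test_functions trig.intros)

lemma L2_cos_mult: "u \<in> L2_space \<Longrightarrow> (\<lambda>x. cos (phase k x) *\<^sub>R u x) \<in> L2_space"
  and L2_sin_mult: "u \<in> L2_space \<Longrightarrow> (\<lambda>x. sin (phase k x) *\<^sub>R u x) \<in> L2_space"
  using L2_mult_test[OF cos_trig_test] L2_mult_test[OF sin_trig_test] by auto

lemma L2_const: "(\<lambda>x. e) \<in> L2_space"
  by (rule L2_bounded[where K="norm e"]) (auto simp: periodic_def)

lemma freq_nonzero: "m \<noteq> 0 \<Longrightarrow> \<exists>i. freq m i \<noteq> 0"
proof -
  assume "m \<noteq> 0"
  then have "freq m 1 \<noteq> 0 \<or> freq m 2 \<noteq> 0" by (cases m) (auto simp: freq_def zero_prod_def)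
  then show ?thesis by blast
qed

lemma trig_integrable:
  assumes "f \<in> trig" shows "integrable torm f"
proof -
  obtain K where "\<forall>x. \<bar>f x\<bar> \<le> K" using trig_bounded[OF assms] by blast
  then show ?thesis
    by (intro torm.integrable_const_bound[where B=K] borel_measurable_torm test_functionsD(4)
      trig_test_functions assms) auto
qed

text \<open>A nonconstant mode is, up to a nonzero factor, a partial derivative of another mode, and
  partial derivatives of test functions have integral zero.\<close>

lemma integral_cos_phase: "(\<integral>x. cos (phase m x) \<partial>torm) = (if m = 0 then 4*pi\<^sup>2 else 0)"
proof (cases "m = 0")
  case True then show ?thesis by (simp add: measure_torm)
next
  case False
  then obtain i where i: "freq m i \<noteq> 0" using freq_nonzero by blast
  have "(\<integral>x. partial_deriv i (\<lambda>x. sin (phase m x)) x \<partial>torm) = 0"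
    by (rule integral_torm_partial_deriv_test[OF sin_trig_test])
  then show ?thesis using i False by (simp add: partial_deriv_sin)
qed

lemma integral_sin_phase: "(\<integral>x. sin (phase m x) \<partial>torm) = 0"
proof (cases "m = 0")
  case False
  then obtain i where i: "freq m i \<noteq> 0" using freq_nonzero by blast
  have "(\<integral>x. partial_deriv i (\<lambda>x. cos (phase m x)) x \<partial>torm) = 0"
    by (rule integral_torm_partial_deriv_test[OF cos_trig_test])
  then show ?thesis using i False by (simp add: partial_deriv_cos)
qed simp

lemma integrable_cos_phase: "integrable torm (\<lambda>x. cos (phase m x))"
  and integrable_sin_phase: "integrable torm (\<lambda>x. sin (phase m x))"
  by (auto intro!: torm.integrable_const_bound[where B=1] borel_measurable_torm test_functionsD(4) cos_trig_test sin_trig_test)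

lemma integral_cos_cos:
  "(\<integral>x. cos (phase k x) * cos (phase l x) \<partial>torm) = 2*pi\<^sup>2 * (of_bool (l = k) + of_bool (l = - k))"
proof -
  have "(\<integral>x. cos (phase k x) * cos (phase l x) \<partial>torm) = (\<integral>x. (1/2) * (cos (phase (k - l) x) + cos (phase (k + l) x)) \<partial>torm)"
    by (simp add: cos_times_cos phase_add phase_diff)
  also have "\<dots> = (1/2) * ((\<integral>x. cos (phase (k - l) x) \<partial>torm) + (\<integral>x. cos (phase (k + l) x) \<partial>torm))"
    by (subst integral_mult_right_zero) (simp add: integrable_cos_phase)
  also have "\<dots> = 2*pi\<^sup>2 * (of_bool (l = k) + of_bool (l = - k))"
    by (auto simp: integral_cos_phase eq_neg_iff_add_eq_0 add.commute)
  finally show ?thesis .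
qed

lemma integral_sin_sin:
  "(\<integral>x. sin (phase k x) * sin (phase l x) \<partial>torm) = 2*pi\<^sup>2 * (of_bool (l = k) - of_bool (l = - k))"
proof -
  have "(\<integral>x. sin (phase k x) * sin (phase l x) \<partial>torm) = (\<integral>x. (1/2) * (cos (phase (k - l) x) - cos (phase (k + l) x)) \<partial>torm)"
    by (simp add: sin_times_sin phase_add phase_diff)
  also have "\<dots> = (1/2) * ((\<integral>x. cos (phase (k - l) x) \<partial>torm) - (\<integral>x. cos (phase (k + l) x) \<partial>torm))"
    by (subst integral_mult_right_zero) (simp add: integrable_cos_phase)
  also have "\<dots> = 2*pi\<^sup>2 * (of_bool (l = k) - of_bool (l = - k))"
    by (auto simp: integral_cos_phase eq_neg_iff_add_eq_0 add.commute)
  finally show ?thesis .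
qed

lemma integral_cos_sin: "(\<integral>x. cos (phase k x) * sin (phase l x) \<partial>torm) = 0"
proof -
  have "(\<integral>x. cos (phase k x) * sin (phase l x) \<partial>torm) = (\<integral>x. (1/2) * (sin (phase (k + l) x) - sin (phase (k - l) x)) \<partial>torm)"
    by (simp add: cos_times_sin phase_add phase_diff)
  also have "\<dots> = (1/2) * ((\<integral>x. sin (phase (k + l) x) \<partial>torm) - (\<integral>x. sin (phase (k - l) x) \<partial>torm))"
    by (subst integral_mult_right_zero) (simp add: integrable_sin_phase)
  finally show ?thesis by (simp add: integral_sin_phase)
qed

lemma fourier_cos_uminus: "fourier_cos (- k) u = fourier_cos k u"
  and fourier_sin_uminus: "fourier_sin (- k) u = - fourier_sin k u"
  by (simp_all add: fourier_cos_def fourier_sin_def phase_uminus)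

lemma fourier_cos_diff: "u \<in> L2_space \<Longrightarrow> v \<in> L2_space \<Longrightarrow> fourier_cos k (\<lambda>x. u x - v x) = fourier_cos k u - fourier_cos k v"
  and fourier_sin_diff: "u \<in> L2_space \<Longrightarrow> v \<in> L2_space \<Longrightarrow> fourier_sin k (\<lambda>x. u x - v x) = fourier_sin k u - fourier_sin k v"
  by (simp_all add: fourier_cos_def fourier_sin_def scaleR_diff_right L2_space_integrable L2_cos_mult L2_sin_mult)

lemma fourier_cos_bound: "u \<in> L2_space \<Longrightarrow> norm (fourier_cos k u) \<le> L2_norm u"
  and fourier_sin_bound: "u \<in> L2_space \<Longrightarrow> norm (fourier_sin k u) \<le> L2_norm u"
proof -
  have pi1: "1 * (2*pi) \<le> 4*pi\<^sup>2" using pi_ge_two by (simp add: power2_eq_square)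
  assume u: "u \<in> L2_space"
  have "norm (\<integral>x. cos (phase k x) *\<^sub>R u x \<partial>torm) \<le> 1 * (2*pi) * L2_norm u"
    by (rule integral_torm_le_L2_norm[OF u]) (auto intro: test_functionsD cos_trig_test)
  also have "\<dots> \<le> (4*pi\<^sup>2) * L2_norm u" using pi1 by (rule mult_right_mono) simp
  finally show "norm (fourier_cos k u) \<le> L2_norm u" by (simp add: fourier_cos_def field_simps)
  have "norm (\<integral>x. sin (phase k x) *\<^sub>R u x \<partial>torm) \<le> 1 * (2*pi) * L2_norm u"
    by (rule integral_torm_le_L2_norm[OF u]) (auto intro: test_functionsD sin_trig_test)
  also have "\<dots> \<le> (4*pi\<^sup>2) * L2_norm u" using pi1 by (rule mult_right_mono) simp
  finally show "norm (fourier_sin k u) \<le> L2_norm u" by (simp add: fourier_sin_def field_simps)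
qed

lemma psum_trig: "(\<lambda>x. psum n u x $ j) \<in> trig"
  unfolding psum_def sum_component vector_add_component vector_scaleR_component real_scaleR_def
  by (intro trig_sum trig.add) (auto simp: mult.commute[of "cos _"] mult.commute[of "sin _"] intro: trig.intros)

lemma psum_norm_le: "norm (psum n u x) \<le> (\<Sum>k\<in>modes n. norm (fourier_cos k u) + norm (fourier_sin k u))"
  unfolding psum_def
proof (rule order_trans[OF norm_sum sum_mono])
  fix k
  have "norm (cos (phase k x) *\<^sub>R fourier_cos k u) \<le> 1 * norm (fourier_cos k u)"
    unfolding norm_scaleR by (intro mult_right_mono) auto
  moreover have "norm (sin (phase k x) *\<^sub>R fourier_sin k u) \<le> 1 * norm (fourier_sin k u)"
    unfolding norm_scaleR by (intro mult_right_mono) auto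
  ultimately show "norm (cos (phase k x) *\<^sub>R fourier_cos k u + sin (phase k x) *\<^sub>R fourier_sin k u)
    \<le> norm (fourier_cos k u) + norm (fourier_sin k u)"
    by (intro order_trans[OF norm_triangle_ineq]) simp
qed

lemma psum_L2: "psum n u \<in> L2_space"
proof (rule L2_bounded[OF _ _ psum_norm_le])
  have meas: "(\<lambda>x. psum n u x $ j) \<in> borel_measurable borel" for j
    by (intro test_functionsD(4) trig_test_functions psum_trig)
  show "psum n u \<in> borel_measurable borel"
    by (subst borel_measurable_euclidean_space) (auto simp: Basis_vec_def inner_axis meas)
  show "periodic (psum n u)"
    using trig_periodic[OF psum_trig] by (simp add: periodic_def vec_eq_iff)
qed

lemma L2_inner_cos:
  assumes u: "u \<in> L2_space"
  shows "L2_inner u (\<lambda>x. cos (phase k x) *\<^sub>R e) = 4*pi\<^sup>2 * (fourier_cos k u \<bullet> e)"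
    and "L2_inner u (\<lambda>x. sin (phase k x) *\<^sub>R e) = 4*pi\<^sup>2 * (fourier_sin k u \<bullet> e)"
proof -
  have "(\<integral>x. cos (phase k x) *\<^sub>R u x \<partial>torm) \<bullet> e = (\<integral>x. (cos (phase k x) *\<^sub>R u x) \<bullet> e \<partial>torm)"
    using L2_space_integrable[OF L2_cos_mult[OF u]] by (intro integral_inner_left[symmetric])
  then show "L2_inner u (\<lambda>x. cos (phase k x) *\<^sub>R e) = 4*pi\<^sup>2 * (fourier_cos k u \<bullet> e)"
    by (simp add: L2_inner_eq fourier_cos_def)
  have "(\<integral>x. sin (phase k x) *\<^sub>R u x \<partial>torm) \<bullet> e = (\<integral>x. (sin (phase k x) *\<^sub>R u x) \<bullet> e \<partial>torm)"
    using L2_space_integrable[OF L2_sin_mult[OF u]] by (intro integral_inner_left[symmetric])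
  then show "L2_inner u (\<lambda>x. sin (phase k x) *\<^sub>R e) = 4*pi\<^sup>2 * (fourier_sin k u \<bullet> e)"
    by (simp add: L2_inner_eq fourier_sin_def)
qed

lemma L2_inner_psum:
  assumes u: "u \<in> L2_space"
  shows "L2_inner u (psum n v) = 4*pi\<^sup>2 * (\<Sum>k\<in>modes n. coeff_inner k u v)"
proof -
  have i: "integrable torm (\<lambda>x. u x \<bullet> (cos (phase k x) *\<^sub>R e))" "integrable torm (\<lambda>x. u x \<bullet> (sin (phase k x) *\<^sub>R e))" for k e
    using L2_inner_integrable[OF u L2_cos_mult[OF L2_const]] L2_inner_integrable[OF u L2_sin_mult[OF L2_const]] by auto
  have "L2_inner u (psum n v) = (\<integral>x. (\<Sum>k\<in>modes n. u x \<bullet> (cos (phase k x) *\<^sub>R fourier_cos k v) + u x \<bullet> (sin (phase k x) *\<^sub>R fourier_sin k v)) \<partial>torm)"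
    unfolding L2_inner_eq psum_def by (simp only: inner_sum_right inner_add_right)
  also have "\<dots> = (\<Sum>k\<in>modes n. L2_inner u (\<lambda>x. cos (phase k x) *\<^sub>R fourier_cos k v) + L2_inner u (\<lambda>x. sin (phase k x) *\<^sub>R fourier_sin k v))"
    unfolding L2_inner_eq using i
    by (subst Bochner_Integration.integral_sum)
      (auto intro!: sum.cong Bochner_Integration.integral_add Bochner_Integration.integrable_add simp del: inner_scaleR_right)
  also have "\<dots> = 4*pi\<^sup>2 * (\<Sum>k\<in>modes n. coeff_inner k u v)"
    by (simp only: L2_inner_cos[OF u] coeff_inner_def sum_distrib_left distrib_left)
  finally show ?thesis .
qed

text \<open>Orthogonality leaves only the frequencies \<open>k\<close> and \<open>- k\<close>. They
  contribute equally, since cosine coefficients are even and sine coefficients odd in the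
  frequency.\<close>

lemma coeff_psum:
  assumes k: "k \<in> modes n"
  shows "fourier_cos k (psum n u) = fourier_cos k u" "fourier_sin k (psum n u) = fourier_sin k u"
proof -
  have ii: "integrable torm (\<lambda>x. f x *\<^sub>R e)" if "f \<in> trig" for f and e :: "real^2"
    using L2_space_integrable[OF L2_mult_trig[OF that L2_const]] .
  have t: "(\<lambda>x. cos (phase k x) * cos (phase l x)) \<in> trig" "(\<lambda>x. cos (phase k x) * sin (phase l x)) \<in> trig"
    "(\<lambda>x. sin (phase k x) * cos (phase l x)) \<in> trig" "(\<lambda>x. sin (phase k x) * sin (phase l x)) \<in> trig" for l
    by (intro trig_mult trig.intros)+
  have s: "(\<Sum>l\<in>modes n. of_bool (l = k) *\<^sub>R f l) = f k" "(\<Sum>l\<in>modes n. of_bool (l = - k) *\<^sub>R f l) = f (- k)"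
    for f :: "int \<times> int \<Rightarrow> real^2"
    using k uminus_modes[of k n] by (simp_all add: of_bool_def if_distrib[of "\<lambda>c. c *\<^sub>R _"] sum.delta cong: if_cong)
  have "(\<integral>x. cos (phase k x) *\<^sub>R psum n u x \<partial>torm) = (\<integral>x. (\<Sum>l\<in>modes n.
      (cos (phase k x) * cos (phase l x)) *\<^sub>R fourier_cos l u + (cos (phase k x) * sin (phase l x)) *\<^sub>R fourier_sin l u) \<partial>torm)"
    unfolding psum_def by (simp add: scaleR_sum_right scaleR_add_right)
  also have "\<dots> = (\<Sum>l\<in>modes n. (\<integral>x. cos (phase k x) * cos (phase l x) \<partial>torm) *\<^sub>R fourier_cos l u
      + (\<integral>x. cos (phase k x) * sin (phase l x) \<partial>torm) *\<^sub>R fourier_sin l u)"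
    by (simp add: ii t trig_integrable)
  also have "\<dots> = (2*pi\<^sup>2) *\<^sub>R ((\<Sum>l\<in>modes n. of_bool (l = k) *\<^sub>R fourier_cos l u) + (\<Sum>l\<in>modes n. of_bool (l = - k) *\<^sub>R fourier_cos l u))"
    unfolding integral_cos_cos integral_cos_sin
    by (simp add: scaleR_add_left scaleR_sum_right sum.distrib scaleR_add_right distrib_left)
  also have "\<dots> = (4*pi\<^sup>2) *\<^sub>R fourier_cos k u"
    unfolding s fourier_cos_uminus by (simp add: scaleR_2[symmetric])
  finally show "fourier_cos k (psum n u) = fourier_cos k u" by (simp add: fourier_cos_def)
  have "(\<integral>x. sin (phase k x) *\<^sub>R psum n u x \<partial>torm) = (\<integral>x. (\<Sum>l\<in>modes n.
      (sin (phase k x) * cos (phase l x)) *\<^sub>R fourier_cos l u + (sin (phase k x) * sin (phase l x)) *\<^sub>R fourier_sin l u) \<partial>torm)"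
    unfolding psum_def by (simp add: scaleR_sum_right scaleR_add_right)
  also have "\<dots> = (\<Sum>l\<in>modes n. (\<integral>x. cos (phase l x) * sin (phase k x) \<partial>torm) *\<^sub>R fourier_cos l u
      + (\<integral>x. sin (phase k x) * sin (phase l x) \<partial>torm) *\<^sub>R fourier_sin l u)"
    using t by (simp add: ii trig_integrable mult.commute[of "sin (phase k _)" "cos _"])
  also have "\<dots> = (2*pi\<^sup>2) *\<^sub>R ((\<Sum>l\<in>modes n. of_bool (l = k) *\<^sub>R fourier_sin l u) - (\<Sum>l\<in>modes n. of_bool (l = - k) *\<^sub>R fourier_sin l u))"
    unfolding integral_sin_sin integral_cos_sin
    by (simp add: scaleR_diff_left scaleR_sum_right sum_subtractf scaleR_diff_right right_diff_distrib)
  also have "\<dots> = (4*pi\<^sup>2) *\<^sub>R fourier_sin k u"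
    unfolding s fourier_sin_uminus by (simp add: scaleR_2[symmetric])
  finally show "fourier_sin k (psum n u) = fourier_sin k u" by (simp add: fourier_sin_def)
qed

lemma coeff_inner_psum: "k \<in> modes n \<Longrightarrow> coeff_inner k (psum n u) v = coeff_inner k u v"
  by (simp add: coeff_inner_def coeff_psum)

lemma L2_inner_psum_psum:
  assumes "n \<le> m"
  shows "L2_inner (psum m u) (psum n v) = 4*pi\<^sup>2 * (\<Sum>k\<in>modes n. coeff_inner k u v)"
  unfolding L2_inner_psum[OF psum_L2]
  using modes_mono[OF assms] by (auto intro!: sum.cong simp: coeff_inner_psum subset_iff)

lemma psum_norm_sq: "(L2_norm (psum n u))\<^sup>2 = 4*pi\<^sup>2 * (\<Sum>k\<in>modes n. coeff_inner k u u)"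
  by (simp add: L2_norm_sq L2_inner_psum_psum)

lemma coeff_inner_nonneg: "0 \<le> coeff_inner k u u"
  by (simp add: coeff_inner_def)

lemma bessel:
  assumes "u \<in> L2_space" shows "(L2_norm (psum n u))\<^sup>2 \<le> (L2_norm u)\<^sup>2"
proof -
  have "0 \<le> (L2_norm (\<lambda>x. u x - psum n u x))\<^sup>2" by simp
  also have "\<dots> = (L2_norm u)\<^sup>2 - (L2_norm (psum n u))\<^sup>2"
    by (simp add: L2_norm_diff_sq[OF assms psum_L2] L2_inner_psum[OF assms] psum_norm_sq)
  finally show ?thesis by simp
qed

text \<open>Completeness of the trigonometric system, applied to the difference. This is how the
  choice behind \<open>weak_deriv\<close> is pinned down.\<close>

lemma coeff_eq_imp_ae_eq:
  assumes "u \<in> L2_space" "v \<in> L2_space" "\<And>k. fourier_cos k u = fourier_cos k v" "\<And>k. fourier_sin k u = fourier_sin k v"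
  shows "ae_eq u v"
proof -
  have "ae_eq (\<lambda>x. u x - v x) (\<lambda>x. 0)"
  proof (rule trig_complete[OF L2_diff[OF assms(1,2)]])
    fix k
    show "(\<integral>x. cos (phase k x) *\<^sub>R (u x - v x) \<partial>torm) = 0"
      using fourier_cos_diff[OF assms(1,2), of k] assms(3)[of k] by (simp add: fourier_cos_def)
    show "(\<integral>x. sin (phase k x) *\<^sub>R (u x - v x) \<partial>torm) = 0"
      using fourier_sin_diff[OF assms(1,2), of k] assms(4)[of k] by (simp add: fourier_sin_def)
  qed
  then show ?thesis by (simp add: ae_eq_def)
qed

text \<open>By Bessel's inequality the squared norms of the partial sums are bounded and increasing,
  so the partial sums are Cauchy. Their limit has the coefficients of \<open>u\<close>, and
  completeness of the system identifies it with \<open>u\<close>.\<close>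

theorem psum_tendsto:
  assumes u: "u \<in> L2_space"
  shows "(\<lambda>n. L2_norm (\<lambda>x. psum n u x - u x)) \<longlonglongrightarrow> 0"
proof -
  define a where "a n = (L2_norm (psum n u))\<^sup>2" for n
  have diff: "(L2_norm (\<lambda>x. psum m u x - psum n u x))\<^sup>2 = a m - a n" if "n \<le> m" for m n
    using that by (simp add: L2_norm_diff_sq psum_L2 L2_inner_psum_psum a_def psum_norm_sq)
  have "convergent a"
  proof (rule Bseq_monoseq_convergent)
    show "Bseq a" by (rule BseqI'[where K="(L2_norm u)\<^sup>2"]) (use bessel[OF u] in \<open>simp add: a_def\<close>)
    have "0 \<le> a m - a n" if "n \<le> m" for n m
      unfolding diff[OF that, symmetric] by (rule zero_le_power2)
    then show "monoseq a" by (simp add: monoseq_def)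
  qed
  then have "Cauchy a" by (rule convergent_Cauchy)
  have cauchy: "\<exists>M. \<forall>m\<ge>M. \<forall>n\<ge>M. L2_norm (\<lambda>x. psum m u x - psum n u x) < e" if e: "e > 0" for e
  proof -
    obtain M where M: "\<And>m n. m \<ge> M \<Longrightarrow> n \<ge> M \<Longrightarrow> \<bar>a m - a n\<bar> < e\<^sup>2"
      using CauchyD[OF \<open>Cauchy a\<close>, of "e\<^sup>2"] e by auto
    have "L2_norm (\<lambda>x. psum m u x - psum n u x) < e" if "m \<ge> M" "n \<ge> M" for m n
    proof (rule power2_less_imp_less)
      show "(L2_norm (\<lambda>x. psum m u x - psum n u x))\<^sup>2 < e\<^sup>2"
        using M[OF that] diff[of n m] diff[of m n] L2_norm_minus_commute[of "psum m u" "psum n u"]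
        by (cases "n \<le> m") auto
    qed (use e in simp)
    then show ?thesis by blast
  qed
  obtain v where v: "v \<in> L2_space" "(\<lambda>n. L2_norm (\<lambda>x. psum n u x - v x)) \<longlonglongrightarrow> 0"
    using L2_complete[of "\<lambda>n. psum n u", OF psum_L2 cauchy] by blast
  have ev: "\<forall>\<^sub>F n in sequentially. k \<in> modes n" for k
  proof -
    have "k \<in> modes n" if "n \<ge> nat (max \<bar>fst k\<bar> \<bar>snd k\<bar>)" for n
      using that by (cases k) (auto simp: modes_def)
    then show ?thesis by (auto simp: eventually_sequentially)
  qed
  have c: "fourier_cos k u = fourier_cos k v" and s: "fourier_sin k u = fourier_sin k v" for k
  proof -
    have "\<forall>\<^sub>F n in sequentially. norm (fourier_cos k u - fourier_cos k v) \<le> L2_norm (\<lambda>x. psum n u x - v x)"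
      using ev[of k]
    proof eventually_elim
      case (elim n)
      show ?case
        using fourier_cos_bound[OF L2_diff[OF psum_L2 v(1)], of k n u]
        by (simp add: fourier_cos_diff psum_L2 v(1) coeff_psum elim)
    qed
    then have "norm (fourier_cos k u - fourier_cos k v) \<le> 0"
      by (intro tendsto_lowerbound[OF v(2)]) auto
    then show "fourier_cos k u = fourier_cos k v" by simp
    have "\<forall>\<^sub>F n in sequentially. norm (fourier_sin k u - fourier_sin k v) \<le> L2_norm (\<lambda>x. psum n u x - v x)"
      using ev[of k]
    proof eventually_elim
      case (elim n)
      show ?case
        using fourier_sin_bound[OF L2_diff[OF psum_L2 v(1)], of k n u]
        by (simp add: fourier_sin_diff psum_L2 v(1) coeff_psum elim)
    qed
    then have "norm (fourier_sin k u - fourier_sin k v) \<le> 0"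
      by (intro tendsto_lowerbound[OF v(2)]) auto
    then show "fourier_sin k u = fourier_sin k v" by simp
  qed
  have "ae_eq u v" by (rule coeff_eq_imp_ae_eq[OF u v(1) c s])
  then have "ae_eq (\<lambda>x. psum n u x - v x) (\<lambda>x. psum n u x - u x)" for n
    by (auto simp: ae_eq_def elim!: eventually_mono)
  then have "L2_norm (\<lambda>x. psum n u x - v x) = L2_norm (\<lambda>x. psum n u x - u x)" for n
    by (rule L2_norm_ae_cong) (auto intro: L2_diff psum_L2 u v)
  with v(2) show ?thesis by simp
qed

lemma parseval_tendsto:
  assumes "u \<in> L2_space" "v \<in> L2_space"
  shows "(\<lambda>n. 4*pi\<^sup>2 * (\<Sum>k\<in>modes n. coeff_inner k u v)) \<longlonglongrightarrow> L2_inner u v"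
  using L2_inner_tendsto[OF psum_L2 assms(2,1) psum_tendsto[OF assms(2)]]
  by (simp add: L2_inner_commute[of _ u] L2_inner_psum[OF assms(1)])

section \<open>Weak derivatives\<close>

lemma is_weak_deriv_torm:
  "is_weak_deriv i u g \<longleftrightarrow> g \<in> L2_space \<and>
     (\<forall>\<phi>\<in>test_functions. (\<integral>x. partial_deriv i \<phi> x *\<^sub>R u x \<partial>torm) = - (\<integral>x. \<phi> x *\<^sub>R g x \<partial>torm))"
  by (simp add: is_weak_deriv_def set_integral_torus)

lemma is_weak_deriv_L2: "is_weak_deriv i u g \<Longrightarrow> g \<in> L2_space"
  by (simp add: is_weak_deriv_def)

text \<open>Cosines and sines are admissible test functions. Moving the derivative onto them turns
  it into multiplication by the frequency and exchanges the two families of coefficients.\<close>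

lemma is_weak_deriv_coeff:
  assumes "is_weak_deriv i u g"
  shows "fourier_cos k g = freq k i *\<^sub>R fourier_sin k u" "fourier_sin k g = - (freq k i *\<^sub>R fourier_cos k u)"
proof -
  have "(\<integral>x. partial_deriv i (\<lambda>x. cos (phase k x)) x *\<^sub>R u x \<partial>torm) = - (\<integral>x. cos (phase k x) *\<^sub>R g x \<partial>torm)"
    using assms cos_trig_test unfolding is_weak_deriv_torm by blast
  moreover have "(\<integral>x. partial_deriv i (\<lambda>x. cos (phase k x)) x *\<^sub>R u x \<partial>torm)
      = (\<integral>x. (- freq k i) *\<^sub>R (sin (phase k x) *\<^sub>R u x) \<partial>torm)"
    by (simp add: partial_deriv_cos)
  ultimately have "(\<integral>x. cos (phase k x) *\<^sub>R g x \<partial>torm) = freq k i *\<^sub>R (\<integral>x. sin (phase k x) *\<^sub>R u x \<partial>torm)"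
    by (simp only: integral_scaleR_right) simp
  then show "fourier_cos k g = freq k i *\<^sub>R fourier_sin k u" by (simp add: fourier_cos_def fourier_sin_def)
  have "(\<integral>x. partial_deriv i (\<lambda>x. sin (phase k x)) x *\<^sub>R u x \<partial>torm) = - (\<integral>x. sin (phase k x) *\<^sub>R g x \<partial>torm)"
    using assms sin_trig_test unfolding is_weak_deriv_torm by blast
  moreover have "(\<integral>x. partial_deriv i (\<lambda>x. sin (phase k x)) x *\<^sub>R u x \<partial>torm)
      = (\<integral>x. (freq k i) *\<^sub>R (cos (phase k x) *\<^sub>R u x) \<partial>torm)"
    by (simp add: partial_deriv_sin)
  ultimately have "(\<integral>x. sin (phase k x) *\<^sub>R g x \<partial>torm) = - (freq k i *\<^sub>R (\<integral>x. cos (phase k x) *\<^sub>R u x \<partial>torm))"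
    by (simp only: integral_scaleR_right) simp
  then show "fourier_sin k g = - (freq k i *\<^sub>R fourier_cos k u)" by (simp add: fourier_cos_def fourier_sin_def)
qed

lemma is_weak_deriv_unique:
  assumes "is_weak_deriv i u g" "is_weak_deriv i u g'" shows "ae_eq g g'"
  using assms by (intro coeff_eq_imp_ae_eq) (auto simp: is_weak_deriv_coeff is_weak_deriv_L2)

lemma integral_mult_ae_cong:
  fixes u v :: vfield
  assumes "ae_eq u v" "u \<in> L2_space" "v \<in> L2_space" "\<phi> \<in> test_functions"
  shows "(\<integral>x. \<phi> x *\<^sub>R u x \<partial>torm) = (\<integral>x. \<phi> x *\<^sub>R v x \<partial>torm)"
proof (rule integral_torm_ae_cong)
  show "ae_eq (\<lambda>x. \<phi> x *\<^sub>R u x) (\<lambda>x. \<phi> x *\<^sub>R v x)"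
    using assms(1) by (auto simp: ae_eq_def elim!: eventually_mono)
qed (intro L2_mult_test assms)+

lemma is_weak_deriv_ae_cong:
  assumes "is_weak_deriv i u g" "ae_eq u u'" "ae_eq g g'" "u \<in> L2_space" "u' \<in> L2_space" "g' \<in> L2_space"
  shows "is_weak_deriv i u' g'"
  using assms is_weak_deriv_L2[OF assms(1)]
  by (simp add: is_weak_deriv_torm integral_mult_ae_cong[OF assms(2,4,5), symmetric]
    integral_mult_ae_cong[OF assms(3) is_weak_deriv_L2[OF assms(1)] assms(6), symmetric]
    test_functions_partial_deriv)

lemma is_weak_deriv_diff:
  assumes "is_weak_deriv i u g" "is_weak_deriv i u' g'" "u \<in> L2_space" "u' \<in> L2_space"
  shows "is_weak_deriv i (\<lambda>x. u x - u' x) (\<lambda>x. g x - g' x)"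
  using assms is_weak_deriv_L2[OF assms(1)] is_weak_deriv_L2[OF assms(2)]
  by (simp add: is_weak_deriv_torm scaleR_diff_right L2_diff L2_space_integrable L2_mult_test test_functions_partial_deriv)

lemma weak_deriv_isI: "is_weak_deriv i u g \<Longrightarrow> is_weak_deriv i u (weak_deriv i u)"
  unfolding weak_deriv_def by (rule someI[where P="is_weak_deriv i u"])

lemma weak_deriv_works: "u \<in> H1_space \<Longrightarrow> is_weak_deriv i u (weak_deriv i u)"
  using weak_deriv_isI unfolding H1_space_def by blast

lemma weak_deriv_ae: "is_weak_deriv i u g \<Longrightarrow> ae_eq (weak_deriv i u) g"
  by (rule is_weak_deriv_unique[OF weak_deriv_isI])

lemma H1_L2: "u \<in> H1_space \<Longrightarrow> u \<in> L2_space"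
  and H2_weak_deriv_H1: "u \<in> H2_space \<Longrightarrow> weak_deriv i u \<in> H1_space"
  and V_H1: "u \<in> V_space \<Longrightarrow> u \<in> H1_space"
  and H_L2: "u \<in> H_space \<Longrightarrow> u \<in> L2_space"
  by (auto simp: H1_space_def H2_space_def V_space_def H_space_def)

lemma V_L2: "u \<in> V_space \<Longrightarrow> u \<in> L2_space"
  by (simp add: V_H1 H1_L2)

lemma V_H: "u \<in> V_space \<Longrightarrow> u \<in> H_space"
  by (simp add: V_space_def H_space_def H1_L2)

lemma weak_deriv_L2: "u \<in> H1_space \<Longrightarrow> weak_deriv i u \<in> L2_space"
  using weak_deriv_works is_weak_deriv_L2 by blast

lemma coeff_inner_weak_deriv:
  assumes "is_weak_deriv i u g"
  shows "coeff_inner k g g = (freq k i)\<^sup>2 * coeff_inner k u u"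
  by (simp add: coeff_inner_def is_weak_deriv_coeff[OF assms] power2_eq_square distrib_left)

text \<open>Compared mode by mode: a nonzero integer frequency has length at least one, and the mean
  condition removes the zero frequency. Passing to the limit in the partial sums gives the constant
  one.\<close>

theorem poincare:
  assumes u: "u \<in> L2_space" and mean: "(\<integral>x. u x \<partial>torm) = 0"
    and g: "\<And>i. is_weak_deriv i u (g i)"
  shows "(L2_norm u)\<^sup>2 \<le> (\<Sum>i\<in>UNIV. (L2_norm (g i))\<^sup>2)"
proof -
  have "(L2_norm (psum n u))\<^sup>2 \<le> (\<Sum>i\<in>UNIV. (L2_norm (g i))\<^sup>2)" for n
  proof -
    have "coeff_inner k u u \<le> coeff_inner k (g 1) (g 1) + coeff_inner k (g 2) (g 2)" for k
    proof (cases "k = 0")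
      case True
      then have "coeff_inner k u u = 0"
        using mean by (simp add: coeff_inner_def fourier_cos_def fourier_sin_def)
      then show ?thesis by (simp add: coeff_inner_nonneg)
    next
      case False
      have "1 \<le> (real_of_int z)\<^sup>2" if "z \<noteq> 0" for z
        using that by (metis of_int_1_le_iff of_int_power zero_less_power2 int_one_le_iff_zero_less)
      moreover have "fst k \<noteq> 0 \<or> snd k \<noteq> 0" using False by (simp add: prod_eq_iff)
      ultimately have "1 \<le> (freq k 1)\<^sup>2 + (freq k 2)\<^sup>2"
        by (auto simp: freq_def intro: add_increasing add_increasing2)
      then have "1 * coeff_inner k u u \<le> ((freq k 1)\<^sup>2 + (freq k 2)\<^sup>2) * coeff_inner k u u"
        by (intro mult_right_mono coeff_inner_nonneg)
      then show ?thesis by (simp add: coeff_inner_weak_deriv[OF g] distrib_right)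
    qed
    then have "(L2_norm (psum n u))\<^sup>2 \<le> 4*pi\<^sup>2 * (\<Sum>k\<in>modes n. coeff_inner k (g 1) (g 1) + coeff_inner k (g 2) (g 2))"
      unfolding psum_norm_sq by (intro mult_left_mono sum_mono) auto
    also have "\<dots> = (L2_norm (psum n (g 1)))\<^sup>2 + (L2_norm (psum n (g 2)))\<^sup>2"
      by (simp add: psum_norm_sq sum.distrib distrib_left)
    also have "\<dots> \<le> (\<Sum>i\<in>UNIV. (L2_norm (g i))\<^sup>2)"
      unfolding sum_2 by (intro add_mono bessel is_weak_deriv_L2[OF g])
    finally show ?thesis .
  qed
  moreover have "(\<lambda>n. (L2_norm (psum n u))\<^sup>2) \<longlonglongrightarrow> (L2_norm u)\<^sup>2"
    by (intro tendsto_power L2_norm_tendsto psum_L2 u psum_tendsto)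
  ultimately show ?thesis by (intro LIMSEQ_le_const2) auto
qed

lemma poincare_V: "u \<in> V_space \<Longrightarrow> L2_norm u \<le> V_norm u"
proof -
  assume u: "u \<in> V_space"
  have "(L2_norm u)\<^sup>2 \<le> (\<Sum>i\<in>UNIV. (L2_norm (weak_deriv i u))\<^sup>2)"
    using u by (intro poincare V_L2 weak_deriv_works V_H1) (auto simp: V_space_def set_integral_torus)
  then show ?thesis unfolding V_norm_def by (intro real_le_rsqrt)
qed

text \<open>By Parseval each frequency contributes \<open>- (freq k i)\<^sup>2\<close> times a
  nonnegative number. In the energy estimate this takes the place of integrating the Laplacian term
  by parts.\<close>

theorem laplacian_dissipative:
  assumes u: "u \<in> L2_space" and g: "is_weak_deriv i u g" and h: "is_weak_deriv i g h"
  shows "L2_inner h u \<le> 0"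
proof (rule LIMSEQ_le_const2[OF parseval_tendsto[OF is_weak_deriv_L2[OF h] u]])
  have "coeff_inner k h u = - ((freq k i)\<^sup>2 * coeff_inner k u u)" for k
    by (simp add: coeff_inner_def is_weak_deriv_coeff[OF h] is_weak_deriv_coeff[OF g] power2_eq_square distrib_left)
  then have "coeff_inner k h u \<le> 0" for k by (simp add: coeff_inner_nonneg)
  then show "\<exists>N. \<forall>n\<ge>N. 4*pi\<^sup>2 * (\<Sum>k\<in>modes n. coeff_inner k h u) \<le> 0"
    by (auto intro!: mult_nonneg_nonpos sum_nonpos)
qed

text \<open>Telescoping: the two terms added in a step are together at most
  \<open>4 / ((n+1) * (n+2))\<close>, which is the amount by which \<open>4 / (n+1)\<close>
  decreases. The value 5 gives equality at \<open>n = 0\<close>.\<close>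

lemma sum_inverse_squares_bound: "(\<Sum>j\<in>{- int n..int n}. 1 / (1 + (real_of_int j)\<^sup>2)) \<le> 5 - 4 / (real n + 1)"
proof (induction n)
  case (Suc n)
  have "{- int (Suc n)..int (Suc n)} = insert (- int (Suc n)) (insert (int (Suc n)) {- int n..int n})" by auto
  then have "(\<Sum>j\<in>{- int (Suc n)..int (Suc n)}. 1 / (1 + (real_of_int j)\<^sup>2))
    = 2 / (1 + (real n + 1)\<^sup>2) + (\<Sum>j\<in>{- int n..int n}. 1 / (1 + (real_of_int j)\<^sup>2))"
    by (simp add: power2_eq_square algebra_simps)
  also have "2 / (1 + (real n + 1)\<^sup>2) = 4 / (2 * (1 + (real n + 1)\<^sup>2))"
    using mult_divide_mult_cancel_left[of 2 2 "1 + (real n + 1)\<^sup>2"] by simp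
  also have "\<dots> \<le> 4 / ((real n + 1) * (real n + 2))"
  proof (rule divide_left_mono)
    show "(real n + 1) * (real n + 2) \<le> 2 * (1 + (real n + 1)\<^sup>2)"
      by (simp add: power2_eq_square algebra_simps)
    show "0 < 2 * (1 + (real n + 1)\<^sup>2) * ((real n + 1) * (real n + 2))"
      by (intro mult_pos_pos) (auto intro: add_pos_nonneg add_nonneg_pos)
  qed simp
  also have "4 / ((real n + 1) * (real n + 2)) = 4 / (real n + 1) - 4 / (real n + 2)"
    by (simp add: field_simps)
  finally show ?case using Suc by (simp add: add.commute)
qed simp

lemma sum_weights_bound: "(\<Sum>k\<in>modes n. 1 / ((1 + (freq k 1)\<^sup>2) * (1 + (freq k 2)\<^sup>2))) \<le> 25"
proof -
  define S where "S = (\<Sum>j\<in>{- int n..int n}. 1 / (1 + (real_of_int j)\<^sup>2))"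
  have "(\<Sum>k\<in>modes n. 1 / ((1 + (freq k 1)\<^sup>2) * (1 + (freq k 2)\<^sup>2))) = S * S"
    unfolding S_def sum_product modes_def sum.cartesian_product
    by (auto intro!: sum.cong simp: freq_def)
  moreover have "0 \<le> S" unfolding S_def by (intro sum_nonneg) (simp add: add_nonneg_nonneg)
  moreover have "0 \<le> 4 / (real n + 1)" by simp
  then have "S \<le> 5" using sum_inverse_squares_bound[of n] unfolding S_def by linarith
  ultimately show ?thesis using mult_mono[of S 5 S 5] by simp
qed

text \<open>
  The weight \<open>(1 + k\<^sub>1\<^sup>2) (1 + k\<^sub>2\<^sup>2)\<close> has a summable inverse, and against the squared coefficients of
  \<open>u\<close> it produces exactly the norms of \<open>u\<close>, its two first derivatives and the mixed one.
\<close>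

lemma psum_bounded:
  assumes u: "u \<in> L2_space" and g1: "is_weak_deriv 1 u g1" and g2: "is_weak_deriv 2 u g2"
    and g12: "is_weak_deriv 1 g2 g12"
  shows "\<exists>K. \<forall>n x. norm (psum n u x) \<le> K"
proof -
  define R where "R = (L2_norm u)\<^sup>2 + (L2_norm g1)\<^sup>2 + (L2_norm g2)\<^sup>2 + (L2_norm g12)\<^sup>2"
  have "norm (psum n u x) \<le> sqrt (25 * (2 * R))" for n x
  proof (rule real_le_rsqrt)
    define w where "w k = (1 + (freq k 1)\<^sup>2) * (1 + (freq k 2)\<^sup>2)" for k
    define a where "a k = norm (fourier_cos k u) + norm (fourier_sin k u)" for k
    have w: "w k > 0" for k unfolding w_def by (intro mult_pos_pos) (auto intro: add_pos_nonneg)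
    have "(norm (psum n u x))\<^sup>2 \<le> (\<Sum>k\<in>modes n. a k)\<^sup>2"
      unfolding a_def by (intro power_mono psum_norm_le) simp
    also have "(\<Sum>k\<in>modes n. a k) = (\<Sum>k\<in>modes n. (1 / sqrt (w k)) * (sqrt (w k) * a k))"
      using w by (intro sum.cong) (auto simp: less_imp_neq[THEN not_sym])
    also have "\<dots>\<^sup>2 \<le> (\<Sum>k\<in>modes n. (1 / sqrt (w k))\<^sup>2) * (\<Sum>k\<in>modes n. (sqrt (w k) * a k)\<^sup>2)"
      by (rule Cauchy_Schwarz_ineq_sum)
    also have "(\<Sum>k\<in>modes n. (1 / sqrt (w k))\<^sup>2) = (\<Sum>k\<in>modes n. 1 / w k)"
      using w by (intro sum.cong) (auto simp: power_divide less_imp_le)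
    also have "(\<Sum>k\<in>modes n. (sqrt (w k) * a k)\<^sup>2) = (\<Sum>k\<in>modes n. w k * (a k)\<^sup>2)"
      using w by (intro sum.cong) (auto simp: power_mult_distrib less_imp_le)
    also have "(\<Sum>k\<in>modes n. 1 / w k) * \<dots> \<le> 25 * (2 * R)"
    proof (rule mult_mono)
      show "(\<Sum>k\<in>modes n. 1 / w k) \<le> 25" unfolding w_def by (rule sum_weights_bound)
      have "w k * (a k)\<^sup>2 \<le> 2 * (coeff_inner k u u + coeff_inner k g1 g1 + coeff_inner k g2 g2 + coeff_inner k g12 g12)" for k
      proof -
        have "(a k)\<^sup>2 \<le> 2 * coeff_inner k u u"
          using sum_squares_bound[of "norm (fourier_cos k u)" "norm (fourier_sin k u)"]
          by (simp add: a_def coeff_inner_def power2_sum power2_norm_eq_inner)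
        then have "w k * (a k)\<^sup>2 \<le> w k * (2 * coeff_inner k u u)"
          using w[of k] by (intro mult_left_mono) auto
        also have "\<dots> = 2 * (coeff_inner k u u + coeff_inner k g1 g1 + coeff_inner k g2 g2 + coeff_inner k g12 g12)"
          by (simp add: w_def coeff_inner_weak_deriv[OF g1] coeff_inner_weak_deriv[OF g2] coeff_inner_weak_deriv[OF g12] algebra_simps)
        finally show ?thesis .
      qed
      then have "(\<Sum>k\<in>modes n. w k * (a k)\<^sup>2) \<le> (\<Sum>k\<in>modes n. 2 * (coeff_inner k u u + coeff_inner k g1 g1 + coeff_inner k g2 g2 + coeff_inner k g12 g12))"
        by (intro sum_mono)
      also have "\<dots> = 2 * ((\<Sum>k\<in>modes n. coeff_inner k u u) + (\<Sum>k\<in>modes n. coeff_inner k g1 g1)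
          + (\<Sum>k\<in>modes n. coeff_inner k g2 g2) + (\<Sum>k\<in>modes n. coeff_inner k g12 g12))"
        by (simp add: sum.distrib sum_distrib_left[symmetric])
      also have "\<dots> \<le> 2 * R"
      proof -
        have b: "(\<Sum>k\<in>modes n. coeff_inner k v v) \<le> (L2_norm v)\<^sup>2" if "v \<in> L2_space" for v
        proof -
          have "1 * (\<Sum>k\<in>modes n. coeff_inner k v v) \<le> 4*pi\<^sup>2 * (\<Sum>k\<in>modes n. coeff_inner k v v)"
            using pi_ge_two mult_mono[of 1 pi 1 pi]
            by (intro mult_right_mono sum_nonneg coeff_inner_nonneg) (auto simp: power2_eq_square)
          then show ?thesis using bessel[OF that, of n] by (simp add: psum_norm_sq)
        qed
        show ?thesis
          unfolding R_def using b[OF u] b[OF is_weak_deriv_L2[OF g1]] b[OF is_weak_deriv_L2[OF g2]] b[OF is_weak_deriv_L2[OF g12]] by simp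
      qed
      finally show "(\<Sum>k\<in>modes n. w k * (a k)\<^sup>2) \<le> 2 * R" .
      show "0 \<le> (\<Sum>k\<in>modes n. w k * (a k)\<^sup>2)" using w by (intro sum_nonneg mult_nonneg_nonneg) (auto simp: less_imp_le)
    qed simp
    finally show "(norm (psum n u x))\<^sup>2 \<le> 25 * (2 * R)" .
  qed
  then show ?thesis by blast
qed

text \<open>The excess of \<open>norm (u x)\<close> over the uniform bound of the partial sums is at
  most \<open>norm (psum n u x - u x)\<close> for every \<open>n\<close>. Its square therefore has
  integral zero, since the partial sums converge in norm.\<close>

theorem sobolev_bounded:
  assumes "u \<in> L2_space" "is_weak_deriv 1 u g1" "is_weak_deriv 2 u g2" "is_weak_deriv 1 g2 g12"
  shows "\<exists>K. AE x in torm. norm (u x) \<le> K"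
proof -
  obtain K where K: "\<And>n x. norm (psum n u x) \<le> K" using psum_bounded[OF assms] by blast
  note u = assms(1)
  define f where "f x = max 0 (norm (u x) - K)" for x
  have [measurable]: "u \<in> borel_measurable torm" using u by (rule L2_space_measurable)
  have f_le: "(f x)\<^sup>2 \<le> (norm (psum n u x - u x))\<^sup>2" for n x
  proof (rule power_mono)
    show "f x \<le> norm (psum n u x - u x)"
      using K[of n x] norm_triangle_ineq3[of "psum n u x" "u x"] by (auto simp: f_def)
  qed (simp add: f_def)
  have int: "integrable torm (\<lambda>x. (f x)\<^sup>2)"
  proof (rule Bochner_Integration.integrable_bound[OF L2_space_integrable_sq[OF L2_diff[OF psum_L2 u]]])
    show "AE x in torm. norm ((f x)\<^sup>2) \<le> norm ((norm (psum 0 u x - u x))\<^sup>2)"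
      using f_le by auto
  qed (simp add: f_def)
  have "(\<integral>x. (f x)\<^sup>2 \<partial>torm) \<le> (L2_norm (\<lambda>x. psum n u x - u x))\<^sup>2" for n
    unfolding L2_norm_sq_integral
    by (intro integral_mono int L2_space_integrable_sq L2_diff psum_L2 u f_le)
  moreover have "(\<lambda>n. (L2_norm (\<lambda>x. psum n u x - u x))\<^sup>2) \<longlonglongrightarrow> 0"
    using tendsto_power[OF psum_tendsto[OF u], of 2] by simp
  ultimately have "(\<integral>x. (f x)\<^sup>2 \<partial>torm) \<le> 0"
    using LIMSEQ_le_const by blast
  then have "(\<integral>x. (f x)\<^sup>2 \<partial>torm) = 0" by (intro antisym) auto
  then have "AE x in torm. (f x)\<^sup>2 = 0" using int by (subst (asm) integral_nonneg_eq_0_iff_AE) auto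
  then have "AE x in torm. norm (u x) \<le> K" by eventually_elim (simp add: f_def max_def split: if_splits)
  then show ?thesis by blast
qed

lemma L2_norm_mult_le:
  assumes u: "u \<in> L2_space" and c: "c \<in> borel_measurable borel" "periodic c" and b: "AE x in torm. \<bar>c x\<bar> \<le> K"
    and K: "0 \<le> K"
  shows "L2_norm (\<lambda>x. c x *\<^sub>R u x) \<le> K * L2_norm u"
proof (rule power2_le_imp_le)
  have "(\<integral>x. (norm (c x *\<^sub>R u x))\<^sup>2 \<partial>torm) \<le> (\<integral>x. K\<^sup>2 * (norm (u x))\<^sup>2 \<partial>torm)"
  proof (rule integral_mono_AE)
    show "AE x in torm. (norm (c x *\<^sub>R u x))\<^sup>2 \<le> K\<^sup>2 * (norm (u x))\<^sup>2"
      using b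
    proof eventually_elim
      case (elim x)
      then have "\<bar>c x\<bar>\<^sup>2 \<le> K\<^sup>2" by (intro power_mono) auto
      then have "\<bar>c x\<bar>\<^sup>2 * (norm (u x))\<^sup>2 \<le> K\<^sup>2 * (norm (u x))\<^sup>2" by (rule mult_right_mono) simp
      then show ?case by (simp add: power_mult_distrib)
    qed
  qed (use L2_space_integrable_sq[OF L2_mult_bounded[OF u c b]] L2_space_integrable_sq[OF u] in auto)
  then show "(L2_norm (\<lambda>x. c x *\<^sub>R u x))\<^sup>2 \<le> (K * L2_norm u)\<^sup>2"
    by (simp add: L2_norm_sq_integral power_mult_distrib)
qed (use K in simp)

lemma L2_inner_tendsto2:
  assumes "\<And>n. s n \<in> L2_space" "\<And>n. t n \<in> L2_space" "s' \<in> L2_space" "t' \<in> L2_space"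
    and s: "(\<lambda>n. L2_norm (\<lambda>x. s n x - s' x)) \<longlonglongrightarrow> 0"
    and t: "(\<lambda>n. L2_norm (\<lambda>x. t n x - t' x)) \<longlonglongrightarrow> 0"
  shows "(\<lambda>n. L2_inner (s n) (t n)) \<longlonglongrightarrow> L2_inner s' t'"
proof -
  have "(\<lambda>n. L2_inner (\<lambda>x. s n x - s' x) (t n)) \<longlonglongrightarrow> 0"
  proof (rule Lim_null_comparison)
    show "\<forall>\<^sub>F n in sequentially. norm (L2_inner (\<lambda>x. s n x - s' x) (t n)) \<le> L2_norm (\<lambda>x. s n x - s' x) * L2_norm (t n)"
      using L2_Cauchy_Schwarz[OF L2_diff[OF assms(1,3)] assms(2)] by simp
    show "(\<lambda>n. L2_norm (\<lambda>x. s n x - s' x) * L2_norm (t n)) \<longlonglongrightarrow> 0"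
      using tendsto_mult[OF s L2_norm_tendsto[OF assms(2,4) t]] by simp
  qed
  moreover have "(\<lambda>n. L2_inner s' (t n)) \<longlonglongrightarrow> L2_inner s' t'"
    using L2_inner_tendsto[OF assms(2,4,3) t] by (simp add: L2_inner_commute[of s'])
  ultimately have "(\<lambda>n. L2_inner (\<lambda>x. s n x - s' x) (t n) + L2_inner s' (t n)) \<longlonglongrightarrow> 0 + L2_inner s' t'"
    by (rule tendsto_add)
  then show ?thesis by (simp add: L2_inner_diff_left assms)
qed

text \<open>Truncation and weak differentiation both act on each frequency separately, so they
  commute; for the truncated field the derivative is a classical one.\<close>

lemma partial_deriv_psum:
  assumes "is_weak_deriv i u g"
  shows "partial_deriv i (\<lambda>x. psum n u x $ j) x = psum n g x $ j"
proof -
  have eq: "(\<lambda>x. psum n u x $ j) = (\<lambda>x. \<Sum>k\<in>modes n. cos (phase k x) * (fourier_cos k u $ j) + sin (phase k x) * (fourier_sin k u $ j))"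
    by (simp add: psum_def)
  have "((\<lambda>x. \<Sum>k\<in>modes n. cos (phase k x) * (fourier_cos k u $ j) + sin (phase k x) * (fourier_sin k u $ j)) has_derivative
      (\<lambda>h. \<Sum>k\<in>modes n. (- sin (phase k x) * phase k h) * (fourier_cos k u $ j) + (cos (phase k x) * phase k h) * (fourier_sin k u $ j))) (at x)"
    by (intro has_derivative_sum has_derivative_add has_derivative_mult_left cos_phase_has_derivative sin_phase_has_derivative)
  from partial_deriv_eqI[OF this, of i] show ?thesis
    unfolding eq by (simp add: psum_def phase_axis1 is_weak_deriv_coeff[OF assms] add.commute mult.assoc)
qed

lemma weakly_div_free_torm:
  "weakly_div_free u \<longleftrightarrow> (\<forall>\<phi>\<in>test_functions. (\<integral>x. (\<Sum>i\<in>UNIV. u x $ i * partial_deriv i \<phi> x) \<partial>torm) = 0)"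
  by (simp add: weakly_div_free_def set_integral_torus)

lemma L2_component:
  assumes "u \<in> L2_space"
  shows "(\<lambda>x. u x $ i) \<in> borel_measurable borel" "periodic (\<lambda>x. u x $ i)"
proof -
  show "(\<lambda>x. u x $ i) \<in> borel_measurable borel"
    by (rule measurable_compose[OF L2_space_borel[OF assms]])
      (intro borel_measurable_continuous_onI continuous_intros)
  show "periodic (\<lambda>x. u x $ i)"
    using L2_space_periodic[OF assms] by (simp add: periodic_def)
qed

text \<open>For smooth \<open>d\<close> the sum is half the integral of \<open>w\<close> against the
  gradient of the squared length of \<open>d\<close>, which vanishes because \<open>w\<close> is
  divergence free. In general \<open>d\<close> is replaced by its partial sums, whose squared length
  is a trigonometric polynomial and so a legitimate test function; boundedness of \<open>w\<close>
  allows the passage to the limit.\<close>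

theorem trilinear_zero:
  assumes w: "w \<in> L2_space" "weakly_div_free w" "AE x in torm. norm (w x) \<le> K"
    and d: "d \<in> L2_space" and g: "\<And>i. is_weak_deriv i d (g i)"
  shows "(\<Sum>i\<in>UNIV. L2_inner (\<lambda>x. (w x $ i) *\<^sub>R d x) (g i)) = 0"
proof -
  have wi: "AE x in torm. \<bar>w x $ i\<bar> \<le> max 0 K" for i
    using w(3) by eventually_elim (use component_le_norm_cart order_trans in \<open>fastforce simp: le_max_iff_disj\<close>)
  note wc = L2_component[OF w(1)]
  have gL: "g i \<in> L2_space" for i by (rule is_weak_deriv_L2[OF g])
  have L: "(\<lambda>x. (w x $ i) *\<^sub>R v x) \<in> L2_space" if "v \<in> L2_space" for v i
    by (rule L2_mult_bounded[OF that wc wi])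
  have zero: "(\<Sum>i\<in>UNIV. L2_inner (\<lambda>x. (w x $ i) *\<^sub>R psum n d x) (psum n (g i))) = 0" for n
  proof -
    define p where "p j x = psum n d x $ j" for j x
    have p: "p j \<in> trig" for j unfolding p_def by (rule psum_trig)
    define \<phi> where "\<phi> = (\<lambda>x. p 1 x * p 1 x + p 2 x * p 2 x)"
    have \<phi>: "\<phi> \<in> trig" unfolding \<phi>_def by (intro trig.add trig_mult p)
    have dp: "partial_deriv i (p j) x = psum n (g i) x $ j" for i j x
      unfolding p_def by (rule partial_deriv_psum[OF g])
    have d\<phi>: "partial_deriv i \<phi> x = 2 * (psum n d x \<bullet> psum n (g i) x)" for i x
      unfolding \<phi>_def using trig_differentiable[OF p]
      by (simp add: partial_deriv_add partial_deriv_mult dp inner_vec_def sum_2) (simp add: p_def algebra_simps)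
    have "0 = (\<integral>x. (\<Sum>i\<in>UNIV. w x $ i * partial_deriv i \<phi> x) \<partial>torm)"
      using w(2) trig_test_functions[OF \<phi>] by (simp add: weakly_div_free_torm)
    also have "\<dots> = (\<integral>x. (\<Sum>i\<in>UNIV. 2 * (((w x $ i) *\<^sub>R psum n d x) \<bullet> psum n (g i) x)) \<partial>torm)"
      by (simp add: d\<phi> mult.left_commute)
    also have "\<dots> = (\<Sum>i\<in>UNIV. (\<integral>x. 2 * (((w x $ i) *\<^sub>R psum n d x) \<bullet> psum n (g i) x) \<partial>torm))"
      by (intro Bochner_Integration.integral_sum integrable_mult_right L2_inner_integrable L psum_L2)
    also have "\<dots> = 2 * (\<Sum>i\<in>UNIV. L2_inner (\<lambda>x. (w x $ i) *\<^sub>R psum n d x) (psum n (g i)))"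
      by (simp only: integral_mult_right_zero L2_inner_eq sum_distrib_left)
    finally show ?thesis by simp
  qed
  have "(\<lambda>n. \<Sum>i\<in>UNIV. L2_inner (\<lambda>x. (w x $ i) *\<^sub>R psum n d x) (psum n (g i)))
      \<longlonglongrightarrow> (\<Sum>i\<in>UNIV. L2_inner (\<lambda>x. (w x $ i) *\<^sub>R d x) (g i))"
  proof (intro tendsto_sum L2_inner_tendsto2 L psum_L2 d gL psum_tendsto)
    fix i :: 2
    show "(\<lambda>n. L2_norm (\<lambda>x. (w x $ i) *\<^sub>R psum n d x - (w x $ i) *\<^sub>R d x)) \<longlonglongrightarrow> 0"
    proof (rule Lim_null_comparison)
      show "\<forall>\<^sub>F n in sequentially. norm (L2_norm (\<lambda>x. (w x $ i) *\<^sub>R psum n d x - (w x $ i) *\<^sub>R d x))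
          \<le> max 0 K * L2_norm (\<lambda>x. psum n d x - d x)"
        using L2_norm_mult_le[OF L2_diff[OF psum_L2 d] wc wi] by (simp add: scaleR_diff_right)
      show "(\<lambda>n. max 0 K * L2_norm (\<lambda>x. psum n d x - d x)) \<longlonglongrightarrow> 0"
        using tendsto_mult_left[OF psum_tendsto[OF d], of "max 0 K"] by simp
    qed
  qed
  then show ?thesis by (simp add: zero LIMSEQ_const_iff)
qed

section \<open>The Leray projector\<close>

lemma grad_test_L2: 
  assumes "\<phi> \<in> test_functions" shows "(\<lambda>x. \<chi> i. partial_deriv i \<phi> x) \<in> L2_space"
proof -
  have eq: "(\<lambda>x. \<chi> i. partial_deriv i \<phi> x) = (\<lambda>x. partial_deriv 1 \<phi> x *\<^sub>R axis 1 1 + partial_deriv 2 \<phi> x *\<^sub>R axis 2 1)"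
    by (simp add: fun_eq_iff vec_eq_iff forall_2 axis_def)
  show ?thesis unfolding eq
    by (intro L2_add L2_mult_test L2_const test_functions_partial_deriv assms)
qed

text \<open>Divergence freeness is orthogonality to gradients of test functions, and mean zero is
  orthogonality to constants. As the annihilator of a set, \<open>H_space\<close> has the form that
  \<open>L2_projection\<close> asks for.\<close>

lemma H_space_eq:
  "H_space = {u \<in> L2_space. \<forall>g\<in>(\<lambda>\<phi> x. \<chi> i. partial_deriv i \<phi> x) ` test_functions \<union> range (\<lambda>e x. e). L2_inner u g = 0}"
proof -
  have mean: "(\<integral>x. u x \<partial>torm) = 0 \<longleftrightarrow> (\<forall>e. L2_inner u (\<lambda>x. e) = 0)" if "u \<in> L2_space" for u
  proof -
    have "L2_inner u (\<lambda>x. e) = (\<integral>x. u x \<partial>torm) \<bullet> e" for e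
      unfolding L2_inner_eq using L2_space_integrable[OF that] by (intro integral_inner_left)
    then show ?thesis by (simp only:) (metis inner_eq_zero_iff inner_zero_left)
  qed
  have div: "weakly_div_free u \<longleftrightarrow> (\<forall>\<phi>\<in>test_functions. L2_inner u (\<lambda>x. \<chi> i. partial_deriv i \<phi> x) = 0)" for u
    by (simp add: weakly_div_free_torm L2_inner_eq inner_vec_def)
  show ?thesis
    unfolding H_space_def set_integral_torus by (auto simp: mean div)
qed

lemma leray_works:
  assumes "w \<in> L2_space"
  shows "leray w \<in> H_space" "h \<in> H_space \<Longrightarrow> L2_inner (leray w) h = L2_inner w h"
proof -
  have "\<exists>v. v \<in> H_space \<and> (\<forall>h\<in>H_space. L2_inner (\<lambda>x. w x - v x) h = 0)"
    by (rule L2_projection[OF _ assms H_space_eq]) (auto intro: grad_test_L2 L2_const)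
  then have *: "leray w \<in> H_space \<and> (\<forall>h\<in>H_space. L2_inner (w - leray w) h = 0)"
    unfolding leray_def by (intro someI_ex[of "\<lambda>v. v \<in> H_space \<and> (\<forall>h\<in>H_space. L2_inner (w - v) h = 0)"]) (simp add: fun_diff_def)
  then show L: "leray w \<in> H_space" by simp
  assume h: "h \<in> H_space"
  then have "L2_inner (\<lambda>x. w x - leray w x) h = 0" using * by (simp add: fun_diff_def)
  then show "L2_inner (leray w) h = L2_inner w h"
    using assms H_L2[OF L] H_L2[OF h] by (simp add: L2_inner_diff_left)
qed

lemma H_diff: "u \<in> H_space \<Longrightarrow> v \<in> H_space \<Longrightarrow> (\<lambda>x. u x - v x) \<in> H_space"
  unfolding H_space_eq using grad_test_L2 L2_const by (auto simp: L2_diff L2_inner_diff_left)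

lemma H_add: "u \<in> H_space \<Longrightarrow> v \<in> H_space \<Longrightarrow> (\<lambda>x. u x + v x) \<in> H_space"
  unfolding H_space_eq using grad_test_L2 L2_const by (auto simp: L2_add L2_inner_add_left)

text \<open>The difference \<open>leray w - v\<close> lies in \<open>H_space\<close> and so may be
  used as the test field in the defining orthogonality, which makes its norm zero. This evaluates
  the choice \<open>leray\<close> on fields that are already in \<open>H_space\<close>.\<close>

lemma leray_unique:
  assumes w: "w \<in> L2_space" and v: "v \<in> H_space" and ae: "ae_eq w v"
  shows "ae_eq (leray w) v"
proof -
  define h where "h = (\<lambda>x. leray w x - v x)"
  have h: "h \<in> H_space" using leray_works(1)[OF w] v by (simp add: h_def H_diff)
  have "L2_inner (leray w) h = L2_inner v h"
    using leray_works(2)[OF w h] L2_inner_ae_cong[OF ae ae_eq_refl w H_L2[OF v] H_L2[OF h] H_L2[OF h]] by simp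
  then have "L2_inner h h = 0"
    using L2_inner_diff_left[OF H_L2[OF leray_works(1)[OF w]] H_L2[OF v] H_L2[OF h]] by (simp add: h_def)
  then have "L2_norm (\<lambda>x. leray w x - v x) = 0" by (simp add: L2_norm_def h_def)
  then show ?thesis using H_L2[OF leray_works(1)[OF w]] H_L2[OF v] by (simp add: L2_norm_diff_eq_0)
qed

section \<open>Shear flows\<close>

text \<open>Product rule: the derivative of the periodic function \<open>\<phi> x * f x\<close> has
  integral zero, which moves the derivative from the test function to \<open>f\<close>.\<close>

lemma is_weak_deriv_trig:
  assumes f: "f \<in> trig"
  shows "is_weak_deriv i (\<lambda>x. f x *\<^sub>R e) (\<lambda>x. partial_deriv i f x *\<^sub>R e)"
  unfolding is_weak_deriv_torm
proof (intro conjI ballI)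
  show "(\<lambda>x. partial_deriv i f x *\<^sub>R e) \<in> L2_space"
    by (intro L2_mult_trig partial_deriv_trig f L2_const)
  fix \<phi> assume \<phi>: "\<phi> \<in> test_functions"
  note ft = trig_test_functions[OF f]
  have pd: "partial_deriv i (\<lambda>x. \<phi> x * f x) = (\<lambda>x. \<phi> x * partial_deriv i f x + partial_deriv i \<phi> x * f x)"
    using partial_deriv_mult[OF test_functionsD(2)[OF \<phi>] test_functionsD(2)[OF ft]] by blast
  have int: "integrable torm (\<lambda>x. (\<psi> x * \<eta> x) *\<^sub>R e)" if "\<psi> \<in> test_functions" "\<eta> \<in> test_functions" for \<psi> \<eta>
    using L2_space_integrable[OF L2_mult_test[OF that(1) L2_mult_test[OF that(2) L2_const]]] by simp
  have intr: "integrable torm (\<lambda>x. \<psi> x * \<eta> x)" if h: "\<psi> \<in> test_functions" "\<eta> \<in> test_functions" for \<psi> \<eta>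
  proof -
    obtain K where K: "\<And>x. \<bar>\<psi> x\<bar> \<le> K" using test_functionsD(5)[OF h(1)] by blast
    obtain L where L: "\<And>x. \<bar>\<eta> x\<bar> \<le> L" using test_functionsD(5)[OF h(2)] by blast
    have "\<bar>\<psi> x * \<eta> x\<bar> \<le> K * L" for x
      unfolding abs_mult using K[of x] L[of x] by (intro mult_mono) auto
    then show ?thesis
      using h by (intro torm.integrable_const_bound[where B="K * L"] borel_measurable_torm borel_measurable_times test_functionsD(4)) auto
  qed
  have "(\<integral>x. partial_deriv i (\<lambda>x. \<phi> x * f x) x \<partial>torm) = 0"
  proof (rule integral_torm_partial_deriv)
    show "periodic (\<lambda>x. \<phi> x * f x)"
      using test_functionsD(1)[OF \<phi>] test_functionsD(1)[OF ft] by (simp add: periodic_def)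
    show "(\<lambda>x. \<phi> x * f x) differentiable (at x)" for x
      using test_functionsD(2)[OF \<phi>] test_functionsD(2)[OF ft] by simp
    show "continuous_on UNIV (partial_deriv i (\<lambda>x. \<phi> x * f x))"
      unfolding pd by (intro continuous_intros test_functionsD(3) test_functions_partial_deriv \<phi> ft)
  qed
  then have s: "(\<integral>x. \<phi> x * partial_deriv i f x \<partial>torm) + (\<integral>x. partial_deriv i \<phi> x * f x \<partial>torm) = 0"
    unfolding pd by (subst (asm) Bochner_Integration.integral_add) (auto intro!: intr \<phi> ft test_functions_partial_deriv)
  have "(\<integral>x. partial_deriv i \<phi> x *\<^sub>R f x *\<^sub>R e \<partial>torm) = (\<integral>x. partial_deriv i \<phi> x * f x \<partial>torm) *\<^sub>R e"
    by (simp add: intr \<phi> ft test_functions_partial_deriv)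
  also have "\<dots> = - ((\<integral>x. \<phi> x * partial_deriv i f x \<partial>torm) *\<^sub>R e)"
    using s by (simp add: eq_neg_iff_add_eq_0 scaleR_add_left[symmetric] add.commute)
  also have "(\<integral>x. \<phi> x * partial_deriv i f x \<partial>torm) *\<^sub>R e = (\<integral>x. \<phi> x *\<^sub>R partial_deriv i f x *\<^sub>R e \<partial>torm)"
    by (simp add: intr \<phi> ft test_functions_partial_deriv)
  finally show "(\<integral>x. partial_deriv i \<phi> x *\<^sub>R f x *\<^sub>R e \<partial>torm) = - (\<integral>x. \<phi> x *\<^sub>R partial_deriv i f x *\<^sub>R e \<partial>torm)" .
qed

text \<open>Amplitude and frequency are parameters because multiples, differences, the time
  derivative and the Laplacian all stay in this family with the same \<open>k\<close>, so every
  computation reduces to one on amplitudes.\<close>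

definition shear :: "real \<Rightarrow> int \<Rightarrow> vfield" where
  "shear c k x = (c * sin (phase (k, 0) x)) *\<^sub>R axis 2 1"

definition coshear :: "real \<Rightarrow> int \<Rightarrow> vfield" where
  "coshear c k x = (c * cos (phase (k, 0) x)) *\<^sub>R axis 2 1"

lemma shear_scale: "(\<lambda>x. a *\<^sub>R shear c k x) = shear (a * c) k"
  and shear_diff: "(\<lambda>x. shear a k x - shear b k x) = shear (a - b) k"
  by (auto simp: shear_def coshear_def algebra_simps scaleR_diff_left[symmetric] simp del: scaleR_diff_left)

lemma shear_zero: "shear 0 k = (\<lambda>x. 0)"
  by (auto simp: shear_def)

lemma shear_nth [simp]: "shear c k x $ 1 = 0" "shear c k x $ 2 = c * sin (phase (k, 0) x)"
  by (auto simp: shear_def axis_def)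

lemma shear_weak_deriv:
  "is_weak_deriv 1 (shear c k) (coshear (c * k) k)" "is_weak_deriv 2 (shear c k) (\<lambda>x. 0)"
  "is_weak_deriv 1 (coshear c k) (shear (- c * k) k)" "is_weak_deriv 2 (coshear c k) (\<lambda>x. 0)"
proof -
  have s: "partial_deriv i (\<lambda>x. c * sin (phase (k, 0) x)) = (\<lambda>x. c * (freq (k, 0) i * cos (phase (k, 0) x)))" for i
    using partial_deriv_scale[OF trig_differentiable[OF trig.sin]] by (simp add: partial_deriv_sin fun_eq_iff)
  have c: "partial_deriv i (\<lambda>x. c * cos (phase (k, 0) x)) = (\<lambda>x. c * (- freq (k, 0) i * sin (phase (k, 0) x)))" for i
    using partial_deriv_scale[OF trig_differentiable[OF trig.cos]] by (simp add: partial_deriv_cos fun_eq_iff)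
  have f: "freq (k, 0) 1 = k" "freq (k, 0) 2 = 0" by (auto simp: freq_def)
  note S = is_weak_deriv_trig[OF trig.scale[OF trig.sin], of _ c "(k, 0)" "axis 2 1", unfolded s]
  note C = is_weak_deriv_trig[OF trig.scale[OF trig.cos], of _ c "(k, 0)" "axis 2 1", unfolded c]
  show "is_weak_deriv 1 (shear c k) (coshear (c * k) k)" using S[of 1] by (simp add: f shear_def[abs_def] coshear_def[abs_def] mult.assoc)
  show "is_weak_deriv 2 (shear c k) (\<lambda>x. 0)" using S[of 2] by (simp add: f shear_def[abs_def] coshear_def[abs_def])
  show "is_weak_deriv 1 (coshear c k) (shear (- c * k) k)" using C[of 1] by (simp add: f shear_def[abs_def] coshear_def[abs_def] mult.assoc)
  show "is_weak_deriv 2 (coshear c k) (\<lambda>x. 0)" using C[of 2] by (simp add: f shear_def[abs_def] coshear_def[abs_def])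
qed

lemma is_weak_deriv_zero: "is_weak_deriv i (\<lambda>x. 0) (\<lambda>x. 0)"
  by (simp add: is_weak_deriv_torm L2_zero)

lemma shear_L2: "shear c k \<in> L2_space" and coshear_L2: "coshear c k \<in> L2_space"
  unfolding shear_def[abs_def] coshear_def[abs_def]
  by (intro L2_mult_trig L2_const trig.scale trig.sin trig.cos)+

lemma shear_H1: "shear c k \<in> H1_space"
  using shear_weak_deriv(1,2) shear_L2 unfolding H1_space_def forall_2 by blast

lemma coshear_H1: "coshear c k \<in> H1_space"
  using shear_weak_deriv(3,4) coshear_L2 unfolding H1_space_def forall_2 by blast

lemma zero_H1: "(\<lambda>x. 0) \<in> H1_space"
  using is_weak_deriv_zero L2_zero unfolding H1_space_def by blast

text \<open>\<open>weak_deriv\<close> returns an unspecified representative, so regularity known for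
  the explicit derivatives of a shear flow has to be carried along \<open>ae_eq\<close>.\<close>

lemma H1_ae_cong:
  assumes "u \<in> H1_space" "ae_eq u u'" "u' \<in> L2_space" shows "u' \<in> H1_space"
  using assms is_weak_deriv_ae_cong[OF weak_deriv_works[OF assms(1)] assms(2) ae_eq_refl H1_L2[OF assms(1)] assms(3) weak_deriv_L2[OF assms(1)]]
  unfolding H1_space_def by blast

lemma weak_deriv_shear_ae:
  "ae_eq (weak_deriv 1 (shear c k)) (coshear (c * k) k)" "ae_eq (weak_deriv 2 (shear c k)) (\<lambda>x. 0)"
  by (intro weak_deriv_ae shear_weak_deriv)+

lemma weak_deriv_shear_L2: "weak_deriv i (shear c k) \<in> L2_space"
  by (intro weak_deriv_L2 shear_H1)

lemma shear_H2: "shear c k \<in> H2_space"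
proof -
  have "weak_deriv 1 (shear c k) \<in> H1_space" "weak_deriv 2 (shear c k) \<in> H1_space"
    using H1_ae_cong[OF coshear_H1 ae_eq_sym[OF weak_deriv_shear_ae(1)] weak_deriv_shear_L2]
      H1_ae_cong[OF zero_H1 ae_eq_sym[OF weak_deriv_shear_ae(2)] weak_deriv_shear_L2] by blast+
  then show ?thesis unfolding H2_space_def forall_2 using shear_H1 by blast
qed

lemma is_weak_deriv2_shear:
  "is_weak_deriv 1 (weak_deriv 1 (shear c k)) (shear (- c * k\<^sup>2) k)"
  "is_weak_deriv 1 (weak_deriv 2 (shear c k)) (\<lambda>x. 0)"
  "is_weak_deriv 2 (weak_deriv 2 (shear c k)) (\<lambda>x. 0)"
proof -
  have "is_weak_deriv 1 (weak_deriv 1 (shear c k)) (shear (- (c * k) * k) k)"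
    by (rule is_weak_deriv_ae_cong[OF shear_weak_deriv(3) ae_eq_sym[OF weak_deriv_shear_ae(1)] ae_eq_refl coshear_L2 weak_deriv_shear_L2 shear_L2])
  then show "is_weak_deriv 1 (weak_deriv 1 (shear c k)) (shear (- c * k\<^sup>2) k)"
    by (simp add: power2_eq_square mult.assoc)
  show "is_weak_deriv 1 (weak_deriv 2 (shear c k)) (\<lambda>x. 0)" "is_weak_deriv 2 (weak_deriv 2 (shear c k)) (\<lambda>x. 0)"
    by (rule is_weak_deriv_ae_cong[OF is_weak_deriv_zero ae_eq_sym[OF weak_deriv_shear_ae(2)] ae_eq_refl L2_zero weak_deriv_shear_L2 L2_zero])+
qed

lemma weak_deriv2_shear_ae:
  "ae_eq (weak_deriv 1 (weak_deriv 1 (shear c k))) (shear (- c * k\<^sup>2) k)"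
  "ae_eq (weak_deriv 1 (weak_deriv 2 (shear c k))) (\<lambda>x. 0)"
  "ae_eq (weak_deriv 2 (weak_deriv 2 (shear c k))) (\<lambda>x. 0)"
  by (intro weak_deriv_ae is_weak_deriv2_shear)+

lemma weak_deriv2_shear_L2:
  "weak_deriv 1 (weak_deriv 1 (shear c k)) \<in> L2_space"
  "weak_deriv 1 (weak_deriv 2 (shear c k)) \<in> L2_space"
  "weak_deriv 2 (weak_deriv 2 (shear c k)) \<in> L2_space"
  by (rule is_weak_deriv_L2[OF weak_deriv_isI[OF is_weak_deriv2_shear(1)]])
    (rule is_weak_deriv_L2[OF weak_deriv_isI[OF is_weak_deriv2_shear(2)]],
     rule is_weak_deriv_L2[OF weak_deriv_isI[OF is_weak_deriv2_shear(3)]])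

lemma L2_norm_shear: "k \<noteq> 0 \<Longrightarrow> L2_norm (shear c k) = \<bar>c\<bar> * (sqrt 2 * pi)"
  and L2_norm_coshear: "k \<noteq> 0 \<Longrightarrow> L2_norm (coshear c k) = \<bar>c\<bar> * (sqrt 2 * pi)"
proof -
  assume k: "k \<noteq> 0"
  then have k': "(k, 0) \<noteq> - (k, 0::int)" by simp
  have "L2_inner (shear c k) (shear c k) = (\<integral>x. c\<^sup>2 * (sin (phase (k, 0) x) * sin (phase (k, 0) x)) \<partial>torm)"
    by (simp add: L2_inner_eq shear_def inner_axis_axis power2_eq_square algebra_simps)
  also have "\<dots> = c\<^sup>2 * (2 * pi\<^sup>2)"
    using k' by (subst integral_mult_right_zero) (simp add: integral_sin_sin)
  finally show "L2_norm (shear c k) = \<bar>c\<bar> * (sqrt 2 * pi)"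
    by (simp add: L2_norm_def real_sqrt_mult)
  have "L2_inner (coshear c k) (coshear c k) = (\<integral>x. c\<^sup>2 * (cos (phase (k, 0) x) * cos (phase (k, 0) x)) \<partial>torm)"
    by (simp add: L2_inner_eq coshear_def inner_axis_axis power2_eq_square algebra_simps)
  also have "\<dots> = c\<^sup>2 * (2 * pi\<^sup>2)"
    using k' by (subst integral_mult_right_zero) (simp add: integral_cos_cos)
  finally show "L2_norm (coshear c k) = \<bar>c\<bar> * (sqrt 2 * pi)"
    by (simp add: L2_norm_def real_sqrt_mult)
qed

lemma V_norm_shear: "k \<noteq> 0 \<Longrightarrow> V_norm (shear c k) = \<bar>c\<bar> * (\<bar>k\<bar> * sqrt 2 * pi)"
  unfolding V_norm_def sum_2
  by (simp add: L2_norm_ae_cong[OF weak_deriv_shear_ae(1) weak_deriv_shear_L2 coshear_L2]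
    L2_norm_ae_cong[OF weak_deriv_shear_ae(2) weak_deriv_shear_L2 L2_zero] L2_norm_coshear abs_mult)

lemma H2_norm_shear:
  assumes "k \<noteq> 0"
  shows "H2_norm (shear c k) = \<bar>c\<bar> * (sqrt (1 + k\<^sup>2 + k^4) * sqrt 2 * pi)"
proof -
  have "H2_norm (shear c k) = sqrt ((\<bar>c\<bar> * (sqrt 2 * pi))\<^sup>2 * (1 + k\<^sup>2 + k^4))"
    unfolding H2_norm_def
    by (simp add: L2_norm_ae_cong[OF weak_deriv_shear_ae(1) weak_deriv_shear_L2 coshear_L2]
      L2_norm_ae_cong[OF weak_deriv_shear_ae(2) weak_deriv_shear_L2 L2_zero] L2_norm_coshear L2_norm_shear
      L2_norm_ae_cong[OF weak_deriv2_shear_ae(1) weak_deriv2_shear_L2(1) shear_L2]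
      L2_norm_ae_cong[OF weak_deriv2_shear_ae(2) weak_deriv2_shear_L2(2) L2_zero]
      L2_norm_ae_cong[OF weak_deriv2_shear_ae(3) weak_deriv2_shear_L2(3) L2_zero]
      assms abs_mult power_mult_distrib) (simp add: algebra_simps)
  then show ?thesis by (simp add: real_sqrt_mult mult.commute mult.left_commute)
qed

lemma shear_V: "shear c k \<in> V_space"
proof -
  have "weakly_div_free (shear c k)"
    unfolding weakly_div_free_torm
  proof
    fix \<phi> assume \<phi>: "\<phi> \<in> test_functions"
    have i: "integrable torm (\<lambda>x. partial_deriv 2 \<phi> x *\<^sub>R shear c k x)"
      by (intro L2_space_integrable L2_mult_test test_functions_partial_deriv \<phi> shear_L2)
    \<comment> \<open>The field has only a second component, so its divergence condition says that
      its weak derivative in direction 2 vanishes.\<close>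
    have "(\<integral>x. partial_deriv 2 \<phi> x *\<^sub>R shear c k x \<partial>torm) = 0"
      using shear_weak_deriv(2)[of c k] \<phi> unfolding is_weak_deriv_torm by fastforce
    then have "(\<integral>x. (partial_deriv 2 \<phi> x *\<^sub>R shear c k x) $ 2 \<partial>torm) = 0"
      using integral_bounded_linear[OF bounded_linear_vec_nth i, of 2] by simp
    then show "(\<integral>x. (\<Sum>i\<in>UNIV. shear c k x $ i * partial_deriv i \<phi> x) \<partial>torm) = 0"
      by (simp add: sum_2 mult.commute)
  qed
  moreover have "(\<integral>x. shear c k x \<partial>torm) = 0"
    by (simp add: shear_def integrable_sin_phase integral_sin_phase)
  ultimately show ?thesis
    by (simp add: V_space_def shear_H1 set_integral_torus)
qed

lemma shear_H: "shear c k \<in> H_space" by (intro V_H shear_V)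

text \<open>The path stays on the line spanned by one shear flow, where \<open>p\<close> is a
  multiple of the absolute value of the amplitude. Hence the preimage of a set open for
  \<open>p\<close> is an open set of amplitudes. Leaving \<open>p\<close> abstract serves both
  \<open>H2_norm\<close> and \<open>L2_norm\<close>.\<close>

lemma shear_measurable:
  assumes "\<And>c. shear c k \<in> X" and p: "\<And>a b. p (shear a k - shear b k) = \<bar>a - b\<bar> * M"
    and [measurable]: "\<gamma> \<in> borel_measurable borel"
  shows "(\<lambda>t. shear (\<gamma> t) k) \<in> restrict_space borel S \<rightarrow>\<^sub>M borel_of_norm X p"
  unfolding borel_of_norm_def
proof (rule measurable_measure_of)
  fix G assume "G \<in> {G. G \<subseteq> X \<and> (\<forall>u\<in>G. \<exists>e>0. \<forall>v\<in>X. p (v - u) < e \<longrightarrow> v \<in> G)}"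
  then have G: "\<And>u. u \<in> G \<Longrightarrow> \<exists>e>0. \<forall>v\<in>X. p (v - u) < e \<longrightarrow> v \<in> G" by blast
  have "open {a. shear a k \<in> G}"
    unfolding open_dist
  proof
    fix a assume "a \<in> {a. shear a k \<in> G}"
    then obtain e where e: "e > 0" "\<And>v. v \<in> X \<Longrightarrow> p (v - shear a k) < e \<Longrightarrow> v \<in> G" using G by blast
    \<comment> \<open>The added \<open>1\<close> keeps the radius meaningful for
      \<open>M = 0\<close>.\<close>
    have "shear b k \<in> G" if b: "dist b a < e / (\<bar>M\<bar> + 1)" for b
    proof (rule e(2)[OF assms(1)])
      have "p (shear b k - shear a k) = \<bar>b - a\<bar> * M" by (rule p)
      also have "\<dots> \<le> \<bar>b - a\<bar> * (\<bar>M\<bar> + 1)" by (intro mult_left_mono) auto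
      also have "\<dots> < e" using b by (simp add: dist_real_def pos_less_divide_eq)
      finally show "p (shear b k - shear a k) < e" .
    qed
    moreover have "e / (\<bar>M\<bar> + 1) > 0" using e by simp
    ultimately show "\<exists>e>0. \<forall>y. dist y a < e \<longrightarrow> y \<in> {a. shear a k \<in> G}" by blast
  qed
  then have "{a. shear a k \<in> G} \<in> sets borel" by simp
  from measurable_sets[OF assms(3) this]
  have "\<gamma> -` {a. shear a k \<in> G} \<in> sets borel" by simp
  moreover have "(\<lambda>t. shear (\<gamma> t) k) -` G \<inter> space (restrict_space borel S) = (\<gamma> -` {a. shear a k \<in> G}) \<inter> S"
    by (auto simp: space_restrict_space)
  ultimately show "(\<lambda>t. shear (\<gamma> t) k) -` G \<inter> space (restrict_space borel S) \<in> sets (restrict_space borel S)"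
    by (auto simp: sets_restrict_space)
qed (use assms(1) in auto)

lemma shear_time_L2:
  assumes X: "\<And>c. shear c k \<in> X" and p: "\<And>a b. p (shear a k - shear b k) = \<bar>a - b\<bar> * M"
    and p0: "\<And>a. p (shear a k) = \<bar>a\<bar> * M"
    and \<gamma>: "\<gamma> \<in> borel_measurable borel" and B: "\<And>t. 0 < t \<Longrightarrow> \<bar>\<gamma> t\<bar> \<le> B"
  shows "(\<lambda>t. shear (\<gamma> t) k) \<in> time_L2 T X p"
proof -
  have "(\<integral>\<^sup>+t\<in>{0<..T}. ennreal ((p (shear (\<gamma> t) k))\<^sup>2) \<partial>lborel) \<le> (\<integral>\<^sup>+t. ennreal ((B * \<bar>M\<bar>)\<^sup>2) * indicator {0<..T} t \<partial>lborel)"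
  proof (rule nn_integral_mono)
    fix t
    have "(p (shear (\<gamma> t) k))\<^sup>2 \<le> (B * \<bar>M\<bar>)\<^sup>2" if "0 < t"
    proof -
      have "\<bar>\<gamma> t\<bar> * \<bar>M\<bar> \<le> B * \<bar>M\<bar>" using B[OF that] by (intro mult_right_mono) auto
      then have "(\<bar>\<gamma> t\<bar> * \<bar>M\<bar>)\<^sup>2 \<le> (B * \<bar>M\<bar>)\<^sup>2" by (intro power_mono) auto
      then show ?thesis by (simp add: p0 power_mult_distrib)
    qed
    then show "ennreal ((p (shear (\<gamma> t) k))\<^sup>2) * indicator {0<..T} t \<le> ennreal ((B * \<bar>M\<bar>)\<^sup>2) * indicator {0<..T} t"
      by (auto split: split_indicator intro!: ennreal_leI)
  qed
  also have "\<dots> = ennreal ((B * \<bar>M\<bar>)\<^sup>2) * emeasure lborel {0<..T}"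
    by (subst nn_integral_cmult_indicator) auto
  also have "\<dots> < \<infinity>"
    by (cases "0 \<le> T") (auto simp: ennreal_mult_less_top)
  finally show ?thesis
    using shear_measurable[OF X p \<gamma>] by (simp add: time_L2_def)
qed

text \<open>The Laplacian of a shear flow is a shear flow, hence already in \<open>H_space\<close>,
  where \<open>leray\<close> is the identity up to null sets.\<close>

lemma stokes_shear: "ae_eq (stokes (shear c k)) (shear (c * k\<^sup>2) k)"
proof -
  have "ae_eq (laplacian (shear c k)) (shear (- c * k\<^sup>2) k)"
    using weak_deriv2_shear_ae(1)[of c k] weak_deriv2_shear_ae(3)[of c k]
    unfolding ae_eq_def laplacian_def by eventually_elim (simp add: sum_2)
  moreover have "laplacian (shear c k) \<in> L2_space"
    unfolding laplacian_def sum_2 by (intro L2_add weak_deriv2_shear_L2)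
  ultimately have "ae_eq (leray (laplacian (shear c k))) (shear (- c * k\<^sup>2) k)"
    by (intro leray_unique shear_H)
  then show ?thesis
    unfolding ae_eq_def stokes_def by eventually_elim (simp add: shear_def)
qed

lemma L2_bounded_mult_component:
  assumes "w \<in> L2_space" "AE x in torm. norm (w x) \<le> K" "v \<in> L2_space"
  shows "(\<lambda>x. (w x $ i) *\<^sub>R v x) \<in> L2_space"
proof (rule L2_mult_bounded[OF assms(3) L2_component[OF assms(1)]])
  show "AE x in torm. \<bar>w x $ i\<bar> \<le> K"
    using assms(2) by eventually_elim (rule order_trans[OF component_le_norm_cart])
qed

lemma shear_norm_le: "norm (shear c k x) \<le> \<bar>c\<bar>"
proof -
  have "\<bar>c\<bar> * \<bar>sin (phase (k, 0) x)\<bar> \<le> \<bar>c\<bar> * 1" by (intro mult_left_mono) auto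
  then show ?thesis by (simp add: shear_def abs_mult)
qed

text \<open>In each term of the advection one factor vanishes: the first component of the flow, or
  its derivative in direction 2.\<close>

lemma nonlin_shear: "ae_eq (nonlin (shear c k) (shear c k)) (\<lambda>x. 0)"
  unfolding nonlin_def
proof (rule leray_unique)
  show "advection (shear c k) (shear c k) \<in> L2_space"
    unfolding advection_def sum_2
    by (intro L2_add L2_bounded_mult_component[where K="\<bar>c\<bar>"] weak_deriv_shear_L2 shear_L2 AE_I2 shear_norm_le)
  show "(\<lambda>x. 0) \<in> H_space" using shear_H[of 0 0] by (simp add: shear_zero)
  show "ae_eq (advection (shear c k) (shear c k)) (\<lambda>x. 0)"
    using weak_deriv_shear_ae(2)[of c k]
    unfolding ae_eq_def advection_def by eventually_elim (simp add: sum_2)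
qed

text \<open>The rate is the viscosity \<open>1/2\<close> times the eigenvalue
  \<open>k\<^sup>2\<close> of the Stokes operator.\<close>

definition shear_decay :: "real \<Rightarrow> int \<Rightarrow> real \<Rightarrow> real" where
  "shear_decay c k t = c * exp (- (real_of_int k)\<^sup>2 * t / 2)"

lemma shear_decay_deriv:
  "(shear_decay c k has_real_derivative (- (real_of_int k)\<^sup>2 / 2) * shear_decay c k t) (at t within S)"
  unfolding shear_decay_def[abs_def] by (auto intro!: derivative_eq_intros)

lemma continuous_shear_decay: "continuous_on S (shear_decay c k)"
  unfolding shear_decay_def[abs_def] by (intro continuous_intros) auto

lemma shear_decay_le: "0 \<le> s \<Longrightarrow> s \<le> t \<Longrightarrow> \<bar>shear_decay c k t\<bar> \<le> \<bar>c\<bar> * exp (- (real_of_int k)\<^sup>2 * s / 2)"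
  unfolding shear_decay_def abs_mult by (intro mult_left_mono) (auto intro: mult_left_mono)

lemma shear_decay_le0: "0 < t \<Longrightarrow> \<bar>shear_decay c k t\<bar> \<le> \<bar>c\<bar>"
  using shear_decay_le[of 0 t c k] by simp

lemma shear_time_deriv_integral:
  assumes st: "s \<le> t"
  shows "L2_inner (shear (shear_decay c k t) k) h - L2_inner (shear (shear_decay c k s) k) h
      = (LINT r:{s<..t}|lborel. L2_inner (shear ((- (real_of_int k)\<^sup>2 / 2) * shear_decay c k r) k) h)"
proof -
  have lin: "L2_inner (shear a k) h = a * L2_inner (shear 1 k) h" for a
    using L2_inner_scale_left[of a "shear 1 k" h] by (simp add: shear_scale)
  have lin': "L2_inner (shear ((- (real_of_int k)\<^sup>2 / 2) * shear_decay c k r) k) h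
      = (- (real_of_int k)\<^sup>2 / 2) * shear_decay c k r * L2_inner (shear 1 k) h" for r
    by (rule lin)
  have [measurable]: "shear_decay c k \<in> borel_measurable borel"
    by (intro borel_measurable_continuous_onI continuous_shear_decay)
  have "(LINT r:{s<..t}|lborel. L2_inner (shear ((- (real_of_int k)\<^sup>2 / 2) * shear_decay c k r) k) h)
      = (\<integral>r. indicator {s..t} r *\<^sub>R ((- (real_of_int k)\<^sup>2 / 2) * shear_decay c k r * L2_inner (shear 1 k) h) \<partial>lborel)"
    unfolding set_lebesgue_integral_def lin'
  proof (rule integral_cong_AE)
    show "AE r in lborel. indicator {s<..t} r *\<^sub>R ((- (real_of_int k)\<^sup>2 / 2) * shear_decay c k r * L2_inner (shear 1 k) h)
      = indicator {s..t} r *\<^sub>R ((- (real_of_int k)\<^sup>2 / 2) * shear_decay c k r * L2_inner (shear 1 k) h)"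
      using AE_lborel_singleton[of s] by eventually_elim (auto split: split_indicator)
  qed measurable
  also have "\<dots> = shear_decay c k t * L2_inner (shear 1 k) h - shear_decay c k s * L2_inner (shear 1 k) h"
  proof (rule integral_FTC_atLeastAtMost[OF st])
    show "((\<lambda>r. shear_decay c k r * L2_inner (shear 1 k) h) has_vector_derivative
      (- (real_of_int k)\<^sup>2 / 2) * shear_decay c k r * L2_inner (shear 1 k) h) (at r within {s..t})" for r
      unfolding has_real_derivative_iff_has_vector_derivative[symmetric]
      by (intro DERIV_cmult_right shear_decay_deriv)
  qed (intro continuous_intros continuous_shear_decay)
  finally show ?thesis by (simp add: lin[of "shear_decay _ _ _"])
qed

text \<open>The explicit flow serves as its own version with values in the Stokes domain, and its
  classical time derivative as \<open>g\<close>. As an existence statement this is what makes the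
  choice in \<open>ns_solution\<close> return a strong solution.\<close>

theorem shear_strong_solution:
  assumes k: "k \<noteq> 0"
  shows "strong_solution (1/2) (\<lambda>_ _. 0) T (shear c k) (\<lambda>t. shear (shear_decay c k t) k)"
  unfolding strong_solution_def
proof (intro conjI)
  let ?u = "\<lambda>t. shear (shear_decay c k t) k"
  define g where "g t = shear ((- (real_of_int k)\<^sup>2 / 2) * shear_decay c k t) k" for t
  have [measurable]: "shear_decay c k \<in> borel_measurable borel"
    by (intro borel_measurable_continuous_onI continuous_shear_decay)
  have "(\<lambda>p. shear (shear_decay c k (fst p)) k (snd p)) \<in> borel_measurable borel"
    unfolding shear_def phase_def
    by (intro borel_measurable_continuous_onI continuous_intros continuous_on_compose2[OF continuous_shear_decay[of UNIV]]) auto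
  then show "(\<lambda>(t, x). ?u t x) \<in> borel_measurable borel" by (simp add: case_prod_unfold)
  show "?u \<in> C_V T"
    unfolding C_V_def
  proof (intro CollectI ballI conjI shear_V)
    fix t
    have "((\<lambda>s. \<bar>shear_decay c k s - shear_decay c k t\<bar> * (\<bar>k\<bar> * sqrt 2 * pi)) \<longlongrightarrow>
        \<bar>shear_decay c k t - shear_decay c k t\<bar> * (\<bar>k\<bar> * sqrt 2 * pi)) (at t within {0..T})"
      using continuous_shear_decay[of UNIV c k]
      by (intro tendsto_intros) (auto simp: continuous_on_def intro: tendsto_within_subset)
    then show "((\<lambda>s. V_norm (?u s - ?u t)) \<longlongrightarrow> 0) (at t within {0..T})"
      by (simp add: fun_diff_def shear_diff V_norm_shear k)
  qed
  show "ae_eq (?u 0) (shear c k)" by (simp add: shear_decay_def)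
  have u2: "?u \<in> time_L2 T stokes_domain H2_norm"
    by (rule shear_time_L2[where M="sqrt (1 + k\<^sup>2 + k^4) * sqrt 2 * pi" and B="\<bar>c\<bar>"])
      (use shear_V shear_H2 k in \<open>auto simp: stokes_domain_def fun_diff_def shear_diff H2_norm_shear shear_decay_le0\<close>)
  have g2: "g \<in> time_L2 T H_space L2_norm"
    unfolding g_def
  proof (rule shear_time_L2[where M="sqrt 2 * pi" and B="(real_of_int k)\<^sup>2 / 2 * \<bar>c\<bar>"])
    fix t :: real assume "0 < t"
    from shear_decay_le0[OF this, of c k]
    have "(real_of_int k)\<^sup>2 / 2 * \<bar>shear_decay c k t\<bar> \<le> (real_of_int k)\<^sup>2 / 2 * \<bar>c\<bar>" by (intro mult_left_mono) auto
    then show "\<bar>(- (real_of_int k)\<^sup>2 / 2) * shear_decay c k t\<bar> \<le> (real_of_int k)\<^sup>2 / 2 * \<bar>c\<bar>" by (simp add: abs_mult)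
  qed (use k in \<open>auto simp: shear_H fun_diff_def shear_diff L2_norm_shear\<close>)
  have ode: "ae_eq (\<lambda>x. g t x + (1/2) *\<^sub>R stokes (?u t) x + nonlin (?u t) (?u t) x) (\<lambda>_. 0)" for t
    using stokes_shear[of "shear_decay c k t" k] nonlin_shear[of "shear_decay c k t" k]
    unfolding ae_eq_def g_def by eventually_elim (simp add: shear_def scaleR_add_left[symmetric])
  have "has_time_deriv T ?u g"
    unfolding has_time_deriv_def g_def using shear_time_deriv_integral by blast
  then show "\<exists>w\<in>time_L2 T stokes_domain H2_norm. \<exists>g\<in>time_L2 T H_space L2_norm.
       (AE t in lborel. t \<in> {0<..T} \<longrightarrow> ae_eq (?u t) (w t)) \<and>
       has_time_deriv T ?u g \<and>
       (AE t in lborel. t \<in> {0<..T} \<longrightarrow>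
          ae_eq (\<lambda>x. g t x + (1/2) *\<^sub>R stokes (w t) x + nonlin (w t) (w t) x) (\<lambda>_. 0))"
    using u2 g2 ode by (intro bexI[of _ ?u] bexI[of _ g]) auto
qed

section \<open>Uniqueness of the solution started at a shear flow\<close>

text \<open>A statement at a single time, with \<open>g\<close> in the role of the time derivative
  of \<open>w\<close> and \<open>a\<close> the amplitude of the explicit flow. After testing with
  \<open>d\<close>, the Laplacian term is at most zero and transport of \<open>d\<close> by
  \<open>w\<close> contributes nothing. What remains is the first component of \<open>w\<close>
  times the derivative of the shear flow, bounded by the supremum
  \<open>\<bar>a\<bar> * \<bar>k\<bar>\<close> of that derivative.\<close>

lemma energy_inequality:
  fixes a :: real and k :: int and w g :: vfield
  assumes w: "w \<in> stokes_domain" and g: "g \<in> H_space"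
    and eq: "ae_eq (\<lambda>x. g x + (1/2) *\<^sub>R stokes w x + nonlin w w x) (\<lambda>_. 0)"
  defines "d \<equiv> (\<lambda>x. w x - shear a k x)"
  shows "L2_inner (\<lambda>x. g x - shear ((- (real_of_int k)\<^sup>2 / 2) * a) k x) d \<le> (\<bar>a\<bar> * \<bar>k\<bar>) * (L2_norm d)\<^sup>2"
proof -
  have wV: "w \<in> V_space" and wH2: "w \<in> H2_space" using w by (auto simp: stokes_domain_def)
  note wL = V_L2[OF wV] and wH1 = V_H1[OF wV]
  define D where "D i = weak_deriv i w" for i
  define DD where "DD i = weak_deriv i (weak_deriv i w)" for i
  have D: "is_weak_deriv i w (D i)" for i unfolding D_def by (rule weak_deriv_works[OF wH1])
  have DD: "is_weak_deriv i (D i) (DD i)" for i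
    unfolding D_def DD_def by (rule weak_deriv_works[OF H2_weak_deriv_H1[OF wH2]])
  have DL: "D i \<in> L2_space" for i by (rule is_weak_deriv_L2[OF D])
  have DDL: "DD i \<in> L2_space" for i by (rule is_weak_deriv_L2[OF DD])
  \<comment> \<open>Fields in the Stokes domain are bounded; this makes the advection square
    integrable and \<open>trilinear_zero\<close> applicable.\<close>
  obtain K where K: "AE x in torm. norm (w x) \<le> K"
    using sobolev_bounded[OF wL D D, of "weak_deriv 1 (D 2)"] weak_deriv_works[OF H2_weak_deriv_H1[OF wH2]]
    unfolding D_def by blast
  define lap adv where "lap = laplacian w" and "adv = advection w w"
  have lap: "lap = (\<lambda>x. DD 1 x + DD 2 x)" by (simp add: lap_def laplacian_def DD_def sum_2)
  have adv: "adv = (\<lambda>x. (w x $ 1) *\<^sub>R D 1 x + (w x $ 2) *\<^sub>R D 2 x)" by (simp add: adv_def advection_def D_def sum_2)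
  have lapL: "lap \<in> L2_space" unfolding lap by (intro L2_add DDL)
  have mL: "(\<lambda>x. (w x $ i) *\<^sub>R v x) \<in> L2_space" if "v \<in> L2_space" for i v
    by (rule L2_bounded_mult_component[OF wL K that])
  have advL: "adv \<in> L2_space" unfolding adv by (intro L2_add mL DL)
  have dH: "d \<in> H_space" unfolding d_def by (intro H_diff V_H wV shear_H)
  note dL = H_L2[OF dH] and gL = H_L2[OF g]
  have lerL: "leray lap \<in> L2_space" "leray adv \<in> L2_space"
    using leray_works(1)[OF lapL] leray_works(1)[OF advL] H_L2 by auto
  have "ae_eq g (\<lambda>x. (1/2) *\<^sub>R leray lap x - leray adv x)"
    using eq unfolding ae_eq_def
  proof eventually_elim
    case (elim x)
    have "g x = (g x + (1/2) *\<^sub>R stokes w x + nonlin w w x) - (1/2) *\<^sub>R stokes w x - nonlin w w x" by simp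
    then show ?case unfolding elim by (simp add: stokes_def nonlin_def lap_def adv_def)
  qed
  then have g1: "L2_inner g d = L2_inner (\<lambda>x. (1/2) *\<^sub>R leray lap x - leray adv x) d"
    by (rule L2_inner_ae_cong[OF _ ae_eq_refl gL L2_diff[OF L2_scale[OF lerL(1)] lerL(2)] dL dL])
  \<comment> \<open>Since \<open>d\<close> lies in \<open>H_space\<close>, the projector drops out
    of both inner products.\<close>
  also have "\<dots> = (1/2) * L2_inner lap d - L2_inner adv d"
    using lerL dL L2_scale[OF lerL(1)]
    by (simp add: L2_inner_diff_left L2_inner_scale_left leray_works(2)[OF lapL dH] leray_works(2)[OF advL dH])
  finally have g2: "L2_inner g d = (1/2) * L2_inner lap d - L2_inner adv d" .
  define sD sDD where "sD = (\<lambda>i::2. if i = 1 then coshear (a * k) k else (\<lambda>x. 0))"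
    and "sDD = (\<lambda>i::2. if i = 1 then shear (- (a * k) * k) k else (\<lambda>x. 0))"
  have i12: "i = 1 \<or> i = 2" for i :: 2 by (rule exhaust_2)
  have sD: "is_weak_deriv i (shear a k) (sD i)" for i
    using i12[of i] shear_weak_deriv(1,2)[of a k] by (auto simp: sD_def)
  have sDD: "is_weak_deriv i (sD i) (sDD i)" for i
    using i12[of i] shear_weak_deriv(3)[of "a * k" k] is_weak_deriv_zero by (auto simp: sD_def sDD_def)
  define e h where "e = (\<lambda>i x. D i x - sD i x)" and "h = (\<lambda>i x. DD i x - sDD i x)"
  have sDL: "sD i \<in> L2_space" "sDD i \<in> L2_space" for i
    using is_weak_deriv_L2[OF sD] is_weak_deriv_L2[OF sDD] by auto
  have e: "is_weak_deriv i d (e i)" for i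
    unfolding d_def e_def by (rule is_weak_deriv_diff[OF D sD wL shear_L2])
  have h: "is_weak_deriv i (e i) (h i)" for i
    unfolding e_def h_def by (rule is_weak_deriv_diff[OF DD sDD DL sDL(1)])
  have eL: "e i \<in> L2_space" and hL: "h i \<in> L2_space" for i
    using is_weak_deriv_L2[OF e] is_weak_deriv_L2[OF h] by auto
  have lap_d: "L2_inner (\<lambda>x. lap x - shear (- (a * k) * k) k x) d \<le> 0"
  proof -
    have "(\<lambda>x. lap x - shear (- (a * k) * k) k x) = (\<lambda>x. h 1 x + h 2 x)"
      by (simp add: lap h_def sDD_def fun_eq_iff)
    then have "L2_inner (\<lambda>x. lap x - shear (- (a * k) * k) k x) d = L2_inner (h 1) d + L2_inner (h 2) d"
      using L2_inner_add_left[OF hL hL dL] by simp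
    then show ?thesis
      using laplacian_dissipative[OF dL e h, of 1] laplacian_dissipative[OF dL e h, of 2] by linarith
  qed
  have adv_d: "\<bar>L2_inner adv d\<bar> \<le> (\<bar>a\<bar> * \<bar>k\<bar>) * (L2_norm d)\<^sup>2"
  proof -
    define r where "r x = (w x $ 1) *\<^sub>R coshear (a * k) k x" for x
    have rL: "r \<in> L2_space" unfolding r_def[abs_def] by (intro mL coshear_L2)
    have "adv = (\<lambda>x. ((w x $ 1) *\<^sub>R e 1 x + (w x $ 2) *\<^sub>R e 2 x) + r x)"
      by (simp add: adv e_def r_def sD_def fun_eq_iff algebra_simps)
    then have "L2_inner adv d = L2_inner (\<lambda>x. (w x $ 1) *\<^sub>R e 1 x) d + L2_inner (\<lambda>x. (w x $ 2) *\<^sub>R e 2 x) d + L2_inner r d"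
      by (simp add: L2_inner_add_left[OF L2_add[OF mL[OF eL] mL[OF eL]] rL dL] L2_inner_add_left[OF mL[OF eL] mL[OF eL] dL])
    moreover have "L2_inner (\<lambda>x. (w x $ i) *\<^sub>R e i x) d = L2_inner (\<lambda>x. (w x $ i) *\<^sub>R d x) (e i)" for i
      by (simp add: L2_inner_eq inner_commute)
    moreover have "(\<Sum>i\<in>UNIV. L2_inner (\<lambda>x. (w x $ i) *\<^sub>R d x) (e i)) = 0"
      using wV by (intro trilinear_zero[OF wL _ K dL e]) (simp add: V_space_def)
    ultimately have "L2_inner adv d = L2_inner r d" by (simp add: sum_2)
    moreover have "\<bar>L2_inner r d\<bar> \<le> (\<integral>x. (\<bar>a\<bar> * \<bar>k\<bar>) * (norm (d x))\<^sup>2 \<partial>torm)"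
      unfolding L2_inner_eq
    proof (rule order_trans[OF integral_abs_bound integral_mono])
      fix x
      \<comment> \<open>The shear flow has no first component, so \<open>w x $ 1 = d x $ 1\<close>;
        this makes the remainder quadratic in \<open>d\<close>.\<close>
      have "r x \<bullet> d x = d x $ 1 * ((a * k * cos (phase (k, 0) x)) * d x $ 2)"
        by (simp add: r_def coshear_def d_def inner_axis' )
      also have "\<bar>\<dots>\<bar> = (\<bar>a\<bar> * \<bar>k\<bar>) * (\<bar>cos (phase (k, 0) x)\<bar> * (\<bar>d x $ 1\<bar> * \<bar>d x $ 2\<bar>))"
        by (simp add: abs_mult)
      also have "\<dots> \<le> (\<bar>a\<bar> * \<bar>k\<bar>) * (1 * (norm (d x) * norm (d x)))"
        by (intro mult_left_mono mult_mono component_le_norm_cart) auto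
      finally show "\<bar>r x \<bullet> d x\<bar> \<le> (\<bar>a\<bar> * \<bar>k\<bar>) * (norm (d x))\<^sup>2" by (simp add: power2_eq_square)
    qed (use L2_inner_integrable[OF rL dL] L2_space_integrable_sq[OF dL] in auto)
    ultimately show ?thesis by (simp add: L2_norm_sq_integral)
  qed
  have half: "shear ((- (real_of_int k)\<^sup>2 / 2) * a) k = (\<lambda>x. (1/2) *\<^sub>R shear (- (a * k) * k) k x)"
    by (simp add: shear_scale power2_eq_square algebra_simps)
  have "L2_inner (\<lambda>x. g x - shear ((- (real_of_int k)\<^sup>2 / 2) * a) k x) d
      = (1/2) * (L2_inner lap d - L2_inner (shear (- (a * k) * k) k) d) - L2_inner adv d"
    unfolding L2_inner_diff_left[OF gL shear_L2 dL] g2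
    unfolding half L2_inner_scale_left by (simp add: algebra_simps)
  also have "L2_inner lap d - L2_inner (shear (- (a * k) * k) k) d \<le> 0"
    using lap_d by (simp add: L2_inner_diff_left[OF lapL shear_L2 dL])
  finally show ?thesis using adv_d by linarith
qed

section \<open>Measurability with respect to a seminorm, and Gronwall's inequality\<close>

lemma space_borel_of_norm [simp]: "space (borel_of_norm X p) = X"
  by (simp add: borel_of_norm_def space_measure_of_conv)

text \<open>The preimage of an open set under a Lipschitz function is open for the seminorm, hence
  one of the generators of \<open>borel_of_norm\<close>. It is applied to norms, to inner products
  with a fixed field and to distances from a parameter.\<close>

lemma Lipschitz_borel_of_norm:
  assumes lip: "\<And>u v. u \<in> X \<Longrightarrow> v \<in> X \<Longrightarrow> \<bar>f v - f u\<bar> \<le> C * p (v - u)"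
    and C: "0 \<le> C" and p: "\<And>u. 0 \<le> p u"
  shows "f \<in> borel_measurable (borel_of_norm X p)"
proof (rule borel_measurableI)
  fix S :: "real set" assume S: "open S"
  have "f -` S \<inter> X \<in> {G. G \<subseteq> X \<and> (\<forall>u\<in>G. \<exists>e>0. \<forall>v\<in>X. p (v - u) < e \<longrightarrow> v \<in> G)}"
  proof (intro CollectI conjI ballI)
    fix u assume u: "u \<in> f -` S \<inter> X"
    then obtain e where e: "e > 0" "\<And>y. dist y (f u) < e \<Longrightarrow> y \<in> S"
      using S by (auto simp: open_dist)
    have "v \<in> f -` S \<inter> X" if v: "v \<in> X" "p (v - u) < e / (\<bar>C\<bar> + 1)" for v
    proof -
      have "p (v - u) * (\<bar>C\<bar> + 1) < e" using v(2) by (simp add: pos_less_divide_eq)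
      moreover have "C * p (v - u) \<le> p (v - u) * (\<bar>C\<bar> + 1)"
        using C p[of "v - u"] by (simp add: algebra_simps)
      ultimately have "\<bar>f v - f u\<bar> < e" using lip[of u v] u v(1) by simp
      then show ?thesis using e(2)[of "f v"] v(1) by (simp add: dist_real_def)
    qed
    then show "\<exists>e>0. \<forall>v\<in>X. p (v - u) < e \<longrightarrow> v \<in> f -` S \<inter> X"
      using e(1) by (intro exI[of _ "e / (\<bar>C\<bar> + 1)"]) auto
  qed simp
  then show "f -` S \<inter> space (borel_of_norm X p) \<in> sets (borel_of_norm X p)"
    unfolding borel_of_norm_def by (subst sets_measure_of) (auto intro!: sigma_sets.Basic simp: space_measure_of_conv)
qed


lemma H1_diff:
  assumes "u \<in> H1_space" "v \<in> H1_space" shows "(\<lambda>x. u x - v x) \<in> H1_space"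
proof -
  have "is_weak_deriv i (\<lambda>x. u x - v x) (\<lambda>x. weak_deriv i u x - weak_deriv i v x)" for i
    by (intro is_weak_deriv_diff weak_deriv_works H1_L2 assms)
  then show ?thesis using L2_diff[OF H1_L2 H1_L2, OF assms] unfolding H1_space_def by blast
qed

lemma V_space_iff: "u \<in> V_space \<longleftrightarrow> u \<in> H1_space \<and> u \<in> H_space"
  by (auto simp: V_space_def H_space_def H1_L2)

lemma V_diff: "u \<in> V_space \<Longrightarrow> v \<in> V_space \<Longrightarrow> (\<lambda>x. u x - v x) \<in> V_space"
  unfolding V_space_iff by (simp add: H1_diff H_diff)

text \<open>Maximise \<open>\<phi> r * exp (- l * r)\<close> with a rate \<open>l\<close> above
  \<open>A\<close>. At the maximiser the integral inequality gives \<open>m * l \<le> m * A\<close>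
  for the maximum \<open>m\<close>, which forces \<open>m = 0\<close>.\<close>

lemma gronwall_zero:
  fixes \<phi> :: "real \<Rightarrow> real"
  assumes cont: "continuous_on {0..T} \<phi>" and nonneg: "\<And>t. t \<in> {0..T} \<Longrightarrow> 0 \<le> \<phi> t" and A: "0 \<le> A"
    and ineq: "\<And>t. t \<in> {0..T} \<Longrightarrow> \<phi> t \<le> A * (LINT r:{0<..t}|lborel. \<phi> r)"
    and t: "t \<in> {0..T}"
  shows "\<phi> t = 0"
proof -
  define l where "l = A + 1"
  have l: "l > 0" using A by (simp add: l_def)
  define \<psi> where "\<psi> r = \<phi> r * exp (- l * r)" for r
  have "compact {0..T}" "{0..T} \<noteq> {}" using t by auto
  moreover have "continuous_on {0..T} \<psi>" unfolding \<psi>_def by (intro continuous_intros cont)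
  ultimately obtain s where s: "s \<in> {0..T}" "\<And>r. r \<in> {0..T} \<Longrightarrow> \<psi> r \<le> \<psi> s"
    using continuous_attains_sup by meson
  define m where "m = \<psi> s"
  have m: "0 \<le> m" using nonneg[OF s(1)] by (simp add: m_def \<psi>_def)
  have \<phi>_le: "\<phi> r \<le> m * exp (l * r)" if "r \<in> {0..T}" for r
    using s(2)[OF that] by (simp add: m_def \<psi>_def exp_minus field_simps)
  have "(LINT r:{0<..s}|lborel. \<phi> r) \<le> (\<integral>r. indicator {0..s} r *\<^sub>R (m * exp (l * r)) \<partial>lborel)"
    unfolding set_lebesgue_integral_def
  proof (rule integral_mono')
    show "integrable lborel (\<lambda>r. indicator {0..s} r *\<^sub>R (m * exp (l * r)))"
      by (intro borel_integrable_compact continuous_intros) auto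
    show "indicator {0<..s} r *\<^sub>R \<phi> r \<le> indicator {0..s} r *\<^sub>R (m * exp (l * r))" for r
      using \<phi>_le[of r] s(1) m by (auto split: split_indicator)
    show "0 \<le> indicator {0..s} r *\<^sub>R (m * exp (l * r))" for r using m by simp
  qed
  also have "\<dots> = m * exp (l * s) / l - m * exp (l * 0) / l"
  proof (rule integral_FTC_atLeastAtMost)
    show "0 \<le> s" using s by simp
    show "((\<lambda>r. m * exp (l * r) / l) has_vector_derivative m * exp (l * r)) (at r within {0..s})" for r
      unfolding has_real_derivative_iff_has_vector_derivative[symmetric]
      using l by (auto intro!: derivative_eq_intros)
  qed (intro continuous_intros)
  also have "\<dots> \<le> m * exp (l * s) / l" using m l by simp
  finally have "A * (LINT r:{0<..s}|lborel. \<phi> r) \<le> A * (m * exp (l * s) / l)"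
    using A by (rule mult_left_mono)
  with ineq[OF s(1)] have "\<phi> s \<le> A * (m * exp (l * s) / l)" by simp
  moreover have "\<phi> s = m * exp (l * s)" by (simp add: m_def \<psi>_def exp_minus)
  ultimately have "m * exp (l * s) * l \<le> m * exp (l * s) * A" using l by (simp add: field_simps)
  then have "m * exp (l * s) \<le> 0" by (simp add: l_def distrib_left)
  then have "m = 0" using m by (simp add: mult_le_0_iff)
  then show ?thesis using \<phi>_le[OF t] nonneg[OF t] by simp
qed

text \<open>
  A product rule for \<open>\<parallel>d(t)\<parallel>\<^sup>2\<close> is avoided: \<open>\<parallel>d(b)\<parallel>\<^sup>2 - \<parallel>d(a)\<parallel>\<^sup>2 = (d(b) - d(a), d(b) + d(a))\<close>, where the
  time derivative applies to the left factor, and \<open>d(b) + d(a)\<close> is close to \<open>2 d(r)\<close> on short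
  intervals. The Bolzano lemma glues the resulting local inequalities.
\<close>

theorem shear_unique:
  fixes k :: int
  assumes k: "k \<noteq> 0" and sol: "strong_solution (1/2) (\<lambda>_ _. 0) T (shear c k) u" and t: "t \<in> {0..T}"
  shows "ae_eq (u t) (shear (shear_decay c k t) k)"
proof -
  define U where "U r = shear (shear_decay c k r) k" for r
  define G where "G r = shear ((- (real_of_int k)\<^sup>2 / 2) * shear_decay c k r) k" for r
  have uC: "u \<in> C_V T" and u0: "ae_eq (u 0) (shear c k)" using sol by (auto simp: strong_solution_def)
  obtain w g where w: "w \<in> time_L2 T stokes_domain H2_norm" and g: "g \<in> time_L2 T H_space L2_norm"
    and uw: "AE t in lborel. t \<in> {0<..T} \<longrightarrow> ae_eq (u t) (w t)"
    and dt: "has_time_deriv T u g"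
    and eq: "AE t in lborel. t \<in> {0<..T} \<longrightarrow> ae_eq (\<lambda>x. g t x + (1/2) *\<^sub>R stokes (w t) x + nonlin (w t) (w t) x) (\<lambda>_. 0)"
    using sol unfolding strong_solution_def by auto
  have uV: "u r \<in> V_space" if "r \<in> {0..T}" for r using uC that by (auto simp: C_V_def)
  have wm: "w \<in> restrict_space borel {0<..T} \<rightarrow>\<^sub>M borel_of_norm stokes_domain H2_norm"
    using w by (simp add: time_L2_def)
  have wS: "w r \<in> stokes_domain" if "r \<in> {0<..T}" for r
    using measurable_space[OF wm, of r] that by (auto simp: space_restrict_space)
  have gm: "g \<in> restrict_space borel {0<..T} \<rightarrow>\<^sub>M borel_of_norm H_space L2_norm" using g by (simp add: time_L2_def)
  have gH: "g r \<in> H_space" if "r \<in> {0<..T}" for r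
    using measurable_space[OF gm, of r] that by (auto simp: space_restrict_space)
  define d where "d r = (\<lambda>x. u r x - U r x)" for r
  have UV: "U r \<in> V_space" for r unfolding U_def by (rule shear_V)
  have GH: "G r \<in> H_space" for r unfolding G_def by (rule shear_H)
  have dV: "d r \<in> V_space" if "r \<in> {0..T}" for r unfolding d_def by (intro V_diff uV UV that)
  have dH: "d r \<in> H_space" and dL: "d r \<in> L2_space" if "r \<in> {0..T}" for r
    using dV[OF that] V_H V_L2 by auto
  define \<phi> where "\<phi> r = (L2_norm (d r))\<^sup>2" for r
  define C where "C = \<bar>c\<bar> * \<bar>k\<bar>"
  have C: "0 \<le> C" by (simp add: C_def)

  \<comment> \<open>The estimate applies to the version \<open>w\<close> with values in the Stokes
    domain and is carried to \<open>u\<close>, which agrees with it at almost every time.\<close>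
  have energy: "AE r in lborel. r \<in> {0<..T} \<longrightarrow> L2_inner (\<lambda>x. g r x - G r x) (d r) \<le> C * \<phi> r"
    using uw eq
  proof eventually_elim
    case (elim r)
    show ?case
    proof
      assume r: "r \<in> {0<..T}"
      then have r': "r \<in> {0..T}" by auto
      define d' where "d' = (\<lambda>x. w r x - shear (shear_decay c k r) k x)"
      have dd: "ae_eq (d r) d'"
        using elim(1) r unfolding ae_eq_def d_def d'_def U_def by (auto elim!: eventually_mono)
      have d'L: "d' \<in> L2_space"
        unfolding d'_def
        by (intro L2_diff shear_L2) (use wS[OF r] in \<open>auto simp: stokes_domain_def intro: V_L2\<close>)
      have gGL: "(\<lambda>x. g r x - G r x) \<in> L2_space" by (intro L2_diff H_L2 gH GH r)
      have "L2_inner (\<lambda>x. g r x - G r x) (d r) = L2_inner (\<lambda>x. g r x - G r x) d'"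
        by (rule L2_inner_ae_cong[OF ae_eq_refl dd gGL gGL dL[OF r'] d'L])
      also have "\<dots> \<le> (\<bar>shear_decay c k r\<bar> * \<bar>k\<bar>) * (L2_norm d')\<^sup>2"
        unfolding G_def d'_def using elim(2) r by (intro energy_inequality wS gH) auto
      also have "\<dots> \<le> C * (L2_norm d')\<^sup>2"
        unfolding C_def using r by (intro mult_right_mono shear_decay_le0) auto
      also have "L2_norm d' = L2_norm (d r)" by (rule L2_norm_ae_cong[OF dd dL[OF r'] d'L, symmetric])
      finally show "L2_inner (\<lambda>x. g r x - G r x) (d r) \<le> C * \<phi> r" by (simp add: \<phi>_def)
    qed
  qed

  \<comment> \<open>Continuity in \<open>V_norm\<close> passes to \<open>L2_norm\<close> by
    Poincare's inequality.\<close>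
  have d_cont: "((\<lambda>s. L2_norm (\<lambda>x. d s x - d r x)) \<longlongrightarrow> 0) (at r within {0..T})" if r: "r \<in> {0..T}" for r
  proof (rule Lim_null_comparison)
    have "((\<lambda>s. V_norm (u s - u r)) \<longlongrightarrow> 0) (at r within {0..T})" using uC r by (auto simp: C_V_def)
    moreover have "((\<lambda>s. \<bar>shear_decay c k s - shear_decay c k r\<bar> * (sqrt 2 * pi)) \<longlongrightarrow>
        \<bar>shear_decay c k r - shear_decay c k r\<bar> * (sqrt 2 * pi)) (at r within {0..T})"
      using continuous_shear_decay[of UNIV c k]
      by (intro tendsto_intros) (auto simp: continuous_on_def intro: tendsto_within_subset)
    ultimately show "((\<lambda>s. V_norm (u s - u r) + \<bar>shear_decay c k s - shear_decay c k r\<bar> * (sqrt 2 * pi)) \<longlongrightarrow> 0) (at r within {0..T})"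
      using tendsto_add by force
    show "\<forall>\<^sub>F s in at r within {0..T}. norm (L2_norm (\<lambda>x. d s x - d r x))
        \<le> V_norm (u s - u r) + \<bar>shear_decay c k s - shear_decay c k r\<bar> * (sqrt 2 * pi)"
      unfolding eventually_at_filter
    proof (intro always_eventually allI impI)
      fix s assume s: "s \<in> {0..T}"
      have uu: "(\<lambda>x. u s x - u r x) \<in> V_space" by (intro V_diff uV s r)
      have "(\<lambda>x. d s x - d r x) = (\<lambda>x. (u s x - u r x) + (U r x - U s x))" by (simp add: d_def fun_eq_iff)
      then have "L2_norm (\<lambda>x. d s x - d r x) \<le> L2_norm (\<lambda>x. u s x - u r x) + L2_norm (\<lambda>x. U r x - U s x)"
        using L2_norm_triangle[OF V_L2[OF uu] L2_diff[OF V_L2[OF UV] V_L2[OF UV]], of r s] by simp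
      also have "L2_norm (\<lambda>x. u s x - u r x) \<le> V_norm (u s - u r)"
        using poincare_V[OF uu] by (simp add: fun_diff_def)
      also have "L2_norm (\<lambda>x. U r x - U s x) = \<bar>shear_decay c k s - shear_decay c k r\<bar> * (sqrt 2 * pi)"
        by (simp add: U_def shear_diff L2_norm_shear k abs_minus_commute)
      finally show "norm (L2_norm (\<lambda>x. d s x - d r x)) \<le> V_norm (u s - u r) + \<bar>shear_decay c k s - shear_decay c k r\<bar> * (sqrt 2 * pi)"
        by (simp add: fun_diff_def)
    qed
  qed

  have \<phi>_cont: "continuous_on {0..T} \<phi>"
    unfolding continuous_on_def \<phi>_def
  proof (intro ballI tendsto_power)
    fix r assume r: "r \<in> {0..T}"
    show "((\<lambda>s. L2_norm (d s)) \<longlongrightarrow> L2_norm (d r)) (at r within {0..T})"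
    proof (rule Lim_null_comparison[OF _ d_cont[OF r], THEN LIM_zero_cancel])
      show "\<forall>\<^sub>F s in at r within {0..T}. norm (L2_norm (d s) - L2_norm (d r)) \<le> L2_norm (\<lambda>x. d s x - d r x)"
        unfolding eventually_at_filter
      proof (intro always_eventually allI impI)
        fix s assume s: "s \<in> {0..T}"
        show "norm (L2_norm (d s) - L2_norm (d r)) \<le> L2_norm (\<lambda>x. d s x - d r x)"
          using L2_norm_triangle_rev[OF dL[OF s] dL[OF r]] L2_norm_triangle_rev[OF dL[OF r] dL[OF s]]
            L2_norm_minus_commute[of "d s" "d r"] by simp
      qed
    qed
  qed
  have \<phi>_int: "set_integrable lborel {0<..T} \<phi>"
  proof (rule set_integrable_subset)
    show "set_integrable lborel {0..T} \<phi>"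
      unfolding set_integrable_def by (rule borel_integrable_compact[OF compact_Icc \<phi>_cont])
  qed auto

  have set_meas: "(\<lambda>r. indicator {0<..T} r *\<^sub>R f (g r)) \<in> borel_measurable borel"
    if "f \<in> borel_measurable (borel_of_norm H_space L2_norm)" for f :: "vfield \<Rightarrow> real"
    using measurable_compose[OF gm that] by (subst (asm) borel_measurable_restrict_space_iff) auto
  have n_meas: "(\<lambda>r. indicator {0<..T} r *\<^sub>R L2_norm (g r)) \<in> borel_measurable borel"
  proof (rule set_meas, rule Lipschitz_borel_of_norm[where C=1])
    fix u v assume "u \<in> H_space" "v \<in> H_space"
    then have "u \<in> L2_space" "v \<in> L2_space" by (auto intro: H_L2)
    then show "\<bar>L2_norm v - L2_norm u\<bar> \<le> 1 * L2_norm (v - u)"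
      using L2_norm_triangle_rev[of u v] L2_norm_triangle_rev[of v u] L2_norm_minus_commute[of u v]
      by (simp add: fun_diff_def)
  qed auto
  \<comment> \<open>On a bounded time interval square integrability gives integrability through
    \<open>y \<le> 1 + y * y\<close>.\<close>
  have n_int: "set_integrable lborel {0<..T} (\<lambda>r. L2_norm (g r))"
    unfolding set_integrable_def
  proof (rule integrableI_bounded)
    have "(\<integral>\<^sup>+r. ennreal (norm (indicator {0<..T} r *\<^sub>R L2_norm (g r))) \<partial>lborel)
       \<le> (\<integral>\<^sup>+r. indicator {0<..T} r + ennreal (indicator {0<..T} r *\<^sub>R L2_norm (g r) * (indicator {0<..T} r *\<^sub>R L2_norm (g r))) \<partial>lborel)"
    proof (rule nn_integral_mono)
      fix r
      have "y \<le> 1 + y * y" for y :: real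
        using zero_le_square[of "y - 1/2"] by (simp add: algebra_simps)
      then have "ennreal (L2_norm (g r)) \<le> ennreal (1 + L2_norm (g r) * L2_norm (g r))" by (rule ennreal_leI)
      then show "ennreal (norm (indicator {0<..T} r *\<^sub>R L2_norm (g r)))
        \<le> indicator {0<..T} r + ennreal (indicator {0<..T} r *\<^sub>R L2_norm (g r) * (indicator {0<..T} r *\<^sub>R L2_norm (g r)))"
        by (auto split: split_indicator)
    qed
    also have "\<dots> = emeasure lborel {0<..T} + (\<integral>\<^sup>+r. ennreal (indicator {0<..T} r *\<^sub>R L2_norm (g r) * (indicator {0<..T} r *\<^sub>R L2_norm (g r))) \<partial>lborel)"
      using n_meas by (subst nn_integral_add) auto
    also have "(\<integral>\<^sup>+r. ennreal (indicator {0<..T} r *\<^sub>R L2_norm (g r) * (indicator {0<..T} r *\<^sub>R L2_norm (g r))) \<partial>lborel)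
       = (\<integral>\<^sup>+t\<in>{0<..T}. ennreal ((L2_norm (g t))\<^sup>2) \<partial>lborel)"
      by (intro nn_integral_cong) (auto simp: power2_eq_square split: split_indicator)
    also have "emeasure lborel {0<..T} + \<dots> < \<infinity>"
      using g by (cases "0 \<le> T") (auto simp: time_L2_def)
    finally show "(\<integral>\<^sup>+r. ennreal (norm (indicator {0<..T} r *\<^sub>R L2_norm (g r))) \<partial>lborel) < \<infinity>" .
  qed (use n_meas in simp)
  have gh_int: "set_integrable lborel {0<..T} (\<lambda>r. L2_inner (g r) h)" if h: "h \<in> H_space" for h
    unfolding set_integrable_def
  proof (rule Bochner_Integration.integrable_bound)
    show "integrable lborel (\<lambda>r. L2_norm h * (indicator {0<..T} r *\<^sub>R L2_norm (g r)))"
      using n_int by (simp add: set_integrable_def)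
    have "(\<lambda>r. indicator {0<..T} r *\<^sub>R L2_inner (g r) h) \<in> borel_measurable borel"
    proof (rule set_meas, rule Lipschitz_borel_of_norm[where C="L2_norm h"])
      fix u v assume "u \<in> H_space" "v \<in> H_space"
      then have "u \<in> L2_space" "v \<in> L2_space" by (auto intro: H_L2)
      then show "\<bar>L2_inner v h - L2_inner u h\<bar> \<le> L2_norm h * L2_norm (v - u)"
        using L2_Cauchy_Schwarz[OF L2_diff[of v u] H_L2[OF h]]
        by (simp add: fun_diff_def L2_inner_diff_left H_L2[OF h] mult.commute)
    qed auto
    then show "(\<lambda>r. indicator {0<..T} r *\<^sub>R L2_inner (g r) h) \<in> borel_measurable lborel" by simp
    show "AE r in lborel. norm (indicator {0<..T} r *\<^sub>R L2_inner (g r) h) \<le> norm (L2_norm h * (indicator {0<..T} r *\<^sub>R L2_norm (g r)))"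
    proof (rule AE_I2)
      fix r
      show "norm (indicator {0<..T} r *\<^sub>R L2_inner (g r) h) \<le> norm (L2_norm h * (indicator {0<..T} r *\<^sub>R L2_norm (g r)))"
        using L2_Cauchy_Schwarz[OF H_L2[OF gH] H_L2[OF h], of r]
        by (auto split: split_indicator simp: mult.commute abs_mult)
    qed
  qed
  have Gh_int: "set_integrable lborel {0<..T} (\<lambda>r. L2_inner (G r) h)" for h
  proof (rule set_integrable_subset)
    have lin: "L2_inner (shear a k) h = a * L2_inner (shear 1 k) h" for a
      using L2_inner_scale_left[of a "shear 1 k" h] by (simp add: shear_scale)
    have "L2_inner (G r) h = (- (real_of_int k)\<^sup>2 / 2) * shear_decay c k r * L2_inner (shear 1 k) h" for r
      unfolding G_def by (rule lin)
    then show "set_integrable lborel {0..T} (\<lambda>r. L2_inner (G r) h)"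
      unfolding set_integrable_def
      by (intro borel_integrable_compact) (auto intro!: continuous_intros continuous_shear_decay)
  qed auto

  define B where "B = (real_of_int k)\<^sup>2 / 2 * \<bar>c\<bar> * (sqrt 2 * pi)"
  have B0: "0 \<le> B" by (simp add: B_def)
  have G_norm: "L2_norm (G r) \<le> B" if "r \<in> {0<..T}" for r
  proof -
    have "(real_of_int k)\<^sup>2 / 2 * \<bar>shear_decay c k r\<bar> * (sqrt 2 * pi) \<le> B"
      unfolding B_def using shear_decay_le0[of r c k] that by (intro mult_right_mono mult_left_mono) auto
    then show ?thesis by (simp add: G_def L2_norm_shear k abs_mult)
  qed
  \<comment> \<open>A time-integrable majorant of the norm of \<open>g r - G r\<close>, against
    which the errors in \<open>main\<close> are measured.\<close>
  define n where "n r = L2_norm (g r) + B" for r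
  have n0: "0 \<le> n r" for r using B0 by (simp add: n_def)
  have nint: "set_integrable lborel {0<..T} n"
    unfolding n_def
  proof (intro set_integral_add n_int)
    have "set_integrable lborel {0..T} (\<lambda>r. B)"
      unfolding set_integrable_def by (intro borel_integrable_compact) auto
    then show "set_integrable lborel {0<..T} (\<lambda>r. B)" by (rule set_integrable_subset) auto
  qed

  have increment: "\<phi> t' - \<phi> s = (LINT r:{s<..t'}|lborel. L2_inner (\<lambda>x. g r x - G r x) (\<lambda>x. d t' x + d s x))"
    if st: "0 \<le> s" "s \<le> t'" "t' \<le> T" for s t'
  proof -
    have s: "s \<in> {0..T}" and t': "t' \<in> {0..T}" using st by auto
    define h where "h = (\<lambda>x. d t' x + d s x)"
    have h: "h \<in> H_space" unfolding h_def by (intro H_add dH s t')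
    note hL = H_L2[OF h]
    have sub: "{s<..t'} \<subseteq> {0<..T}" using st by auto
    have "\<phi> t' - \<phi> s = L2_inner (d t') h - L2_inner (d s) h"
      unfolding h_def \<phi>_def
      by (simp add: L2_inner_add_right[OF dL[OF t'] dL[OF s] dL[OF t']] L2_inner_add_right[OF dL[OF t'] dL[OF s] dL[OF s]]
        L2_norm_sq L2_inner_commute[of "d s" "d t'"])
    also have "\<dots> = (L2_inner (u t') h - L2_inner (u s) h) - (L2_inner (U t') h - L2_inner (U s) h)"
      unfolding d_def
      by (simp add: L2_inner_diff_left[OF V_L2[OF uV[OF t']] V_L2[OF UV] hL] L2_inner_diff_left[OF V_L2[OF uV[OF s]] V_L2[OF UV] hL])
    also have "L2_inner (u t') h - L2_inner (u s) h = (LINT r:{s<..t'}|lborel. L2_inner (g r) h)"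
      using dt h st unfolding has_time_deriv_def by blast
    also have "L2_inner (U t') h - L2_inner (U s) h = (LINT r:{s<..t'}|lborel. L2_inner (G r) h)"
      unfolding U_def G_def by (rule shear_time_deriv_integral[OF st(2)])
    also have "(LINT r:{s<..t'}|lborel. L2_inner (g r) h) - (LINT r:{s<..t'}|lborel. L2_inner (G r) h)
      = (LINT r:{s<..t'}|lborel. L2_inner (g r) h - L2_inner (G r) h)"
      using set_integrable_subset[OF gh_int[OF h] _ sub] set_integrable_subset[OF Gh_int _ sub]
      by (intro set_integral_diff(2)[symmetric]) auto
    also have "\<dots> = (LINT r:{s<..t'}|lborel. L2_inner (\<lambda>x. g r x - G r x) h)"
      using sub by (intro set_lebesgue_integral_cong) (auto simp: L2_inner_diff_left H_L2 gH GH hL subset_eq)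
    finally show ?thesis by (simp add: h_def)
  qed

  have main: "\<phi> t' \<le> (2 * C) * (LINT r:{0<..t'}|lborel. \<phi> r)" if t': "t' \<in> {0..T}" for t'
  proof (rule field_le_epsilon)
    fix e' :: real assume e': "e' > 0"
    define N where "N = (LINT r:{0<..t'}|lborel. n r)"
    have N0: "0 \<le> N" unfolding N_def set_lebesgue_integral_def by (intro Bochner_Integration.integral_nonneg) (auto simp: n0)
    \<comment> \<open>Chosen so that \<open>e * N \<le> e'\<close>; the added \<open>1\<close>
      covers \<open>N = 0\<close>.\<close>
    define e where "e = e' / (N + 1)"
    have e: "e > 0" using e' N0 by (simp add: e_def)
    \<comment> \<open>The first summand bounds the pairing with \<open>2 d(r)\<close>, the second
      pays for replacing the sum of the two end values of \<open>d\<close> by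
      \<open>2 d(r)\<close>.\<close>
    define f where "f r = (2 * C) * \<phi> r + e * n r" for r
    have f_int: "set_integrable lborel {0<..T} f"
      unfolding f_def by (intro set_integral_add set_integrable_mult_right \<phi>_int nint)
    have f0: "0 \<le> f r" for r unfolding f_def using C e n0 by (simp add: \<phi>_def)
    define F where "F s = (LINT r:{0<..s}|lborel. f r)" for s
    have F_diff: "F b - F a = (LINT r:{a<..b}|lborel. f r)" if "0 \<le> a" "a \<le> b" "b \<le> T" for a b
    proof -
      have "{0<..b} = {0<..a} \<union> {a<..b}" using that by auto
      then have "F b = F a + (LINT r:{a<..b}|lborel. f r)"
        unfolding F_def using that
        by (simp only:) (intro set_integral_Un set_integrable_subset[OF f_int], auto)
      then show ?thesis by simp
    qed
    \<comment> \<open>The Bolzano lemma quantifies over all short intervals around a point, also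
      those leaving the time horizon; the bounds on the end points are therefore guards inside the
      predicate.\<close>
    have "(0::real) \<le> 0 \<and> t' \<le> T \<longrightarrow> \<phi> t' - \<phi> 0 \<le> F t' - F 0"
    proof (rule Bolzano[where P="\<lambda>a b. 0 \<le> a \<and> b \<le> T \<longrightarrow> \<phi> b - \<phi> a \<le> F b - F a"])
      show "0 \<le> t'" using t' by simp
    next
      fix a b c assume "0 \<le> a \<and> b \<le> T \<longrightarrow> \<phi> b - \<phi> a \<le> F b - F a" "0 \<le> b \<and> c \<le> T \<longrightarrow> \<phi> c - \<phi> b \<le> F c - F b"
        "a \<le> b" "b \<le> c"
      then show "0 \<le> a \<and> c \<le> T \<longrightarrow> \<phi> c - \<phi> a \<le> F c - F a" by auto
    next
      fix x assume x: "0 \<le> x" "x \<le> t'"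
      then have xT: "x \<in> {0..T}" using t' by auto
      have "\<forall>\<^sub>F s in at x within {0..T}. L2_norm (\<lambda>y. d s y - d x y) < e / 4"
        using order_tendstoD(2)[OF d_cont[OF xT], of "e / 4"] e by simp
      then obtain \<delta> where \<delta>: "\<delta> > 0" "\<And>s. s \<in> {0..T} \<Longrightarrow> s \<noteq> x \<Longrightarrow> dist s x < \<delta> \<Longrightarrow> L2_norm (\<lambda>y. d s y - d x y) < e / 4"
        unfolding eventually_at by blast
      have near: "L2_norm (\<lambda>y. d s y - d x y) \<le> e / 4" if "s \<in> {0..T}" "dist s x < \<delta>" for s
        using \<delta>(2)[OF that(1) _ that(2)] e by (cases "s = x") auto
      have "\<phi> b - \<phi> a \<le> F b - F a" if ab: "a \<le> x" "x \<le> b" "b - a < \<delta>" "0 \<le> a" "b \<le> T" for a b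
      proof -
        have aT: "a \<in> {0..T}" and bT: "b \<in> {0..T}" using ab by auto
        have sub: "{a<..b} \<subseteq> {0<..T}" using ab by auto
        \<comment> \<open>Each point is within \<open>e / 4\<close> of \<open>d x\<close>, hence any
          two within \<open>e / 2\<close>; the two end points together then cost
          \<open>e * n r\<close>, as allowed by \<open>f\<close>.\<close>
        have close: "L2_norm (\<lambda>y. d s y - d r y) \<le> e / 2" if "s \<in> {a..b}" "r \<in> {a..b}" for s r
        proof -
          have sr: "s \<in> {0..T}" "r \<in> {0..T}" "dist s x < \<delta>" "dist r x < \<delta>" using that ab by (auto simp: dist_real_def)
          have "L2_norm (\<lambda>y. d s y - d r y) \<le> L2_norm (\<lambda>y. d s y - d x y) + L2_norm (\<lambda>y. d x y - d r y)"
            by (rule L2_norm_triangle_diff[OF dL[OF sr(1)] dL[OF xT] dL[OF sr(2)]])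
          then show ?thesis using near[OF sr(1,3)] near[OF sr(2,4)] L2_norm_minus_commute[of "d x" "d r"] by simp
        qed
        have "\<phi> b - \<phi> a = (LINT r:{a<..b}|lborel. L2_inner (\<lambda>x. g r x - G r x) (\<lambda>x. d b x + d a x))"
          by (rule increment) (use ab in auto)
        also have "\<dots> \<le> (LINT r:{a<..b}|lborel. f r)"
          unfolding set_lebesgue_integral_def
        proof (rule integral_mono_AE')
          show "integrable lborel (\<lambda>r. indicator {a<..b} r *\<^sub>R f r)"
            using set_integrable_subset[OF f_int _ sub] by (simp add: set_integrable_def)
          show "AE r in lborel. 0 \<le> indicator {a<..b} r *\<^sub>R f r" using f0 by simp
          show "AE r in lborel. indicator {a<..b} r *\<^sub>R L2_inner (\<lambda>x. g r x - G r x) (\<lambda>x. d b x + d a x)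
             \<le> indicator {a<..b} r *\<^sub>R f r"
            using energy
          proof eventually_elim
            case (elim r)
            show ?case
            proof (cases "r \<in> {a<..b}")
              case True
              then have r: "r \<in> {0<..T}" and rT: "r \<in> {0..T}" and rab: "r \<in> {a..b}" using sub by auto
              define q where "q = (\<lambda>x. g r x - G r x)"
              have qL: "q \<in> L2_space" unfolding q_def by (intro L2_diff H_L2 gH GH r)
              have q_le: "L2_norm q \<le> n r"
                using L2_norm_triangle[OF H_L2[OF gH[OF r]] L2_uminus[OF H_L2[OF GH]], of r] L2_norm_uminus[of "G r"] G_norm[OF r]
                by (simp add: q_def n_def)
              have db: "(\<lambda>x. d b x - d r x) \<in> L2_space" and da: "(\<lambda>x. d a x - d r x) \<in> L2_space"
                by (intro L2_diff dL aT bT rT)+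
              have "(\<lambda>x. d b x + d a x) = (\<lambda>x. (2 *\<^sub>R d r x) + ((d b x - d r x) + (d a x - d r x)))"
                by (simp add: fun_eq_iff scaleR_2)
              then have "L2_inner q (\<lambda>x. d b x + d a x) = 2 * L2_inner q (d r) + (L2_inner q (\<lambda>x. d b x - d r x) + L2_inner q (\<lambda>x. d a x - d r x))"
                by (simp only: L2_inner_add_right[OF L2_scale[OF dL[OF rT]] L2_add[OF db da] qL] L2_inner_add_right[OF db da qL] L2_inner_scale_right)
              moreover have "L2_inner q (\<lambda>x. d b x - d r x) \<le> n r * (e / 2)"
              proof -
                have "L2_inner q (\<lambda>x. d b x - d r x) \<le> L2_norm q * L2_norm (\<lambda>x. d b x - d r x)"
                  using L2_Cauchy_Schwarz[OF qL db] by linarith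
                also have "\<dots> \<le> n r * (e / 2)" using q_le n0 rab ab by (intro mult_mono close) auto
                finally show ?thesis .
              qed
              moreover have "L2_inner q (\<lambda>x. d a x - d r x) \<le> n r * (e / 2)"
              proof -
                have "L2_inner q (\<lambda>x. d a x - d r x) \<le> L2_norm q * L2_norm (\<lambda>x. d a x - d r x)"
                  using L2_Cauchy_Schwarz[OF qL da] by linarith
                also have "\<dots> \<le> n r * (e / 2)" using q_le n0 rab ab by (intro mult_mono close) auto
                finally show ?thesis .
              qed
              moreover have "L2_inner q (d r) \<le> C * \<phi> r" using elim r by (simp add: q_def)
              ultimately have "L2_inner q (\<lambda>x. d b x + d a x) \<le> f r" by (simp add: f_def algebra_simps)
              then show ?thesis using True by (simp add: q_def)
            qed simp
          qed
        qed
        also have "\<dots> = F b - F a" by (rule F_diff[symmetric]) (use ab in auto)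
        finally show ?thesis .
      qed
      then show "\<exists>\<delta>>0. \<forall>a b. a \<le> x \<and> x \<le> b \<and> b - a < \<delta> \<longrightarrow> 0 \<le> a \<and> b \<le> T \<longrightarrow> \<phi> b - \<phi> a \<le> F b - F a"
        using \<delta>(1) by blast
    qed
    moreover have "\<phi> 0 = 0"
    proof -
      have "0 \<in> {0..T}" using t' by auto
      moreover have "ae_eq (u 0) (U 0)" using u0 by (simp add: U_def shear_decay_def)
      ultimately show ?thesis
        using L2_norm_diff_eq_0[OF V_L2[OF uV] V_L2[OF UV], of 0 0] by (simp add: \<phi>_def d_def)
    qed
    moreover have "F 0 = 0" by (simp add: F_def set_lebesgue_integral_def)
    ultimately have "\<phi> t' \<le> F t'" using t' by simp
    also have "F t' = (2 * C) * (LINT r:{0<..t'}|lborel. \<phi> r) + e * N"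
    proof -
      have "{0<..t'} \<subseteq> {0<..T}" using t' by auto
      then have "set_integrable lborel {0<..t'} \<phi>" "set_integrable lborel {0<..t'} n"
        using set_integrable_subset[OF \<phi>_int] set_integrable_subset[OF nint] by auto
      then show ?thesis unfolding F_def f_def N_def
        by (subst set_integral_add(2)) auto
    qed
    also have "e * N \<le> e'" using e' N0 by (simp add: e_def field_simps)
    finally show "\<phi> t' \<le> (2 * C) * (LINT r:{0<..t'}|lborel. \<phi> r) + e'" by simp
  qed
  have "\<phi> t = 0"
    by (rule gronwall_zero[OF \<phi>_cont _ _ main t]) (use C in \<open>auto simp: \<phi>_def\<close>)
  then have "L2_norm (\<lambda>x. u t x - U t x) = 0" by (simp add: \<phi>_def d_def)
  then show ?thesis using L2_norm_diff_eq_0[OF V_L2[OF uV[OF t]] V_L2[OF UV], of t] by (simp add: U_def)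
qed

section \<open>Perturbation of the observation law\<close>

definition gauss_density :: "real^2 \<Rightarrow> real" where
  "gauss_density y = std_normal_density (y $ 1) * std_normal_density (y $ 2)"

lemma std_gaussian_eq: "std_gaussian = density lborel (\<lambda>y. ennreal (gauss_density y))"
  by (simp add: std_gaussian_def gauss_density_def UNIV_2)

lemma borel_vec_nth [measurable]: "(\<lambda>x::real^2. x $ i) \<in> borel_measurable borel"
  by (intro borel_measurable_continuous_onI continuous_intros)

lemma gauss_density_measurable [measurable]: "gauss_density \<in> borel_measurable borel"
  unfolding gauss_density_def[abs_def] by measurable

lemma gauss_density_nonneg [simp]: "0 \<le> gauss_density y"
  by (simp add: gauss_density_def)

lemma sets_std_gaussian [simp]: "sets std_gaussian = sets borel"
  by (simp add: std_gaussian_eq)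

lemma space_std_gaussian [simp]: "space std_gaussian = UNIV"
  by (simp add: std_gaussian_eq)

lemma nn_integral_prod_real2:
  fixes p q :: "real \<Rightarrow> real"
  assumes [measurable]: "p \<in> borel_measurable borel" "q \<in> borel_measurable borel"
    and nn: "\<And>x. 0 \<le> p x" "\<And>x. 0 \<le> q x"
  shows "(\<integral>\<^sup>+y. ennreal (p (y $ 1) * q (y $ 2)) \<partial>(lborel :: (real^2) measure))
    = (\<integral>\<^sup>+x. ennreal (p x) \<partial>lborel) * (\<integral>\<^sup>+x. ennreal (q x) \<partial>lborel)"
proof -
  define f where "f b = (if b = axis 1 1 then p else q)" for b :: "real^2"
  have ne: "axis 2 1 \<noteq> (axis 1 1 :: real^2)" by (simp add: axis_eq_axis)
  have "(\<integral>\<^sup>+y. (\<Prod>b\<in>Basis. ennreal (f b (y \<bullet> b))) \<partial>(lborel :: (real^2) measure)) = (\<Prod>b\<in>(Basis :: (real^2) set). (\<integral>\<^sup>+x. ennreal (f b x) \<partial>lborel))"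
    by (rule nn_integral_lborel_prod) (auto simp: f_def)
  then show ?thesis
    by (simp add: prod_Basis_real2 UNIV_2 f_def ne inner_axis ennreal_mult nn)
qed

lemma nn_integral_std_normal: "(\<integral>\<^sup>+x. ennreal (std_normal_density x) \<partial>lborel) = 1"
  using prob_space.emeasure_space_1[OF prob_space_normal_density[of 1 0]]
  by (simp add: emeasure_density)

lemma nn_integral_std_normal_square: "(\<integral>\<^sup>+x. ennreal (std_normal_density x * x\<^sup>2) \<partial>lborel) = 1"
  using std_normal_moment_even[of 1]
  by (subst nn_integral_eq_integral) (auto simp: has_bochner_integral_iff fact_numeral)

lemma prob_space_std_gaussian: "prob_space std_gaussian"
proof
  show "emeasure std_gaussian (space std_gaussian) = 1"
    unfolding std_gaussian_eq
    by (simp add: emeasure_density gauss_density_def nn_integral_prod_real2 nn_integral_std_normal)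
qed

lemma ennreal_lincomb:
  "0 \<le> a \<Longrightarrow> 0 \<le> b \<Longrightarrow> 0 \<le> c \<Longrightarrow> 0 \<le> d \<Longrightarrow>
    ennreal (a * b + c * d) = ennreal a * ennreal b + ennreal c * ennreal d"
  by (simp add: ennreal_mult)

lemma norm_sq_real2: "(norm (a::real^2))\<^sup>2 = (a $ 1)\<^sup>2 + (a $ 2)\<^sup>2"
  unfolding power2_norm_eq_inner by (simp only: inner_vec_def sum_2 inner_real_def power2_eq_square)

text \<open>The weight \<open>1 + (norm y)\<^sup>2 / 2\<close> is a majorant of
  \<open>norm y\<close> with an explicit integral: mass one plus half of two unit second
  moments.\<close>

lemma gauss_moment:
  "(\<integral>\<^sup>+y. ennreal (gauss_density y * (1 + ((y $ 1)\<^sup>2 + (y $ 2)\<^sup>2) / 2)) \<partial>lborel) = 2"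
proof -
  have "(\<integral>\<^sup>+y. ennreal (gauss_density y * (1 + ((y $ 1)\<^sup>2 + (y $ 2)\<^sup>2) / 2)) \<partial>lborel)
     = (\<integral>\<^sup>+y. ennreal (gauss_density y) + ennreal (1/2) * (ennreal ((std_normal_density (y$1) * (y$1)\<^sup>2) * std_normal_density (y$2))
          + ennreal (std_normal_density (y$1) * (std_normal_density (y$2) * (y$2)\<^sup>2))) \<partial>lborel)"
  proof (rule nn_integral_cong)
    fix y :: "real^2"
    define A B where "A = (std_normal_density (y$1) * (y$1)\<^sup>2) * std_normal_density (y$2)"
      and "B = std_normal_density (y$1) * (std_normal_density (y$2) * (y$2)\<^sup>2)"
    have AB: "0 \<le> A" "0 \<le> B" by (auto simp: A_def B_def)
    have "gauss_density y * (1 + ((y $ 1)\<^sup>2 + (y $ 2)\<^sup>2) / 2) = 1 * gauss_density y + (1/2) * (A + B)"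
      by (simp add: gauss_density_def A_def B_def algebra_simps)
    then show "ennreal (gauss_density y * (1 + ((y $ 1)\<^sup>2 + (y $ 2)\<^sup>2) / 2)) = ennreal (gauss_density y) + ennreal (1/2) * (ennreal A + ennreal B)"
      using AB ennreal_lincomb[of 1 "gauss_density y" "1/2" "A + B"] by (simp del: ennreal_half)
  qed
  also have "\<dots> = (\<integral>\<^sup>+y. ennreal (gauss_density y) \<partial>lborel) + ennreal (1/2) * ((\<integral>\<^sup>+y. ennreal ((std_normal_density (y$1) * (y$1)\<^sup>2) * std_normal_density (y$2)) \<partial>(lborel :: (real^2) measure))
          + (\<integral>\<^sup>+y. ennreal (std_normal_density (y$1) * (std_normal_density (y$2) * (y$2)\<^sup>2)) \<partial>(lborel :: (real^2) measure)))"
    by (simp add: nn_integral_add nn_integral_cmult)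
  also have "\<dots> = 1 + ennreal (1/2) * (1 + 1)"
    using nn_integral_prod_real2[of "\<lambda>x. std_normal_density x * x\<^sup>2" std_normal_density]
      nn_integral_prod_real2[of std_normal_density "\<lambda>x. std_normal_density x * x\<^sup>2"]
    by (simp add: gauss_density_def nn_integral_prod_real2 nn_integral_std_normal nn_integral_std_normal_square)
  also have "\<dots> = 2"
  proof -
    have "ennreal (1/2) * (1 + 1) = ennreal (1/2 * 2)" by (subst ennreal_mult) auto
    then show ?thesis by simp
  qed
  finally show ?thesis .
qed

text \<open>The ratio of the two densities is \<open>exp E\<close>, and convexity gives
  \<open>1 - exp E \<le> - E\<close>. The linear term in \<open>E\<close> is then bounded by second
  moments. One direction is enough, since the question is only how much mass an event can
  lose.\<close>

lemma gauss_density_shift: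
  "gauss_density y \<le> gauss_density (y - a) + gauss_density y * ((norm a)\<^sup>2 / 2 + norm a * (1 + ((y $ 1)\<^sup>2 + (y $ 2)\<^sup>2) / 2))"
proof -
  define E where "E = y \<bullet> a - (norm a)\<^sup>2 / 2"
  have 1: "std_normal_density (r - s) = std_normal_density r * exp (r * s - s\<^sup>2 / 2)" for r s :: real
    by (simp add: normal_density_def exp_add[symmetric] power2_diff diff_divide_distrib add_divide_distrib algebra_simps)
  have "gauss_density (y - a) = gauss_density y * exp E"
    unfolding gauss_density_def E_def norm_sq_real2
    by (simp add: 1 exp_add[symmetric] inner_vec_def sum_2 add_divide_distrib algebra_simps)
  moreover have "1 - exp E \<le> - E" using exp_ge_add_one_self[of E] by linarith
  moreover have "- E \<le> (norm a)\<^sup>2 / 2 + norm a * (1 + ((y $ 1)\<^sup>2 + (y $ 2)\<^sup>2) / 2)"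
  proof -
    have "- (y \<bullet> a) \<le> norm a * norm y" using Cauchy_Schwarz_ineq2[of y a] by (simp add: mult.commute)
    also have "norm y \<le> 1 + (norm y)\<^sup>2 / 2"
      using zero_le_square[of "norm y - 1"] by (simp add: algebra_simps power2_eq_square)
    then have "norm a * norm y \<le> norm a * (1 + (norm y)\<^sup>2 / 2)" by (rule mult_left_mono) simp
    also have "(norm y)\<^sup>2 = (y $ 1)\<^sup>2 + (y $ 2)\<^sup>2" by (rule norm_sq_real2)
    finally show ?thesis by (simp add: E_def)
  qed
  ultimately have "gauss_density y * (1 - exp E) \<le> gauss_density y * ((norm a)\<^sup>2 / 2 + norm a * (1 + ((y $ 1)\<^sup>2 + (y $ 2)\<^sup>2) / 2))"
    by (intro mult_left_mono) auto
  then show ?thesis using \<open>gauss_density (y - a) = gauss_density y * exp E\<close> by (simp add: algebra_simps)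
qed

text \<open>The density bound is integrated against a function with values at most one: the mass 1
  and the moment 2 produce the two coefficients, and translation invariance of \<open>lborel\<close>
  turns the shifted density into a shifted argument.\<close>

lemma std_gaussian_shift:
  assumes f [measurable]: "f \<in> borel_measurable borel" and f1: "\<And>y. f y \<le> 1"
  shows "(\<integral>\<^sup>+y. f y \<partial>std_gaussian) \<le> (\<integral>\<^sup>+y. f (a + y) \<partial>std_gaussian) + ennreal ((norm a)\<^sup>2 / 2 + 2 * norm a)"
proof -
  let ?q = "\<lambda>y::real^2. 1 + ((y $ 1)\<^sup>2 + (y $ 2)\<^sup>2) / 2"
  have q: "0 \<le> ?q y" for y :: "real^2" by (simp add: add_nonneg_nonneg)
  have mass: "(\<integral>\<^sup>+y. ennreal (gauss_density y) \<partial>lborel) = 1"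
    using prob_space.emeasure_space_1[OF prob_space_std_gaussian]
    by (simp add: std_gaussian_eq emeasure_density)
  have "(\<integral>\<^sup>+y. f y \<partial>std_gaussian) = (\<integral>\<^sup>+y. ennreal (gauss_density y) * f y \<partial>lborel)"
    by (simp add: std_gaussian_eq nn_integral_density)
  also have "\<dots> \<le> (\<integral>\<^sup>+y. ennreal (gauss_density (y - a)) * f y
      + (ennreal ((norm a)\<^sup>2 / 2) * ennreal (gauss_density y) + ennreal (norm a) * ennreal (gauss_density y * ?q y)) \<partial>lborel)"
  proof (rule nn_integral_mono)
    fix y
    define R where "R = gauss_density y * ((norm a)\<^sup>2 / 2 + norm a * ?q y)"
    have R: "0 \<le> R" unfolding R_def using q[of y] by (intro mult_nonneg_nonneg add_nonneg_nonneg) auto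
    have "ennreal (gauss_density y) * f y \<le> ennreal (gauss_density (y - a) + R) * f y"
      unfolding R_def by (intro mult_right_mono ennreal_leI gauss_density_shift) auto
    also have "\<dots> = ennreal (gauss_density (y - a)) * f y + ennreal R * f y"
      using R by (simp add: ennreal_plus distrib_right)
    also have "\<dots> \<le> ennreal (gauss_density (y - a)) * f y + ennreal R * 1"
      by (intro add_mono mult_left_mono f1) auto
    also have "ennreal R * 1 = ennreal ((norm a)\<^sup>2 / 2) * ennreal (gauss_density y) + ennreal (norm a) * ennreal (gauss_density y * ?q y)"
    proof -
      have "R = (norm a)\<^sup>2 / 2 * gauss_density y + norm a * (gauss_density y * ?q y)"
        by (simp add: R_def algebra_simps)
      then show ?thesis
        using q[of y] ennreal_lincomb[of "(norm a)\<^sup>2 / 2" "gauss_density y" "norm a" "gauss_density y * ?q y"]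
        by (simp only: mult_1_right) (simp del: ennreal_plus)
    qed
    finally show "ennreal (gauss_density y) * f y \<le> ennreal (gauss_density (y - a)) * f y
      + (ennreal ((norm a)\<^sup>2 / 2) * ennreal (gauss_density y) + ennreal (norm a) * ennreal (gauss_density y * ?q y))" .
  qed
  also have "\<dots> = (\<integral>\<^sup>+y. ennreal (gauss_density (y - a)) * f y \<partial>lborel)
      + (ennreal ((norm a)\<^sup>2 / 2) * 1 + ennreal (norm a) * 2)"
    unfolding mass[symmetric] gauss_moment[symmetric]
    by (simp add: nn_integral_add nn_integral_cmult)
  also have "(\<integral>\<^sup>+y. ennreal (gauss_density (y - a)) * f y \<partial>lborel) = (\<integral>\<^sup>+y. ennreal (gauss_density y) * f (a + y) \<partial>lborel)"
    by (subst lborel_distr_plus[symmetric, of a], subst nn_integral_distr) auto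
  also have "\<dots> = (\<integral>\<^sup>+y. f (a + y) \<partial>std_gaussian)"
    by (simp add: std_gaussian_eq nn_integral_density)
  also have "ennreal ((norm a)\<^sup>2 / 2) * 1 + ennreal (norm a) * 2 = ennreal ((norm a)\<^sup>2 / 2 + 2 * norm a)"
    by (simp add: ennreal_plus ennreal_mult mult.commute)
  finally show ?thesis .
qed

lemma emeasure_lborel_torus: "emeasure lborel torus = ennreal (4 * pi\<^sup>2)"
  using emeasure_torm by (simp add: torm_def emeasure_restrict_space)

section \<open>The design law and the law of a sample\<close>

context
  fixes T0 T :: real
  assumes T: "0 < T0 \<and> T0 < T \<or> T0 = T \<and> T > 0"
begin

lemma sets_design_law [simp]: "sets (design_law T0 T) = sets borel"
proof -
  have *: "sets (return borel T \<Otimes>\<^sub>M uniform_measure lborel torus) = sets ((borel :: real measure) \<Otimes>\<^sub>M (borel :: (real^2) measure))"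
    by (intro sets_pair_measure_cong) auto
  show ?thesis
  proof (cases "T0 < T")
    case True then show ?thesis by (simp add: design_law_def)
  next
    case False
    then show ?thesis by (simp only: design_law_def if_False * borel_prod)
  qed
qed

lemma space_design_law [simp]: "space (design_law T0 T) = UNIV"
  using sets_eq_imp_space_eq[OF sets_design_law] by simp

lemma prob_uniform_torus: "prob_space (uniform_measure lborel torus)"
  by (rule prob_space_uniform_measure) (simp_all add: emeasure_lborel_torus)

lemma prob_space_design_law: "prob_space (design_law T0 T)"
proof (cases "T0 < T")
  case True
  have "emeasure lborel ({T0<..T} \<times> torus) = ennreal (T - T0) * ennreal (4 * pi\<^sup>2)"
    unfolding lborel_prod[symmetric]
    using True by (subst lborel.emeasure_pair_measure_Times) (auto simp: emeasure_lborel_torus)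
  then have "prob_space (uniform_measure lborel ({T0<..T} \<times> torus))"
    using True by (intro prob_space_uniform_measure) (auto simp: ennreal_mult_eq_top_iff)
  then show ?thesis using True by (simp add: design_law_def)
next
  case False
  interpret t: prob_space "return borel T" by (rule prob_space_return) simp
  interpret x: prob_space "uniform_measure lborel torus" by (rule prob_uniform_torus)
  interpret pair_prob_space "return borel T" "uniform_measure lborel torus" ..
  show ?thesis using False prob_space_axioms by (simp add: design_law_def)
qed

text \<open>For the uniform design this is Fubini's theorem; in the other case the design charges
  the single time \<open>T\<close>. A null set of exceptional times would be fatal there, hence the
  assumption for every time in the interval.\<close>

lemma AE_design_law:
  assumes m: "{p. P (fst p) (snd p)} \<in> sets borel"
    and ae: "\<And>t. t \<in> {T0..T} \<Longrightarrow> AE x in lborel. P t x"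
  shows "AE p in design_law T0 T. P (fst p) (snd p)"
proof (cases "T0 < T")
  case True
  have "AE p in (lborel :: (real \<times> (real^2)) measure). fst p \<in> {T0<..T} \<longrightarrow> P (fst p) (snd p)"
    unfolding lborel_prod[symmetric]
  proof (rule lborel_pair.AE_pair_measure)
    have "fst -` {T0<..T} \<in> sets (borel :: (real \<times> (real^2)) measure)"
      using measurable_sets[of fst "borel :: (real \<times> (real^2)) measure" borel "{T0<..T}"]
      by (simp add: borel_measurable_continuous_onI continuous_on_fst)
    then have "- (fst -` {T0<..T}) \<union> {p. P (fst p) (snd p)} \<in> sets borel" using m by auto
    moreover have "{p \<in> space (lborel \<Otimes>\<^sub>M lborel). fst p \<in> {T0<..T} \<longrightarrow> P (fst p) (snd p)}
      = - (fst -` {T0<..T}) \<union> {p. P (fst p) (snd p)}" by (auto simp: space_pair_measure)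
    ultimately show "{p \<in> space (lborel \<Otimes>\<^sub>M lborel). fst p \<in> {T0<..T} \<longrightarrow> P (fst p) (snd p)} \<in> sets (lborel \<Otimes>\<^sub>M lborel)"
      by (simp only: lborel_prod sets_lborel)
    show "AE t in lborel. AE x in lborel. fst (t, x) \<in> {T0<..T} \<longrightarrow> P (fst (t, x)) (snd (t, x))"
    proof (rule AE_I2)
      fix t :: real
      show "AE x in lborel. fst (t, x) \<in> {T0<..T} \<longrightarrow> P (fst (t, x)) (snd (t, x))"
        using ae[of t] by (cases "t \<in> {T0<..T}") simp_all
    qed
  qed
  then have "AE p in uniform_measure lborel ({T0<..T} \<times> torus). P (fst p) (snd p)"
    by (intro AE_uniform_measureI) (auto elim!: eventually_mono intro: borel_Times)
  moreover have "design_law T0 T = uniform_measure lborel ({T0<..T} \<times> torus)"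
    using True by (simp only: design_law_def if_True)
  ultimately show ?thesis by (simp only:)
next
  case False
  then have TT: "T0 = T" using T by auto
  interpret t: prob_space "return borel T" by (rule prob_space_return) simp
  interpret x: prob_space "uniform_measure lborel torus" by (rule prob_uniform_torus)
  interpret pair_prob_space "return borel T" "uniform_measure lborel torus" ..
  have eq: "design_law T0 T = return borel T \<Otimes>\<^sub>M uniform_measure lborel torus"
    using False by (simp only: design_law_def if_False)
  show ?thesis
    unfolding eq
  proof (rule AE_pair_measure)
    show "{p \<in> space (return borel T \<Otimes>\<^sub>M uniform_measure lborel torus). P (fst p) (snd p)} \<in> sets (return borel T \<Otimes>\<^sub>M uniform_measure lborel torus)"
      using m unfolding eq[symmetric] by simp
    have "AE x in uniform_measure lborel torus. P T x"
      using ae[of T] TT by (intro AE_uniform_measureI) (auto elim!: eventually_mono)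
    moreover have "AE t in return borel T. t = T"
      by (subst AE_return) auto
    ultimately show "AE t in return borel T. AE x in uniform_measure lborel torus. P (fst (t, x)) (snd (t, x))"
      by (auto elim!: eventually_mono)
  qed
qed


text \<open>The law of one observation of the zero solution, that is, of pure noise. It is the
  reference with which all other laws are compared.\<close>

definition obs_law :: "observation measure" where
  "obs_law = std_gaussian \<Otimes>\<^sub>M design_law T0 T"

definition shift_obs :: "(real \<Rightarrow> vfield) \<Rightarrow> observation \<Rightarrow> observation" where
  "shift_obs u = (\<lambda>(y, t, x). (u t x + y, t, x))"

lemma sets_obs_law [simp, measurable_cong]: "sets obs_law = sets borel"
proof -
  have "sets obs_law = sets ((borel :: (real^2) measure) \<Otimes>\<^sub>M (borel :: (real \<times> (real^2)) measure))"
    unfolding obs_law_def by (intro sets_pair_measure_cong) auto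
  then show ?thesis by (simp only: borel_prod)
qed

lemma prob_space_obs_law: "prob_space obs_law"
proof -
  interpret g: prob_space std_gaussian by (rule prob_space_std_gaussian)
  interpret d: prob_space "design_law T0 T" by (rule prob_space_design_law)
  interpret pair_prob_space std_gaussian "design_law T0 T" ..
  show ?thesis using prob_space_axioms by (simp add: obs_law_def)
qed

lemma shift_obs_measurable:
  assumes [measurable]: "(\<lambda>(t, x). u t x) \<in> borel_measurable borel"
  shows "shift_obs u \<in> borel_measurable borel"
proof -
  have [measurable]: "(\<lambda>p. u (fst p) (snd p)) \<in> borel_measurable (borel \<Otimes>\<^sub>M borel)"
    using assms by (simp add: case_prod_unfold borel_prod)
  have "(\<lambda>p. (u (fst (snd p)) (snd (snd p)) + fst p, snd p)) \<in> borel \<Otimes>\<^sub>M (borel \<Otimes>\<^sub>M borel) \<rightarrow>\<^sub>M borel \<Otimes>\<^sub>M (borel \<Otimes>\<^sub>M borel)"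
    by measurable
  then show ?thesis by (simp add: shift_obs_def case_prod_unfold borel_prod)
qed

text \<open>At a fixed design point the solution merely translates the Gaussian noise by a vector of
  length at most \<delta>, so the Gaussian estimate applies inside the integral over the
  design.\<close>

lemma obs_law_shift:
  assumes u: "(\<lambda>(t, x). u t x) \<in> borel_measurable borel"
    and small: "\<And>t. t \<in> {T0..T} \<Longrightarrow> AE x in lborel. norm (u t x) \<le> \<delta>"
    and f: "f \<in> borel_measurable borel" and f1: "\<And>z. f z \<le> 1"
  shows "(\<integral>\<^sup>+z. f z \<partial>obs_law) \<le> (\<integral>\<^sup>+z. f (shift_obs u z) \<partial>obs_law) + ennreal (\<delta>\<^sup>2 / 2 + 2 * \<delta>)"
proof -
  interpret g: prob_space std_gaussian by (rule prob_space_std_gaussian)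
  interpret d: prob_space "design_law T0 T" by (rule prob_space_design_law)
  interpret pair_prob_space std_gaussian "design_law T0 T" ..
  have f': "f \<in> borel_measurable (std_gaussian \<Otimes>\<^sub>M design_law T0 T)"
    using f measurable_cong_sets[OF sets_obs_law refl, of "borel :: ennreal measure"] by (simp add: obs_law_def)
  have fs: "(\<lambda>z. f (shift_obs u z)) \<in> borel_measurable (std_gaussian \<Otimes>\<^sub>M design_law T0 T)"
    using measurable_compose[OF shift_obs_measurable[OF u] f] measurable_cong_sets[OF sets_obs_law refl, of "borel :: ennreal measure"]
    by (simp add: obs_law_def)
  have "{p. norm ((\<lambda>(t, x). u t x) p) \<le> \<delta>} \<in> sets borel"
    using u by measurable
  then have ae: "AE p in design_law T0 T. norm (u (fst p) (snd p)) \<le> \<delta>"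
    by (intro AE_design_law small) (simp_all add: case_prod_unfold)
  have "(\<integral>\<^sup>+z. f z \<partial>obs_law) = (\<integral>\<^sup>+p. \<integral>\<^sup>+y. f (y, p) \<partial>std_gaussian \<partial>design_law T0 T)"
    unfolding obs_law_def by (rule nn_integral_snd[OF f', symmetric])
  also have "\<dots> \<le> (\<integral>\<^sup>+p. (\<integral>\<^sup>+y. f (shift_obs u (y, p)) \<partial>std_gaussian) + ennreal (\<delta>\<^sup>2 / 2 + 2 * \<delta>) \<partial>design_law T0 T)"
  proof (rule nn_integral_mono_AE)
    show "AE p in design_law T0 T. (\<integral>\<^sup>+y. f (y, p) \<partial>std_gaussian)
        \<le> (\<integral>\<^sup>+y. f (shift_obs u (y, p)) \<partial>std_gaussian) + ennreal (\<delta>\<^sup>2 / 2 + 2 * \<delta>)"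
      using ae
    proof eventually_elim
      case (elim p)
      have "(\<lambda>y. (y, p)) \<in> borel_measurable borel"
        by (intro borel_measurable_continuous_onI continuous_intros)
      then have "(\<integral>\<^sup>+y. f (y, p) \<partial>std_gaussian) \<le> (\<integral>\<^sup>+y. f (u (fst p) (snd p) + y, p) \<partial>std_gaussian)
          + ennreal ((norm (u (fst p) (snd p)))\<^sup>2 / 2 + 2 * norm (u (fst p) (snd p)))"
        using f by (intro std_gaussian_shift f1) (rule measurable_compose)
      also have "\<dots> \<le> (\<integral>\<^sup>+y. f (u (fst p) (snd p) + y, p) \<partial>std_gaussian) + ennreal (\<delta>\<^sup>2 / 2 + 2 * \<delta>)"
      proof (intro add_left_mono ennreal_leI add_mono)
        show "(norm (u (fst p) (snd p)))\<^sup>2 / 2 \<le> \<delta>\<^sup>2 / 2" using elim by (intro divide_right_mono power_mono) auto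
      qed (use elim in auto)
      finally show ?case by (simp add: shift_obs_def case_prod_unfold)
    qed
  qed
  also have "\<dots> = (\<integral>\<^sup>+p. (\<integral>\<^sup>+y. f (shift_obs u (y, p)) \<partial>std_gaussian) \<partial>design_law T0 T) + ennreal (\<delta>\<^sup>2 / 2 + 2 * \<delta>)"
  proof (subst nn_integral_add)
    show "(\<lambda>p. \<integral>\<^sup>+y. f (shift_obs u (y, p)) \<partial>std_gaussian) \<in> borel_measurable (design_law T0 T)"
      using g.borel_measurable_nn_integral_fst[OF measurable_pair_swap[OF fs]] by simp
  qed (simp_all add: d.emeasure_space_1[unfolded space_design_law])
  also have "(\<integral>\<^sup>+p. (\<integral>\<^sup>+y. f (shift_obs u (y, p)) \<partial>std_gaussian) \<partial>design_law T0 T) = (\<integral>\<^sup>+z. f (shift_obs u z) \<partial>obs_law)"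
    unfolding obs_law_def by (rule nn_integral_snd[OF fs])
  finally show ?thesis .
qed

text \<open>The observations are shifted one coordinate at a time, each at the cost of a single
  observation. Integrating out the coordinate already shifted leaves a measurable function with
  values at most one again, which is why the induction runs over all such \<open>f\<close>.\<close>

lemma product_law_shift:
  assumes u: "(\<lambda>(t, x). u t x) \<in> borel_measurable borel"
    and small: "\<And>t. t \<in> {T0..T} \<Longrightarrow> AE x in lborel. norm (u t x) \<le> \<delta>" and \<delta>: "0 \<le> \<delta>"
    and J: "finite J"
    and f: "f \<in> borel_measurable (Pi\<^sub>M J (\<lambda>_. obs_law))" and f1: "\<And>z. f z \<le> 1"
  shows "(\<integral>\<^sup>+z. f z \<partial>Pi\<^sub>M J (\<lambda>_. obs_law))
    \<le> (\<integral>\<^sup>+z. f (\<lambda>i\<in>J. shift_obs u (z i)) \<partial>Pi\<^sub>M J (\<lambda>_. obs_law)) + ennreal (real (card J) * (\<delta>\<^sup>2 / 2 + 2 * \<delta>))"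
  using J f f1
proof (induction J arbitrary: f rule: finite_induct)
  case empty
  then show ?case by (simp add: PiM_empty nn_integral_count_space_finite restrict_def)
next
  case (insert i J)
  interpret p: prob_space obs_law by (rule prob_space_obs_law)
  interpret product_prob_space "\<lambda>_. obs_law" UNIV ..
  define \<eta> where "\<eta> = \<delta>\<^sup>2 / 2 + 2 * \<delta>"
  have \<eta>: "0 \<le> \<eta>" using \<delta> by (simp add: \<eta>_def)
  have s [measurable]: "shift_obs u \<in> obs_law \<rightarrow>\<^sub>M obs_law"
    using shift_obs_measurable[OF u] by (simp cong: measurable_cong_sets)
  note [measurable] = insert.prems(1)
  have fub: "(\<integral>\<^sup>+z. F z \<partial>Pi\<^sub>M (insert i J) (\<lambda>_. obs_law)) = (\<integral>\<^sup>+x. (\<integral>\<^sup>+y. F (x(i := y)) \<partial>obs_law) \<partial>Pi\<^sub>M J (\<lambda>_. obs_law))"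
    if "F \<in> borel_measurable (Pi\<^sub>M (insert i J) (\<lambda>_. obs_law))" for F
    using product_nn_integral_insert[OF insert.hyps(1,2) that] .
  have upd: "(\<lambda>p. f ((fst p)(i := h (snd p)))) \<in> borel_measurable (Pi\<^sub>M J (\<lambda>_. obs_law) \<Otimes>\<^sub>M obs_law)"
    if h: "h \<in> obs_law \<rightarrow>\<^sub>M obs_law" for h
  proof -
    have "(\<lambda>p. (fst p, h (snd p))) \<in> Pi\<^sub>M J (\<lambda>_. obs_law) \<Otimes>\<^sub>M obs_law \<rightarrow>\<^sub>M Pi\<^sub>M J (\<lambda>_. obs_law) \<Otimes>\<^sub>M obs_law"
      using h by measurable
    from measurable_compose[OF measurable_compose[OF this measurable_add_dim] insert.prems(1)]
    show ?thesis by (simp only: case_prod_conv)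
  qed
  define g where "g x = (\<integral>\<^sup>+y. f (x(i := shift_obs u y)) \<partial>obs_law)" for x
  have g_meas: "g \<in> borel_measurable (Pi\<^sub>M J (\<lambda>_. obs_law))"
    unfolding g_def using p.borel_measurable_nn_integral_fst[OF upd[OF s]] by simp
  have g1: "g x \<le> 1" for x
  proof -
    have "g x \<le> (\<integral>\<^sup>+y. 1 \<partial>obs_law)" unfolding g_def by (intro nn_integral_mono insert.prems)
    then show ?thesis by (simp add: p.emeasure_space_1)
  qed
  have restr: "(\<lambda>j\<in>insert i J. shift_obs u ((x(i := y)) j)) = (\<lambda>j\<in>J. shift_obs u (x j))(i := shift_obs u y)" for x y
    using insert.hyps(2) by (auto simp: fun_eq_iff)
  have fr: "(\<lambda>z. f (\<lambda>j\<in>insert i J. shift_obs u (z j))) \<in> borel_measurable (Pi\<^sub>M (insert i J) (\<lambda>_. obs_law))"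
    by measurable
  have "(\<integral>\<^sup>+z. f z \<partial>Pi\<^sub>M (insert i J) (\<lambda>_. obs_law)) = (\<integral>\<^sup>+x. (\<integral>\<^sup>+y. f (x(i := y)) \<partial>obs_law) \<partial>Pi\<^sub>M J (\<lambda>_. obs_law))"
    by (rule fub[OF insert.prems(1)])
  also have "\<dots> \<le> (\<integral>\<^sup>+x. g x + ennreal \<eta> \<partial>Pi\<^sub>M J (\<lambda>_. obs_law))"
  proof (rule nn_integral_mono)
    fix x assume x: "x \<in> space (Pi\<^sub>M J (\<lambda>_. obs_law))"
    have "(\<lambda>y. f (x(i := y))) \<in> borel_measurable obs_law"
      using measurable_Pair2[OF upd[of "\<lambda>y. y"] x] by simp
    then have "(\<lambda>y. f (x(i := y))) \<in> borel_measurable borel" by (simp cong: measurable_cong_sets)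
    then show "(\<integral>\<^sup>+y. f (x(i := y)) \<partial>obs_law) \<le> g x + ennreal \<eta>"
      unfolding g_def \<eta>_def by (intro obs_law_shift u small insert.prems)
  qed
  also have "\<dots> = (\<integral>\<^sup>+x. g x \<partial>Pi\<^sub>M J (\<lambda>_. obs_law)) + ennreal \<eta>"
    using prob_space.emeasure_space_1[OF prob_space_PiM[of J "\<lambda>_. obs_law"]] prob_space_obs_law
    by (subst nn_integral_add[OF g_meas]) auto
  also have "\<dots> \<le> ((\<integral>\<^sup>+x. g (\<lambda>j\<in>J. shift_obs u (x j)) \<partial>Pi\<^sub>M J (\<lambda>_. obs_law)) + ennreal (real (card J) * \<eta>)) + ennreal \<eta>"
    unfolding \<eta>_def by (intro add_right_mono insert.IH g_meas g1)
  also have "\<dots> = (\<integral>\<^sup>+x. g (\<lambda>j\<in>J. shift_obs u (x j)) \<partial>Pi\<^sub>M J (\<lambda>_. obs_law)) + ennreal (real (card (insert i J)) * \<eta>)"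
    using \<eta> insert.hyps by (simp add: add.assoc ennreal_plus[symmetric] distrib_right add.commute del: ennreal_plus)
  also have "(\<integral>\<^sup>+x. g (\<lambda>j\<in>J. shift_obs u (x j)) \<partial>Pi\<^sub>M J (\<lambda>_. obs_law))
      = (\<integral>\<^sup>+z. f (\<lambda>j\<in>insert i J. shift_obs u (z j)) \<partial>Pi\<^sub>M (insert i J) (\<lambda>_. obs_law))"
    unfolding fub[OF fr] g_def restr ..
  finally show ?case unfolding \<eta>_def .
qed

text \<open>\<open>data_law\<close> is the image of the pure noise law under the coordinatewise
  shift, so the product estimate for an indicator applies: an event likely under pure noise stays
  likely when a small solution is observed.\<close>

lemma emeasure_data_law_ge:
  assumes u: "(\<lambda>(t, x). u t x) \<in> borel_measurable borel"
    and small: "\<And>t. t \<in> {T0..T} \<Longrightarrow> AE x in lborel. norm (u t x) \<le> \<delta>" and \<delta>: "0 \<le> \<delta>"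
    and A: "A \<in> sets (sample_space N)"
  shows "emeasure (Pi\<^sub>M {..<N} (\<lambda>_. obs_law)) A
    \<le> emeasure (data_law T0 T u N) A + ennreal (real N * (\<delta>\<^sup>2 / 2 + 2 * \<delta>))"
proof -
  have sets: "sets (Pi\<^sub>M {..<N} (\<lambda>_. obs_law)) = sets (sample_space N)"
    unfolding sample_space_def by (intro sets_PiM_cong) auto
  have A': "A \<in> sets (Pi\<^sub>M {..<N} (\<lambda>_. obs_law))" using A sets by simp
  have [measurable]: "shift_obs u \<in> obs_law \<rightarrow>\<^sub>M obs_law"
    using shift_obs_measurable[OF u] by (simp cong: measurable_cong_sets)
  let ?F = "\<lambda>z. \<lambda>i\<in>{..<N}. shift_obs u (z i)"
  have F: "?F \<in> Pi\<^sub>M {..<N} (\<lambda>_. obs_law) \<rightarrow>\<^sub>M Pi\<^sub>M {..<N} (\<lambda>_. obs_law)" by measurable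
  then have F': "?F \<in> Pi\<^sub>M {..<N} (\<lambda>_. obs_law) \<rightarrow>\<^sub>M sample_space N"
    using measurable_cong_sets[OF refl sets] by blast
  have eq: "data_law T0 T u N = distr (Pi\<^sub>M {..<N} (\<lambda>_. obs_law)) (sample_space N) ?F"
    unfolding data_law_def obs_law_def shift_obs_def by (simp add: case_prod_unfold)
  have "emeasure (Pi\<^sub>M {..<N} (\<lambda>_. obs_law)) A = (\<integral>\<^sup>+z. indicator A z \<partial>Pi\<^sub>M {..<N} (\<lambda>_. obs_law))"
    using A' by simp
  also have "\<dots> \<le> (\<integral>\<^sup>+z. indicator A (?F z) \<partial>Pi\<^sub>M {..<N} (\<lambda>_. obs_law)) + ennreal (real (card {..<N}) * (\<delta>\<^sup>2 / 2 + 2 * \<delta>))"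
    by (rule product_law_shift[OF u small \<delta>]) (use A' in \<open>auto simp: indicator_def\<close>)
  also have "(\<integral>\<^sup>+z. indicator A (?F z) \<partial>Pi\<^sub>M {..<N} (\<lambda>_. obs_law)) = (\<integral>\<^sup>+z. indicator A z \<partial>data_law T0 T u N)"
    unfolding eq using A by (subst nn_integral_distr[OF F']) auto
  also have "\<dots> = emeasure (data_law T0 T u N) A"
    using A by (simp add: data_law_def)
  finally show ?thesis by simp
qed

end

section \<open>The lower bound\<close>

lemma V_norm_nonneg: "0 \<le> V_norm u"
  unfolding V_norm_def by (intro real_sqrt_ge_zero sum_nonneg) simp

text \<open>Estimators are measurable for the sigma-algebra of \<open>V_norm\<close>; Poincare's
  inequality makes the loss Lipschitz in that norm.\<close>

lemma L2_dist_measurable: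
  assumes \<theta>: "\<theta> \<in> V_space"
  shows "(\<lambda>v. L2_norm (v - \<theta>)) \<in> borel_measurable (borel_of_norm V_space V_norm)"
proof (rule Lipschitz_borel_of_norm[where C=1])
  fix u v assume u: "u \<in> V_space" and v: "v \<in> V_space"
  have tri: "L2_norm (\<lambda>x. p x - \<theta> x) - L2_norm (\<lambda>x. q x - \<theta> x) \<le> L2_norm (\<lambda>x. p x - q x)"
    if "p \<in> V_space" "q \<in> V_space" for p q
    using L2_norm_triangle_diff[OF V_L2[OF that(1)] V_L2[OF that(2)] V_L2[OF \<theta>]] by simp
  have "L2_norm (\<lambda>x. v x - u x) \<le> V_norm (\<lambda>x. v x - u x)"
    by (rule poincare_V[OF V_diff[OF v u]])
  then show "\<bar>L2_norm (v - \<theta>) - L2_norm (u - \<theta>)\<bar> \<le> 1 * V_norm (v - u)"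
    using tri[OF u v] tri[OF v u] L2_norm_minus_commute[of u v] by (simp add: fun_diff_def)
qed (simp_all add: V_norm_nonneg)

lemma error_event_measurable:
  assumes "est \<in> estimators N" "\<theta> \<in> V_space"
  shows "{z \<in> space (sample_space N). L2_norm (est z - \<theta>) > r} \<in> sets (sample_space N)"
proof -
  have "(\<lambda>z. L2_norm (est z - \<theta>)) \<in> borel_measurable (sample_space N)"
    using assms(1) L2_dist_measurable[OF assms(2)] unfolding estimators_def by (rule measurable_compose)
  then show ?thesis by measurable
qed

lemma ns_solution_shear:
  assumes "k \<noteq> 0"
  shows "strong_solution (1/2) (\<lambda>_ _. 0) T (shear c k) (ns_solution (1/2) (\<lambda>_ _. 0) T (shear c k))"
  unfolding ns_solution_def
  by (rule someI[where P="strong_solution (1/2) (\<lambda>_ _. 0) T (shear c k)", OF shear_strong_solution[OF assms]])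

text \<open>Both risks are compared with the pure noise law, under which the two error events cover
  the sample space and so have total mass at least one. The zero field enters as the shear flow of
  amplitude zero, to which the same uniqueness theorem applies with \<delta> equal to zero; only the
  other hypothesis leaves an error term.\<close>

lemma two_point_bound:
  assumes T: "0 < T0 \<and> T0 < T \<or> T0 = T \<and> T > 0" and k: "k \<noteq> 0"
    and est: "est \<in> estimators N" and r: "2 * r < \<bar>c\<bar> * (sqrt 2 * pi)"
  defines "\<delta> \<equiv> \<bar>c\<bar> * exp (- (real_of_int k)\<^sup>2 * T0 / 2)"
  defines "risk \<equiv> \<lambda>\<theta>. emeasure (data_law T0 T (ns_solution (1/2) (\<lambda>_ _. 0) T \<theta>) N)
          {z \<in> space (sample_space N). L2_norm (est z - \<theta>) > r}"
  shows "1 \<le> risk (shear 0 k) + risk (shear c k) + ennreal (real N * (\<delta>\<^sup>2 / 2 + 2 * \<delta>))"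
proof -
  let ?Q = "Pi\<^sub>M {..<N} (\<lambda>_. obs_law T0 T)"
  define A where "A \<theta> = {z \<in> space (sample_space N). L2_norm (est z - \<theta>) > r}" for \<theta>
  have A: "A (shear a k) \<in> sets (sample_space N)" for a
    unfolding A_def by (rule error_event_measurable[OF est shear_V])
  have sets: "sets ?Q = sets (sample_space N)"
    unfolding sample_space_def using T by (intro sets_PiM_cong) (auto simp: sets_obs_law)
  have prob: "prob_space ?Q" by (rule prob_space_PiM) (rule prob_space_obs_law[OF T])
  have bound: "emeasure ?Q (A (shear a k)) \<le> risk (shear a k) + ennreal (real N * (d\<^sup>2 / 2 + 2 * d))"
    if d: "d = \<bar>a\<bar> * exp (- (real_of_int k)\<^sup>2 * T0 / 2)" for a d
    unfolding risk_def A_def[symmetric]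
  proof (rule emeasure_data_law_ge[OF T _ _ _ A])
    note sol = ns_solution_shear[OF k, of T a]
    show "(\<lambda>(t, x). ns_solution (1/2) (\<lambda>_ _. 0) T (shear a k) t x) \<in> borel_measurable borel"
      using sol by (simp add: strong_solution_def)
    fix t assume t: "t \<in> {T0..T}"
    then have t0: "t \<in> {0..T}" "0 \<le> T0" using T by auto
    have "AE x in lborel. ns_solution (1/2) (\<lambda>_ _. 0) T (shear a k) t x = shear (shear_decay a k t) k x"
      using shear_unique[OF k sol t0(1)] by (simp add: ae_eq_def)
    then show "AE x in lborel. norm (ns_solution (1/2) (\<lambda>_ _. 0) T (shear a k) t x) \<le> d"
    proof eventually_elim
      case (elim x)
      have "norm (shear (shear_decay a k t) k x) \<le> \<bar>shear_decay a k t\<bar>" by (rule shear_norm_le)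
      also have "\<dots> \<le> d" unfolding d by (rule shear_decay_le) (use t t0 in auto)
      finally show ?case by (simp add: elim)
    qed
  qed (simp add: d)
  \<comment> \<open>The two parameters are more than \<open>2 * r\<close> apart, so no estimate is
    within \<open>r\<close> of both.\<close>
  have cover: "space (sample_space N) \<subseteq> A (shear 0 k) \<union> A (shear c k)"
  proof
    fix z assume z: "z \<in> space (sample_space N)"
    then have eV: "est z \<in> V_space"
      using measurable_space[of est "sample_space N" "borel_of_norm V_space V_norm" z] est by (simp add: estimators_def)
    have "L2_norm (\<lambda>x. shear c k x - shear 0 k x) \<le> L2_norm (\<lambda>x. shear c k x - est z x) + L2_norm (\<lambda>x. est z x - shear 0 k x)"
      by (intro L2_norm_triangle_diff shear_L2 V_L2 eV)
    then have "\<bar>c\<bar> * (sqrt 2 * pi) \<le> L2_norm (\<lambda>x. est z x - shear c k x) + L2_norm (\<lambda>x. est z x - shear 0 k x)"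
      by (simp add: shear_diff L2_norm_shear k L2_norm_minus_commute[of "shear c k" "est z"])
    then have "L2_norm (est z - shear c k) > r \<or> L2_norm (est z - shear 0 k) > r"
      using r unfolding fun_diff_def by linarith
    then show "z \<in> A (shear 0 k) \<union> A (shear c k)" using z by (auto simp: A_def)
  qed
  have "1 = emeasure ?Q (space ?Q)" using prob_space.emeasure_space_1[OF prob] by simp
  also have "\<dots> \<le> emeasure ?Q (A (shear 0 k) \<union> A (shear c k))"
    using cover A sets sets_eq_imp_space_eq[OF sets] by (intro emeasure_mono) auto
  also have "\<dots> \<le> emeasure ?Q (A (shear 0 k)) + emeasure ?Q (A (shear c k))"
    using A sets by (intro emeasure_subadditive) auto
  also have "\<dots> \<le> risk (shear 0 k) + (risk (shear c k) + ennreal (real N * (\<delta>\<^sup>2 / 2 + 2 * \<delta>)))"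
    using bound[of 0 0] bound[of \<delta> c] by (intro add_mono) (simp_all add: \<delta>_def)
  finally show ?thesis by (simp add: add.assoc)
qed

text \<open>The larger of the two risks is at least half of what remains of the total mass,
  \<open>(1 - 1/4) / 2\<close>, and this exceeds \<open>1/4\<close>.\<close>

lemma ennreal_half_bound:
  fixes s a b :: ennreal
  assumes "1 \<le> a + b + ennreal \<eta>" "a \<le> s" "b \<le> s" "\<eta> \<le> 1/4"
  shows "ennreal (3/8) \<le> s"
proof (cases s)
  case (real x)
  have "1 \<le> s + s + ennreal (1/4)"
    using assms by (meson add_mono ennreal_leI order_trans)
  also have "\<dots> = ennreal (x + x + 1/4)" using real by (simp add: ennreal_plus[symmetric] del: ennreal_plus)
  finally have "1 \<le> x + x + 1/4" by (simp only: ennreal_1[symmetric]) (subst (asm) ennreal_le_iff, use real in auto)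
  then show ?thesis using real by (simp add: ennreal_leI)
qed simp

theorem theorem4:
  fixes U T0 T :: real
  assumes "U > 0" and "0 < T0 \<and> T0 < T \<or> T0 = T \<and> T > 0"
  shows "\<exists>c::real. c > 0 \<and>
    liminf (\<lambda>N. INF est \<in> estimators N.
      SUP \<theta> \<in> {\<theta> \<in> V_space. \<theta> \<in> H2_space \<and> H2_norm \<theta> \<le> U}.
        emeasure (data_law T0 T (ns_solution (1/2) (\<lambda>_ _. 0) T \<theta>) N)
          {z \<in> space (sample_space N). L2_norm (est z - \<theta>) > c / ln (real N)}) > 1/4"
proof -
  have U: "U > 0" by fact
  have T0: "T0 > 0" using assms(2) by auto
  \<comment> \<open>The amplitude chosen below is \<open>U / (10 * k\<^sup>2)\<close> with
    \<open>k\<^sup>2 \<le> (8 / T0 + 2) * ln N\<close>, hence at least \<open>2 * c / ln N\<close>,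
    twice the error radius. The constant is a function of \<open>U\<close> and
    \<open>T0\<close>.\<close>
  define c where "c = U / (20 * (8 / T0 + 2))"
  have c: "c > 0" using U T0 by (simp add: c_def add_pos_pos)
  define \<Theta> where "\<Theta> = {\<theta> \<in> V_space. \<theta> \<in> H2_space \<and> H2_norm \<theta> \<le> U}"
  define risk where "risk N est \<theta> = emeasure (data_law T0 T (ns_solution (1/2) (\<lambda>_ _. 0) T \<theta>) N)
          {z \<in> space (sample_space N). L2_norm (est z - \<theta>) > c / ln (real N)}" for N est \<theta>
  \<comment> \<open>The threshold \<open>exp 1\<close> makes the logarithm at least one; the other
    brings the cost of the comparison with pure noise down to \<open>1/4\<close>.\<close>
  have lower: "ennreal (3/8) \<le> (INF est \<in> estimators N. SUP \<theta> \<in> \<Theta>. risk N est \<theta>)"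
    if N: "real N \<ge> exp 1" "real N \<ge> 2 * U\<^sup>2 + 8 * U" for N
  proof (rule INF_greatest)
    fix est assume est: "est \<in> estimators N"
    have N1: "real N \<ge> 1" using N(1) exp_ge_add_one_self[of 1] by linarith
    define l where "l = ln (real N)"
    have l: "l \<ge> 1" using N(1) ln_mono[of "exp 1" "real N"] by (simp add: l_def)
    \<comment> \<open>The least integer with \<open>4 * l / T0 \<le> k\<^sup>2\<close>, that is,
      with a damping factor of at most \<open>1 / N\<^sup>2\<close> at time
      \<open>T0\<close>.\<close>
    define k where "k = \<lceil>sqrt (4 * l / T0)\<rceil>"
    have sq: "0 < sqrt (4 * l / T0)" using l T0 by simp
    then have k0: "0 < k" by (simp add: k_def)
    have k1: "1 \<le> real_of_int k" using k0 by linarith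
    have k_lo: "sqrt (4 * l / T0) \<le> k" by (simp add: k_def)
    have k_hi: "k \<le> sqrt (4 * l / T0) + 1" unfolding k_def by linarith
    have "(sqrt (4 * l / T0))\<^sup>2 \<le> (real_of_int k)\<^sup>2" using k_lo sq by (intro power_mono) auto
    then have k2_lo: "4 * l / T0 \<le> (real_of_int k)\<^sup>2" using l T0 by simp
    have k2_hi: "(real_of_int k)\<^sup>2 \<le> (8 / T0 + 2) * l"
    proof -
      have "(real_of_int k)\<^sup>2 \<le> (sqrt (4 * l / T0) + 1)\<^sup>2" using k_hi k1 by (intro power_mono) auto
      also have "\<dots> \<le> 2 * (sqrt (4 * l / T0))\<^sup>2 + 2 * 1\<^sup>2"
        using sum_squares_bound[of "sqrt (4 * l / T0)" 1] by (simp add: power2_sum)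
      also have "\<dots> = 8 / T0 * l + 2" using l T0 by simp
      also have "\<dots> \<le> (8 / T0 + 2) * l" using l by (simp add: distrib_right)
      finally show ?thesis .
    qed
    have kpos: "0 < (real_of_int k)\<^sup>2" using k1 by simp
    define a where "a = U / (10 * (real_of_int k)\<^sup>2)"
    have a: "a > 0" using U kpos by (simp add: a_def)
    define \<delta> where "\<delta> = \<bar>a\<bar> * exp (- (real_of_int k)\<^sup>2 * T0 / 2)"
    have sep: "2 * (c / ln (real N)) < \<bar>a\<bar> * (sqrt 2 * pi)"
    proof -
      have D: "2 * (U / (20 * D) / l) = U / (10 * (D * l))" if "D > 0" for D
        using that l by (simp add: field_simps)
      have "2 * (c / ln (real N)) = U / (10 * ((8 / T0 + 2) * l))"
        unfolding c_def l_def[symmetric] using T0 by (intro D add_pos_pos) auto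
      also have "\<dots> \<le> a"
        unfolding a_def using U k2_hi kpos l T0 by (intro divide_left_mono mult_left_mono mult_pos_pos add_pos_pos) auto
      \<comment> \<open>The strict inequality comes from the norm \<open>sqrt 2 * pi\<close> of the
        shear flow of amplitude one.\<close>
      also have "a < a * (sqrt 2 * pi)"
      proof -
        have "1 * 1 < sqrt 2 * pi" using pi_gt3 by (intro mult_strict_mono) auto
        then show ?thesis using a by simp
      qed
      finally show ?thesis using a by simp
    qed
    \<comment> \<open>From \<open>\<delta> \<le> U\<close> the square is absorbed into the linear
      term, and \<open>\<delta> \<le> U / N\<^sup>2\<close> leaves a total of order
      \<open>1 / N\<close>; the second threshold for \<open>N\<close> is read off from the
      constant.\<close>
    have small: "real N * (\<delta>\<^sup>2 / 2 + 2 * \<delta>) \<le> 1/4"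
    proof -
      have "2 * l \<le> (real_of_int k)\<^sup>2 * T0 / 2" using k2_lo T0 by (simp add: field_simps)
      then have "exp (- (real_of_int k)\<^sup>2 * T0 / 2) \<le> exp (- (2 * l))" by simp
      also have "exp (- (2 * l)) = 1 / (real N)\<^sup>2"
        using N1 by (simp add: l_def exp_minus exp_double inverse_eq_divide)
      finally have "\<bar>a\<bar> * exp (- (real_of_int k)\<^sup>2 * T0 / 2) \<le> \<bar>a\<bar> * (1 / (real N)\<^sup>2)"
        by (rule mult_left_mono) simp
      then have "\<delta> \<le> a * (1 / (real N)\<^sup>2)" unfolding \<delta>_def using a by simp
      also have "\<dots> \<le> U * (1 / (real N)\<^sup>2)"
      proof (rule mult_right_mono)
        have "1 \<le> 10 * (real_of_int k)\<^sup>2" using power_mono[OF k1, of 2] by simp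
        then show "a \<le> U" unfolding a_def using U kpos by (simp add: field_simps)
      qed simp
      finally have \<delta>1: "\<delta> \<le> U / (real N)\<^sup>2" by simp
      have \<delta>0: "0 \<le> \<delta>" by (simp add: \<delta>_def)
      have N2: "1 \<le> (real N)\<^sup>2" using power_mono[OF N1, of 2] by simp
      then have "U / (real N)\<^sup>2 \<le> U" using divide_left_mono[of 1 "(real N)\<^sup>2" U] U N1 by simp
      then have "\<delta> \<le> U" using \<delta>1 by simp
      then have "\<delta>\<^sup>2 \<le> U * \<delta>" using \<delta>0 by (simp add: power2_eq_square mult_right_mono)
      then have "\<delta>\<^sup>2 / 2 + 2 * \<delta> \<le> (U / 2 + 2) * \<delta>" by (simp add: algebra_simps)
      also have "\<dots> \<le> (U / 2 + 2) * (U / (real N)\<^sup>2)" using U \<delta>1 by (intro mult_left_mono) auto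
      finally have "real N * (\<delta>\<^sup>2 / 2 + 2 * \<delta>) \<le> real N * ((U / 2 + 2) * (U / (real N)\<^sup>2))"
        by (intro mult_left_mono) auto
      also have "\<dots> = (2 * U\<^sup>2 + 8 * U) / 4 / real N"
        using N1 by (simp add: field_simps power2_eq_square)
      also have "\<dots> \<le> 1/4" using N(2) N1 by (simp add: field_simps)
      finally show ?thesis .
    qed
    \<comment> \<open>The origin of the factor \<open>10\<close> in \<open>a\<close>: with
      \<open>x = k\<^sup>2\<close> at least one,
      \<open>1 + x + x\<^sup>2 \<le> 3 * x\<^sup>2\<close>, and
      \<open>3 * 2 * 4\<^sup>2 = 96\<close> is below \<open>10\<^sup>2\<close>.\<close>
    have H2: "H2_norm (shear b k) \<le> U" if b: "\<bar>b\<bar> \<le> a" for b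
    proof -
      let ?x = "(real_of_int k)\<^sup>2"
      have x1: "1 \<le> ?x" using power_mono[OF k1, of 2] by simp
      have "sqrt (1 + k\<^sup>2 + k^4) * sqrt 2 * pi \<le> 10 * ?x"
      proof (rule power2_le_imp_le)
        have "(1 + ?x + ?x\<^sup>2) * 2 * pi\<^sup>2 \<le> (3 * ?x\<^sup>2) * 2 * 4\<^sup>2"
        proof (intro mult_mono power_mono)
          show "1 + ?x + ?x\<^sup>2 \<le> 3 * ?x\<^sup>2"
            using x1 mult_left_mono[OF x1, of ?x] by (simp add: power2_eq_square[of ?x])
          show "pi \<le> 4" using pi_less_4 by simp
        qed auto
        also have "\<dots> \<le> (10 * ?x)\<^sup>2" by (simp add: power_mult_distrib)
        finally show "(sqrt (1 + k\<^sup>2 + k^4) * sqrt 2 * pi)\<^sup>2 \<le> (10 * ?x)\<^sup>2"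
          by (simp add: power_mult_distrib power_mult[symmetric] del: real_sqrt_mult)
      qed simp
      from mult_mono[OF b this] have "\<bar>b\<bar> * (sqrt (1 + k\<^sup>2 + k^4) * sqrt 2 * pi) \<le> a * (10 * ?x)"
        using a by simp
      also have "\<dots> = U" using kpos by (simp add: a_def)
      finally show ?thesis using k0 by (simp add: H2_norm_shear)
    qed
    have mem: "shear b k \<in> \<Theta>" if "\<bar>b\<bar> \<le> a" for b
      unfolding \<Theta>_def using H2[OF that] shear_V shear_H2 by auto
    show "ennreal (3/8) \<le> (SUP \<theta> \<in> \<Theta>. risk N est \<theta>)"
    proof (rule ennreal_half_bound[OF _ _ _ small])
      show "1 \<le> risk N est (shear 0 k) + risk N est (shear a k) + ennreal (real N * (\<delta>\<^sup>2 / 2 + 2 * \<delta>))"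
        unfolding risk_def \<delta>_def using k0 by (intro two_point_bound assms(2) est sep) simp
      show "risk N est (shear 0 k) \<le> (SUP \<theta> \<in> \<Theta>. risk N est \<theta>)"
        "risk N est (shear a k) \<le> (SUP \<theta> \<in> \<Theta>. risk N est \<theta>)"
        using a by (auto intro!: SUP_upper mem)
    qed
  qed
  have "\<forall>\<^sub>F N in sequentially. ennreal (3/8) \<le> (INF est \<in> estimators N. SUP \<theta> \<in> \<Theta>. risk N est \<theta>)"
    using eventually_ge_at_top[of "nat \<lceil>exp 1 + (2 * U\<^sup>2 + 8 * U)\<rceil>"]
  proof eventually_elim
    case (elim N)
    then have "exp 1 + (2 * U\<^sup>2 + 8 * U) \<le> real N" by linarith
    moreover have "0 \<le> 2 * U\<^sup>2 + 8 * U" "0 \<le> exp (1::real)" using U by auto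
    ultimately show ?case by (intro lower) linarith+
  qed
  then have "ennreal (3/8) \<le> liminf (\<lambda>N. INF est \<in> estimators N. SUP \<theta> \<in> \<Theta>. risk N est \<theta>)"
    by (rule Liminf_bounded)
  moreover have "1 / 4 < ennreal (3/8)"
  proof -
    have "ennreal 1 / ennreal 4 = ennreal (1/4)" by (rule divide_ennreal) auto
    then have "1 / 4 = ennreal (1/4)" by simp
    also have "\<dots> < ennreal (3/8)" by (rule ennreal_lessI) auto
    finally show ?thesis .
  qed
  ultimately have "1 / 4 < liminf (\<lambda>N. INF est \<in> estimators N. SUP \<theta> \<in> \<Theta>. risk N est \<theta>)"
    by (rule less_le_trans[rotated])
  then show ?thesis using c unfolding \<Theta>_def risk_def by blast
qed

end
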